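(* $\mathrm{Frac}\,O_{q^2}(so(3,\mathbb{C}))\cong\mathrm{Frac}\,\bigl(\mathbb{C}(C)\otimes_{\mathbb{C}}\mathbb{C}_{q^2}[x,y]\bigr)$, where $\mathbb{C}(C)$ is the field of rational functions in one variable $C$.
   Context: $q\in\mathbb{C}$ is nonzero and not a root of unity. $\mathrm{Frac}$ denotes the skew field of fractions, and $\mathbb{C}_{q^2}[x,y]=\mathbb{C}\langle x,y\mid yx=q^2xy\rangle$ is the quantum plane. The algebra $O_{q^2}(so(3,\mathbb{C}))$ is realized as the generalized Weyl algebra $D(a,\sigma)$ with $D=\mathbb{C}[H,C]$ the polynomial ring in two variables, $\sigma$ the automorphism with $\sigma(C)=C$, $\sigma(H)=q^2H$, and $a=C+\dfrac{H^2}{q(1+q^2)}$; that is, it is generated over $D$ by $X,Y$ with relations $Xd=\sigma(d)X$, $Yd=\sigma^{-1}(d)Y$ ($d\in D$), $YX=a$, $XY=\sigma(a)$. *)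

theory Defs
  imports
    "HOL-Algebra.QuotRing"
    "HOL-Algebra.Module"
    "HOL-Computational_Algebra.Fraction_Field"
    "HOL-Computational_Algebra.Polynomial"
    "HOL-Library.Poly_Mapping"
    Complex_Main
begin

hide_const (open) Multiset.mult Polynomial.smult

text \<open>
  An associative unital, not necessarily commutative, complex algebra is a record of type
  \<^typ>\<open>(complex, 'a) module\<close>. The locale \<^locale>\<open>algebra\<close> covers commutative algebras only,
  so it is not used.
\<close>

definition algebra_isomorphic :: "(complex, 'a) module \<Rightarrow> (complex, 'b) module \<Rightarrow> bool" where
  "algebra_isomorphic A B \<longleftrightarrow>
     (\<exists>\<phi> \<in> ring_iso A B. \<forall>c. \<forall>x \<in> carrier A. \<phi> (c \<odot>\<^bsub>A\<^esub> x) = c \<odot>\<^bsub>B\<^esub> \<phi> x)"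

text \<open>The algebra on a whole type, for a ring homomorphism \<open>\<iota>\<close> from the scalars into its centre.\<close>

definition type_algebra :: "(complex \<Rightarrow> 'a::ring_1) \<Rightarrow> (complex, 'a) module" where
  "type_algebra \<iota> =
     \<lparr>carrier = UNIV, mult = (*), one = 1, zero = 0, add = (+), smult = (\<lambda>c x. \<iota> c * x)\<rparr>"

definition monoid_algebra :: "('m, 'x) monoid_scheme \<Rightarrow> (complex, 'm \<Rightarrow>\<^sub>0 complex) module" where
  "monoid_algebra M =
     \<lparr>carrier = {f. Poly_Mapping.keys f \<subseteq> carrier M},
      mult = (\<lambda>f g. \<Sum>k \<in> Poly_Mapping.keys f. \<Sum>l \<in> Poly_Mapping.keys g.
                Poly_Mapping.single (k \<otimes>\<^bsub>M\<^esub> l)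
                  (Poly_Mapping.lookup f k * Poly_Mapping.lookup g l)),
      one = Poly_Mapping.single \<one>\<^bsub>M\<^esub> 1,
      zero = 0,
      add = (+),
      smult = (\<lambda>c. Poly_Mapping.map ((*) c))\<rparr>"

text \<open>Here \<^term>\<open>Idl\<^bsub>A\<^esub> S\<close> is the two-sided ideal generated by \<open>S\<close>.\<close>

definition algebra_quotient :: "(complex, 'a) module \<Rightarrow> 'a set \<Rightarrow> (complex, 'a set) module" where
  "algebra_quotient A S =
     ring.extend (A Quot (Idl\<^bsub>A\<^esub> S))
       (module.fields (\<lambda>c K. \<Union>x\<in>K. (Idl\<^bsub>A\<^esub> S) +>\<^bsub>A\<^esub> (c \<odot>\<^bsub>A\<^esub> x)))"

definition free_monoid :: "'g set \<Rightarrow> 'g list monoid" where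
  "free_monoid G = \<lparr>carrier = lists G, mult = (@), one = []\<rparr>"

definition word :: "'g list \<Rightarrow> ('g list \<Rightarrow>\<^sub>0 complex)" where
  "word w = Poly_Mapping.single w 1"

text \<open>
  The algebra with generators \<open>G\<close> and one relation \<open>l = r\<close> for each pair \<open>(l, r)\<close> in \<open>R\<close>.
\<close>

definition presented_algebra ::
  "'g set \<Rightarrow> (('g list \<Rightarrow>\<^sub>0 complex) \<times> ('g list \<Rightarrow>\<^sub>0 complex)) set
    \<Rightarrow> (complex, ('g list \<Rightarrow>\<^sub>0 complex) set) module" where
  "presented_algebra G R =
     algebra_quotient (monoid_algebra (free_monoid G)) {l - r | l r. (l, r) \<in> R}"


text \<open>
  In the generalized Weyl algebra the first four families of relations say that the generators
  \<open>Coef d\<close> multiply, add and scale as the elements \<open>d\<close> of \<open>D\<close> do.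
\<close>

datatype 'd gwa_gen = Coef 'd | Gen_X | Gen_Y

definition gwa ::
  "(complex, 'd) module \<Rightarrow> 'd \<Rightarrow> ('d \<Rightarrow> 'd)
    \<Rightarrow> (complex, ('d gwa_gen list \<Rightarrow>\<^sub>0 complex) set) module" where
  "gwa D a \<sigma> = presented_algebra (Coef ` carrier D \<union> {Gen_X, Gen_Y})
     ({(word [Coef (d \<oplus>\<^bsub>D\<^esub> e)], word [Coef d] + word [Coef e]) | d e.
         d \<in> carrier D \<and> e \<in> carrier D}
      \<union> {(word [Coef (d \<otimes>\<^bsub>D\<^esub> e)], word [Coef d, Coef e]) | d e.
           d \<in> carrier D \<and> e \<in> carrier D}
      \<union> {(word [Coef (c \<odot>\<^bsub>D\<^esub> d)], Poly_Mapping.single [Coef d] c) | c d. d \<in> carrier D}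
      \<union> {(word [Coef \<one>\<^bsub>D\<^esub>], word [])}
      \<union> {(word [Gen_X, Coef d], word [Coef (\<sigma> d), Gen_X]) | d. d \<in> carrier D}
      \<union> {(word [Gen_Y, Coef d], word [Coef (inv_into (carrier D) \<sigma> d), Gen_Y]) | d.
           d \<in> carrier D}
      \<union> {(word [Gen_Y, Gen_X], word [Coef a]), (word [Gen_X, Gen_Y], word [Coef (\<sigma> a)])})"

text \<open>
  The polynomial ring in \<open>H\<close> and \<open>C\<close> is \<^typ>\<open>complex poly poly\<close>, with \<open>C\<close> the inner and \<open>H\<close> the
  outer variable. The automorphism substitutes \<open>q\<^sup>2 H\<close> for \<open>H\<close>.
\<close>

definition poly_HC :: "(complex, complex poly poly) module" where
  "poly_HC = type_algebra (\<lambda>c. [:[:c:]:])"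

definition var_H :: "complex poly poly" where
  "var_H = [:0, 1:]"

definition var_C :: "complex poly poly" where
  "var_C = [:[:0, 1:]:]"

definition so3_aut :: "complex \<Rightarrow> complex poly poly \<Rightarrow> complex poly poly" where
  "so3_aut q d = pcompose d ([:[:q\<^sup>2:]:] * var_H)"

definition O_so3 ::
  "complex \<Rightarrow> (complex, (complex poly poly gwa_gen list \<Rightarrow>\<^sub>0 complex) set) module" where
  "O_so3 q = gwa poly_HC (var_C + [:[:1 / (q * (1 + q\<^sup>2)):]:] * var_H\<^sup>2) (so3_aut q)"


datatype plane_gen = Plane_x | Plane_y

definition quantum_plane ::
  "complex \<Rightarrow> (complex, (plane_gen list \<Rightarrow>\<^sub>0 complex) set) module" where
  "quantum_plane p = presented_algebra {Plane_x, Plane_y}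
     {(word [Plane_y, Plane_x], Poly_Mapping.single [Plane_x, Plane_y] p)}"

definition rational_functions :: "(complex, complex poly fract) module" where
  "rational_functions = type_algebra (\<lambda>c. Fraction_Field.Fract [:c:] 1)"


text \<open>
  The tensor product over the complex numbers is the free vector space on pairs modulo the
  bilinearity relations, with product \<open>(a \<otimes> b) (a' \<otimes> b') = a a' \<otimes> b b'\<close>. The free vector space
  with this product is the monoid algebra of the direct product of the multiplicative monoids.
  Multiplying a bilinearity relation by a pair gives another one, so the linear span of these
  relations is already the two-sided ideal that they generate.
\<close>

definition tensor_algebra_product ::
  "(complex, 'a) module \<Rightarrow> (complex, 'b) module
    \<Rightarrow> (complex, ('a \<times> 'b \<Rightarrow>\<^sub>0 complex) set) module" where
  "tensor_algebra_product A B = algebra_quotient (monoid_algebra (A \<times>\<times> B))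
     ({Poly_Mapping.single (a \<oplus>\<^bsub>A\<^esub> a', b) 1
         - (Poly_Mapping.single (a, b) 1 + Poly_Mapping.single (a', b) 1) | a a' b.
         a \<in> carrier A \<and> a' \<in> carrier A \<and> b \<in> carrier B}
      \<union> {Poly_Mapping.single (a, b \<oplus>\<^bsub>B\<^esub> b') 1
           - (Poly_Mapping.single (a, b) 1 + Poly_Mapping.single (a, b') 1) | a b b'.
           a \<in> carrier A \<and> b \<in> carrier B \<and> b' \<in> carrier B}
      \<union> {Poly_Mapping.single (c \<odot>\<^bsub>A\<^esub> a, b) 1 - Poly_Mapping.single (a, b) c | c a b.
           a \<in> carrier A \<and> b \<in> carrier B}
      \<union> {Poly_Mapping.single (a, c \<odot>\<^bsub>B\<^esub> b) 1 - Poly_Mapping.single (a, b) c | c a b.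
           a \<in> carrier A \<and> b \<in> carrier B})"


text \<open>
  The skew field of fractions of an Ore domain \<open>A\<close>: the pair \<open>(a, s)\<close> stands for the right
  fraction \<open>a s\<^sup>-\<^sup>1\<close>. Two pairs are identified if they agree after expansion to a common
  denominator.

  Sums are computed on representatives with a common denominator, products on representatives
  of the form \<open>a s\<^sup>-\<^sup>1\<close> and \<open>(s b) t\<^sup>-\<^sup>1\<close>, whose product is \<open>(a b) t\<^sup>-\<^sup>1\<close>. The right Ore condition
  provides such representatives. All choices give the same class, so that each union below is
  the union of a single class.
\<close>

definition frac_rel :: "(complex, 'a) module \<Rightarrow> (('a \<times> 'a) \<times> ('a \<times> 'a)) set" where
  "frac_rel A = {((a, s), (b, t)) | a s b t.
     a \<in> carrier A \<and> s \<in> carrier A - {\<zero>\<^bsub>A\<^esub>} \<and> b \<in> carrier A \<and> t \<in> carrier A - {\<zero>\<^bsub>A\<^esub>} \<and>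
     (\<exists>u \<in> carrier A - {\<zero>\<^bsub>A\<^esub>}. \<exists>v \<in> carrier A - {\<zero>\<^bsub>A\<^esub>}.
        a \<otimes>\<^bsub>A\<^esub> u = b \<otimes>\<^bsub>A\<^esub> v \<and> s \<otimes>\<^bsub>A\<^esub> u = t \<otimes>\<^bsub>A\<^esub> v)}"

definition frac_class :: "(complex, 'a) module \<Rightarrow> 'a \<Rightarrow> 'a \<Rightarrow> ('a \<times> 'a) set" where
  "frac_class A a s = frac_rel A `` {(a, s)}"

definition skew_frac :: "(complex, 'a) module \<Rightarrow> (complex, ('a \<times> 'a) set) module" where
  "skew_frac A =
     \<lparr>carrier = (carrier A \<times> (carrier A - {\<zero>\<^bsub>A\<^esub>})) // frac_rel A,
      mult = (\<lambda>P Q. \<Union>{frac_class A (a \<otimes>\<^bsub>A\<^esub> b) t | a s b t.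
                (a, s) \<in> P \<and> b \<in> carrier A \<and> (s \<otimes>\<^bsub>A\<^esub> b, t) \<in> Q}),
      one = frac_class A \<one>\<^bsub>A\<^esub> \<one>\<^bsub>A\<^esub>,
      zero = frac_class A \<zero>\<^bsub>A\<^esub> \<one>\<^bsub>A\<^esub>,
      add = (\<lambda>P Q. \<Union>{frac_class A (a \<oplus>\<^bsub>A\<^esub> b) s | a b s. (a, s) \<in> P \<and> (b, s) \<in> Q}),
      smult = (\<lambda>c P. \<Union>{frac_class A (c \<odot>\<^bsub>A\<^esub> a) s | a s. (a, s) \<in> P})\<rparr>"

end

theory Submission
  imports Defs "HOL-Computational_Algebra.Polynomial_Factorial"
begin

text \<open>
  Both algebras live inside one \<^emph>\<open>quantum torus\<close> \<open>T\<close>: the Laurent polynomials in \<open>x\<close> and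
  \<open>y\<close> over the field \<open>K = \<complex>(C)\<close>, with \<open>y x = q\<^sup>2 x y\<close>. The generalized Weyl algebra is
  mapped to \<open>T\<close> by \<open>H \<mapsto> x\<close>, \<open>X \<mapsto> y\<close>, \<open>Y \<mapsto> a y\<^sup>-\<^sup>1\<close>, and the tensor product by
  \<open>k \<otimes> x\<^sup>i y\<^sup>j \<mapsto> k x\<^sup>i y\<^sup>j\<close>. Both images contain all \<open>p(C) x\<^sup>i y\<^sup>j\<close> with \<open>i, j \<ge> 0\<close> and \<open>p\<close> a
  polynomial. Hence every \<open>t\<close> in \<open>T\<close> is brought into either image by right multiplication with
  a nonzero element \<open>p(C) x\<^sup>N y\<^sup>N\<close> of that image: \<open>p\<close> clears the denominators of the coefficients
  and \<open>x\<^sup>N y\<^sup>N\<close> the negative exponents (\<open>dense_embedding_if_monomials\<close>). An injective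
  homomorphism with this density property induces an isomorphism of skew fields of fractions
  (\<open>frac_map_hom\<close>, \<open>frac_map_bij\<close>), so both skew fields are isomorphic to that of \<open>T\<close>.

  Three facts support this argument.

  \<^item> \<open>T\<close> is a right Ore domain. Leading terms show that it is a domain (\<open>tmult_nonzero\<close>), and a
    comparison of dimensions gives nonzero common right multiples (\<open>common_right_multiple\<close>). The
    Ore condition descends to every dense subalgebra (\<open>ore_domain_source\<close>), in particular to
    the two presented algebras.

  \<^item> The two maps exist, because the images of the generators satisfy the defining relations
    (\<open>gwa_relations_hold\<close>, \<open>bilinearity_relations_hold\<close>).

  \<^item> The two maps are injective. The relations allow one to write every element as a sum of
    normal forms, \<open>d X\<^sup>j\<close> and \<open>d Y\<^sup>j\<close> in one case and \<open>k \<otimes> x\<^sup>i y\<^sup>j\<close> in the other, and the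
    images of such forms are visibly independent (\<open>inj_on_if_independent_family\<close>).
\<close>

hide_const (open) Multiset.mult Polynomial.smult

section \<open>Complex algebras and their homomorphisms\<close>

locale complex_algebra = ring A for A :: "(complex, 'a) module" (structure) +
  assumes smult_closed [simp, intro]: "x \<in> carrier A \<Longrightarrow> c \<odot> x \<in> carrier A"
    and smult_l_distr: "x \<in> carrier A \<Longrightarrow> (c + d) \<odot> x = c \<odot> x \<oplus> d \<odot> x"
    and smult_r_distr: "x \<in> carrier A \<Longrightarrow> y \<in> carrier A \<Longrightarrow> c \<odot> (x \<oplus> y) = c \<odot> x \<oplus> c \<odot> y"
    and smult_smult: "x \<in> carrier A \<Longrightarrow> c \<odot> (d \<odot> x) = (c * d) \<odot> x"
    and smult_one: "x \<in> carrier A \<Longrightarrow> 1 \<odot> x = x"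
    and smult_mult_left:
      "x \<in> carrier A \<Longrightarrow> y \<in> carrier A \<Longrightarrow> (c \<odot> x) \<otimes> y = c \<odot> (x \<otimes> y)"
    and smult_mult_right:
      "x \<in> carrier A \<Longrightarrow> y \<in> carrier A \<Longrightarrow> x \<otimes> (c \<odot> y) = c \<odot> (x \<otimes> y)"
begin

lemma smult_zero_left: "x \<in> carrier A \<Longrightarrow> 0 \<odot> x = \<zero>"
  using smult_l_distr [of x 0 0] by (simp add: a_lcomm)

end

definition algebra_hom ::
    "(complex, 'a) module \<Rightarrow> (complex, 'b) module \<Rightarrow> ('a \<Rightarrow> 'b) set" where
  "algebra_hom A B =
     {h \<in> ring_hom A B. \<forall>c. \<forall>x \<in> carrier A. h (c \<odot>\<^bsub>A\<^esub> x) = c \<odot>\<^bsub>B\<^esub> h x}"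

lemma algebra_homD:
  assumes "h \<in> algebra_hom A B"
  shows "x \<in> carrier A \<Longrightarrow> h x \<in> carrier B"
    and "x \<in> carrier A \<Longrightarrow> y \<in> carrier A \<Longrightarrow> h (x \<otimes>\<^bsub>A\<^esub> y) = h x \<otimes>\<^bsub>B\<^esub> h y"
    and "x \<in> carrier A \<Longrightarrow> y \<in> carrier A \<Longrightarrow> h (x \<oplus>\<^bsub>A\<^esub> y) = h x \<oplus>\<^bsub>B\<^esub> h y"
    and "h \<one>\<^bsub>A\<^esub> = \<one>\<^bsub>B\<^esub>"
    and "x \<in> carrier A \<Longrightarrow> h (c \<odot>\<^bsub>A\<^esub> x) = c \<odot>\<^bsub>B\<^esub> h x"
  using assms unfolding algebra_hom_def
  by (auto dest: ring_hom_closed ring_hom_mult ring_hom_add ring_hom_one)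

lemma algebra_hom_zero:
  assumes "h \<in> algebra_hom A B" "complex_algebra A" "complex_algebra B"
  shows "h \<zero>\<^bsub>A\<^esub> = \<zero>\<^bsub>B\<^esub>"
proof -
  interpret A: complex_algebra A by fact
  interpret B: complex_algebra B by fact
  show ?thesis
    using assms(1) by (auto simp: algebra_hom_def intro: ring_hom_zero A.ring_axioms B.ring_axioms)
qed

text \<open>
  The inverse of a bijective homomorphism respects an operation only where the operation stays in
  the carrier, and a record alone does not guarantee that. This is the closure needed to invert.
\<close>
definition operations_closed :: "(complex, 'a) module \<Rightarrow> bool" where
  "operations_closed A \<longleftrightarrow>
     (\<forall>x \<in> carrier A. \<forall>y \<in> carrier A.
        x \<otimes>\<^bsub>A\<^esub> y \<in> carrier A \<and> x \<oplus>\<^bsub>A\<^esub> y \<in> carrier A) \<and>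
     \<one>\<^bsub>A\<^esub> \<in> carrier A \<and> (\<forall>c. \<forall>x \<in> carrier A. c \<odot>\<^bsub>A\<^esub> x \<in> carrier A)"

text \<open>
  The isomorphism follows \<open>f\<close> by the inverse of \<open>g\<close>; since \<open>g\<close> is injective, each law can be
  checked after applying \<open>g\<close>.
\<close>
lemma algebra_isomorphic_if_common_target:
  assumes f: "f \<in> algebra_hom A T" "bij_betw f (carrier A) (carrier T)"
    and g: "g \<in> algebra_hom B T" "bij_betw g (carrier B) (carrier T)"
    and closed: "operations_closed A" "operations_closed B"
  shows "algebra_isomorphic A B"
proof -
  define h where "h = inv_into (carrier B) g \<circ> f"
  note closed = closed [unfolded operations_closed_def]
  have inj: "inj_on g (carrier B)" and surj: "g ` carrier B = carrier T"
    using g(2) by (auto simp: bij_betw_def)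
  have hc: "h x \<in> carrier B" and gh: "g (h x) = f x" if "x \<in> carrier A" for x
    using that algebra_homD(1)[OF f(1)] surj
    by (auto simp: h_def intro: inv_into_into f_inv_into_f)
  have eq: "u = v" if "g u = g v" "u \<in> carrier B" "v \<in> carrier B" for u v
    using inj that by (auto dest: inj_onD)
  have "h \<in> ring_iso A B"
  proof (rule ring_iso_memI)
    show "bij_betw h (carrier A) (carrier B)"
      unfolding h_def by (rule bij_betw_trans[OF f(2) bij_betw_inv_into[OF g(2)]])
  qed (use closed in \<open>auto intro!: eq simp: hc gh algebra_homD[OF f(1)] algebra_homD[OF g(1)]\<close>)
  moreover have "h (c \<odot>\<^bsub>A\<^esub> x) = c \<odot>\<^bsub>B\<^esub> h x" if "x \<in> carrier A" for c x
    using that closed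
    by (auto intro!: eq simp: hc gh algebra_homD[OF f(1)] algebra_homD[OF g(1)])
  ultimately show ?thesis
    unfolding algebra_isomorphic_def by blast
qed

section \<open>Fractions in a right Ore domain\<close>

locale ore_domain = complex_algebra +
  assumes one_not_zero: "\<one> \<noteq> \<zero>"
    and integral: "a \<otimes> b = \<zero> \<Longrightarrow> a \<in> carrier A \<Longrightarrow> b \<in> carrier A \<Longrightarrow> a = \<zero> \<or> b = \<zero>"
    and ore: "a \<in> carrier A \<Longrightarrow> s \<in> carrier A - {\<zero>} \<Longrightarrow>
      \<exists>u \<in> carrier A - {\<zero>}. \<exists>v \<in> carrier A. a \<otimes> u = s \<otimes> v"
begin

lemma nonzero_mult [intro]:
  "a \<in> carrier A - {\<zero>} \<Longrightarrow> b \<in> carrier A - {\<zero>} \<Longrightarrow> a \<otimes> b \<in> carrier A - {\<zero>}"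
  using integral by auto

lemma left_cancel:
  assumes "s \<in> carrier A - {\<zero>}" "x \<in> carrier A" "y \<in> carrier A" "s \<otimes> x = s \<otimes> y"
  shows "x = y"
proof -
  have "s \<otimes> (x \<ominus> y) = s \<otimes> x \<ominus> s \<otimes> y"
    using assms by (simp add: minus_eq r_distr r_minus)
  also have "\<dots> = \<zero>"
    using assms by (simp add: minus_eq r_neg)
  finally have "x \<ominus> y = \<zero>"
    using assms integral[of s "x \<ominus> y"] by auto
  then show ?thesis
    using assms(2,3) minus_equality[of x "\<ominus> y"] by (simp add: minus_eq)
qed

lemma ore_nonzero:
  assumes "a \<in> carrier A - {\<zero>}" "s \<in> carrier A - {\<zero>}"
  obtains u v where "u \<in> carrier A - {\<zero>}" "v \<in> carrier A - {\<zero>}" "a \<otimes> u = s \<otimes> v"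
proof -
  obtain u v where uv: "u \<in> carrier A - {\<zero>}" "v \<in> carrier A" "a \<otimes> u = s \<otimes> v"
    using ore[of a s] assms by blast
  moreover have "v \<noteq> \<zero>"
    using uv assms nonzero_mult[of a u] by auto
  ultimately show thesis
    using that by blast
qed

lemma frac_rel_iff:
  "((a, s), (b, t)) \<in> frac_rel A \<longleftrightarrow>
     a \<in> carrier A \<and> s \<in> carrier A - {\<zero>} \<and> b \<in> carrier A \<and> t \<in> carrier A - {\<zero>} \<and>
     (\<exists>u \<in> carrier A - {\<zero>}. \<exists>v \<in> carrier A - {\<zero>}. a \<otimes> u = b \<otimes> v \<and> s \<otimes> u = t \<otimes> v)"
  unfolding frac_rel_def by blast

lemma frac_relI:
  assumes "a \<in> carrier A" "s \<in> carrier A - {\<zero>}" "b \<in> carrier A" "t \<in> carrier A - {\<zero>}"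
    and "u \<in> carrier A - {\<zero>}" "v \<in> carrier A - {\<zero>}" "a \<otimes> u = b \<otimes> v" "s \<otimes> u = t \<otimes> v"
  shows "((a, s), (b, t)) \<in> frac_rel A"
  using assms unfolding frac_rel_iff by blast

lemma frac_relE:
  assumes "((a, s), (b, t)) \<in> frac_rel A"
  obtains u v where "a \<in> carrier A" "s \<in> carrier A - {\<zero>}" "b \<in> carrier A" "t \<in> carrier A - {\<zero>}"
    and "u \<in> carrier A - {\<zero>}" "v \<in> carrier A - {\<zero>}" "a \<otimes> u = b \<otimes> v" "s \<otimes> u = t \<otimes> v"
  using assms unfolding frac_rel_iff by blast

lemma frac_rel_expand:
  assumes "a \<in> carrier A" "s \<in> carrier A - {\<zero>}" "u \<in> carrier A - {\<zero>}"
  shows "((a, s), (a \<otimes> u, s \<otimes> u)) \<in> frac_rel A"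
proof -
  have "a \<otimes> u = (a \<otimes> u) \<otimes> \<one>" "s \<otimes> u = (s \<otimes> u) \<otimes> \<one>" "\<one> \<in> carrier A - {\<zero>}"
    using assms one_not_zero by auto
  then show ?thesis
    unfolding frac_rel_iff using assms nonzero_mult[of s u] by blast
qed

lemma frac_rel_refl:
  "a \<in> carrier A \<Longrightarrow> s \<in> carrier A - {\<zero>} \<Longrightarrow> ((a, s), (a, s)) \<in> frac_rel A"
  unfolding frac_rel_iff using one_not_zero by blast

lemma frac_rel_sym:
  assumes "((a, s), (b, t)) \<in> frac_rel A"
  shows "((b, t), (a, s)) \<in> frac_rel A"
proof -
  obtain u v where "u \<in> carrier A - {\<zero>}" "v \<in> carrier A - {\<zero>}"
    "b \<otimes> v = a \<otimes> u" "t \<otimes> v = s \<otimes> u"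
    using assms unfolding frac_rel_iff by metis
  then show ?thesis
    using assms unfolding frac_rel_iff by blast
qed

text \<open>
  The middle fraction is expanded by \<open>v\<close> in one relation and by \<open>u'\<close> in the other. A common right
  multiple \<open>v p = u' p'\<close> makes the two expansions equal.
\<close>
lemma frac_rel_trans:
  assumes "((a, s), (b, t)) \<in> frac_rel A" "((b, t), (c, r)) \<in> frac_rel A"
  shows "((a, s), (c, r)) \<in> frac_rel A"
proof -
  obtain u v where 1: "u \<in> carrier A - {\<zero>}" "v \<in> carrier A - {\<zero>}"
      "a \<otimes> u = b \<otimes> v" "s \<otimes> u = t \<otimes> v"
    using assms(1) unfolding frac_rel_iff by blast
  obtain u' v' where 2: "u' \<in> carrier A - {\<zero>}" "v' \<in> carrier A - {\<zero>}"
      "b \<otimes> u' = c \<otimes> v'" "t \<otimes> u' = r \<otimes> v'"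
    using assms(2) unfolding frac_rel_iff by blast
  have c: "a \<in> carrier A" "s \<in> carrier A" "b \<in> carrier A" "t \<in> carrier A" "c \<in> carrier A" "r \<in> carrier A"
    "u \<in> carrier A" "v \<in> carrier A" "u' \<in> carrier A" "v' \<in> carrier A"
    using assms 1 2 unfolding frac_rel_iff by auto
  obtain p p' where 3: "p \<in> carrier A - {\<zero>}" "p' \<in> carrier A - {\<zero>}" "v \<otimes> p = u' \<otimes> p'"
    using ore_nonzero[OF 1(2) 2(1)] .
  then have p: "p \<in> carrier A" "p' \<in> carrier A"
    by auto
  have *: "x \<otimes> (u \<otimes> p) = z \<otimes> (v' \<otimes> p')"
    if "x \<otimes> u = y \<otimes> v" "y \<otimes> u' = z \<otimes> v'" "x \<in> carrier A" "y \<in> carrier A" "z \<in> carrier A" for x y z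
  proof -
    have "x \<otimes> (u \<otimes> p) = y \<otimes> (v \<otimes> p)"
      using that c p by (simp flip: m_assoc)
    also have "\<dots> = z \<otimes> (v' \<otimes> p')"
      using that c p 3(3) by (simp flip: m_assoc)
    finally show ?thesis .
  qed
  show ?thesis
    unfolding frac_rel_iff
    using assms[unfolded frac_rel_iff] *[OF 1(3) 2(3)] *[OF 1(4) 2(4)] c
      nonzero_mult[OF 1(1) 3(1)] nonzero_mult[OF 2(2) 3(2)] by blast
qed

lemma equiv_frac_rel: "equiv (carrier A \<times> (carrier A - {\<zero>})) (frac_rel A)"
proof (rule equivI)
  show "refl_on (carrier A \<times> (carrier A - {\<zero>})) (frac_rel A)"
    using frac_rel_refl by (auto simp: refl_on_def)
  show "sym (frac_rel A)"
    by (rule symI) (metis frac_rel_sym surj_pair)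
  show "trans (frac_rel A)"
    by (rule transI) (metis frac_rel_trans surj_pair)
  show "frac_rel A \<subseteq> (carrier A \<times> (carrier A - {\<zero>})) \<times> carrier A \<times> (carrier A - {\<zero>})"
    by (auto simp: frac_rel_def)
qed

lemma frac_class_eq_iff:
  assumes "a \<in> carrier A" "s \<in> carrier A - {\<zero>}" "b \<in> carrier A" "t \<in> carrier A - {\<zero>}"
  shows "frac_class A a s = frac_class A b t \<longleftrightarrow> ((a, s), (b, t)) \<in> frac_rel A"
  unfolding frac_class_def using eq_equiv_class_iff[OF equiv_frac_rel] assms by auto

lemma frac_class_eqI: "((a, s), (b, t)) \<in> frac_rel A \<Longrightarrow> frac_class A a s = frac_class A b t"
  unfolding frac_class_def by (rule equiv_class_eq[OF equiv_frac_rel])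

lemma mem_frac_class_iff: "(b, t) \<in> frac_class A a s \<longleftrightarrow> ((a, s), (b, t)) \<in> frac_rel A"
  by (simp add: frac_class_def)

lemma frac_class_expand:
  "a \<in> carrier A \<Longrightarrow> s \<in> carrier A - {\<zero>} \<Longrightarrow> u \<in> carrier A - {\<zero>} \<Longrightarrow>
     frac_class A (a \<otimes> u) (s \<otimes> u) = frac_class A a s"
  using frac_class_eq_iff[of a s "a \<otimes> u" "s \<otimes> u"] frac_rel_expand[of a s u]
    nonzero_mult[of s u] by blast

lemma carrier_skew_frac:
  "carrier (skew_frac A) = {frac_class A a s | a s. a \<in> carrier A \<and> s \<in> carrier A - {\<zero>}}"
  by (auto simp: skew_frac_def quotient_def frac_class_def)

lemma skew_frac_carrierE:
  assumes "P \<in> carrier (skew_frac A)"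
  obtains a s where "a \<in> carrier A" "s \<in> carrier A - {\<zero>}" "P = frac_class A a s"
  using assms unfolding carrier_skew_frac by blast

lemma frac_class_closed:
  "a \<in> carrier A \<Longrightarrow> s \<in> carrier A - {\<zero>} \<Longrightarrow> frac_class A a s \<in> carrier (skew_frac A)"
  unfolding carrier_skew_frac by blast

text \<open>
  The denominators of the first factors are expanded by \<open>u\<close> and \<open>u'\<close>. Choosing \<open>b v w = u z\<close>
  expresses the inner numerator through \<open>u\<close>, and left cancellation of \<open>s'\<close> yields the
  corresponding equation \<open>b' v' w = u' z\<close>; the products then agree after expansion by \<open>w\<close>.
\<close>
lemma frac_rel_mult:
  assumes "((a, s), (a', s')) \<in> frac_rel A" "((s \<otimes> b, t), (s' \<otimes> b', t')) \<in> frac_rel A"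
    and b: "b \<in> carrier A" "b' \<in> carrier A"
  shows "((a \<otimes> b, t), (a' \<otimes> b', t')) \<in> frac_rel A"
proof -
  obtain u u' where 1: "a \<in> carrier A" "s \<in> carrier A - {\<zero>}" "a' \<in> carrier A"
      "s' \<in> carrier A - {\<zero>}" "u \<in> carrier A - {\<zero>}" "u' \<in> carrier A - {\<zero>}"
      "a \<otimes> u = a' \<otimes> u'" "s \<otimes> u = s' \<otimes> u'"
    using assms(1) by (rule frac_relE)
  obtain v v' where 2: "t \<in> carrier A - {\<zero>}" "t' \<in> carrier A - {\<zero>}"
      "v \<in> carrier A - {\<zero>}" "v' \<in> carrier A - {\<zero>}"
      "(s \<otimes> b) \<otimes> v = (s' \<otimes> b') \<otimes> v'" "t \<otimes> v = t' \<otimes> v'"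
    using assms(2) by (rule frac_relE)
  have c: "s \<in> carrier A" "s' \<in> carrier A" "t \<in> carrier A" "t' \<in> carrier A"
    "u \<in> carrier A" "v \<in> carrier A" "u' \<in> carrier A" "v' \<in> carrier A"
    using 1 2 by auto
  obtain w z where 3: "w \<in> carrier A - {\<zero>}" "z \<in> carrier A" "(b \<otimes> v) \<otimes> w = u \<otimes> z"
    using ore[OF m_closed[OF b(1) c(6)] 1(5)] by blast
  then have w: "w \<in> carrier A"
    by auto
  note cs = b c w 3(2) 1(1,3)
  have "s' \<otimes> ((b' \<otimes> v') \<otimes> w) = ((s \<otimes> b) \<otimes> v) \<otimes> w"
    unfolding 2(5) using cs by (simp add: m_assoc)
  also have "\<dots> = s \<otimes> ((b \<otimes> v) \<otimes> w)"
    using cs by (simp add: m_assoc)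
  also have "\<dots> = (s \<otimes> u) \<otimes> z"
    unfolding 3(3) using cs by (simp add: m_assoc)
  also have "\<dots> = s' \<otimes> (u' \<otimes> z)"
    unfolding 1(8) using cs by (simp add: m_assoc)
  finally have 4: "(b' \<otimes> v') \<otimes> w = u' \<otimes> z"
    by (rule left_cancel[OF 1(4), rotated 2]) (use cs in auto)
  have "(a \<otimes> b) \<otimes> (v \<otimes> w) = a \<otimes> ((b \<otimes> v) \<otimes> w)"
    using cs by (simp add: m_assoc)
  also have "\<dots> = (a \<otimes> u) \<otimes> z"
    unfolding 3(3) using cs by (simp add: m_assoc)
  also have "\<dots> = a' \<otimes> (u' \<otimes> z)"
    unfolding 1(7) using cs by (simp add: m_assoc)
  also have "\<dots> = (a' \<otimes> b') \<otimes> (v' \<otimes> w)"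
    unfolding 4[symmetric] using cs by (simp add: m_assoc)
  finally have 5: "(a \<otimes> b) \<otimes> (v \<otimes> w) = (a' \<otimes> b') \<otimes> (v' \<otimes> w)" .
  have 6: "t \<otimes> (v \<otimes> w) = t' \<otimes> (v' \<otimes> w)"
    using cs by (simp add: 2(6) flip: m_assoc)
  show ?thesis
    by (rule frac_relI[OF _ 2(1) _ 2(2) nonzero_mult[OF 2(3) 3(1)] nonzero_mult[OF 2(4) 3(1)] 5 6])
      (use cs in auto)
qed

text \<open>
  The two given expansions of the common denominators \<open>s\<close> and \<open>s'\<close> become the same one after a
  choice of \<open>u w = v z\<close>, because left cancellation of \<open>s'\<close> gives \<open>u' w = v' z\<close> as well.
\<close>
lemma frac_rel_add:
  assumes "((a, s), (a', s')) \<in> frac_rel A" "((b, s), (b', s')) \<in> frac_rel A"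
  shows "((a \<oplus> b, s), (a' \<oplus> b', s')) \<in> frac_rel A"
proof -
  obtain u u' where 1: "a \<in> carrier A" "s \<in> carrier A - {\<zero>}" "a' \<in> carrier A"
      "s' \<in> carrier A - {\<zero>}" "u \<in> carrier A - {\<zero>}" "u' \<in> carrier A - {\<zero>}"
      "a \<otimes> u = a' \<otimes> u'" "s \<otimes> u = s' \<otimes> u'"
    using assms(1) by (rule frac_relE)
  obtain v v' where 2: "b \<in> carrier A" "b' \<in> carrier A" "v \<in> carrier A - {\<zero>}" "v' \<in> carrier A - {\<zero>}"
      "b \<otimes> v = b' \<otimes> v'" "s \<otimes> v = s' \<otimes> v'"
    using assms(2) by (rule frac_relE)
  obtain w z where 3: "w \<in> carrier A - {\<zero>}" "z \<in> carrier A - {\<zero>}" "u \<otimes> w = v \<otimes> z"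
    by (rule ore_nonzero[OF 1(5) 2(3)])
  have cs: "a \<in> carrier A" "s \<in> carrier A" "a' \<in> carrier A" "s' \<in> carrier A" "b \<in> carrier A"
    "b' \<in> carrier A" "u \<in> carrier A" "v \<in> carrier A" "u' \<in> carrier A" "v' \<in> carrier A"
    "w \<in> carrier A" "z \<in> carrier A"
    using 1 2 3 by auto
  have "s' \<otimes> (u' \<otimes> w) = s \<otimes> (u \<otimes> w)"
    using cs by (simp add: 1(8) flip: m_assoc)
  also have "\<dots> = s' \<otimes> (v' \<otimes> z)"
    unfolding 3(3) using cs by (simp add: 2(6) flip: m_assoc)
  finally have 4: "u' \<otimes> w = v' \<otimes> z"
    by (rule left_cancel[OF 1(4), rotated 2]) (use cs in auto)
  have 5: "a \<otimes> (u \<otimes> w) = a' \<otimes> (u' \<otimes> w)"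
    using cs by (simp add: 1(7) flip: m_assoc)
  have 6: "b \<otimes> (u \<otimes> w) = b' \<otimes> (u' \<otimes> w)"
    unfolding 3(3) 4 using cs by (simp add: 2(5) flip: m_assoc)
  have 7: "(a \<oplus> b) \<otimes> (u \<otimes> w) = (a' \<oplus> b') \<otimes> (u' \<otimes> w)"
    using cs 5 6 by (simp add: l_distr)
  have 8: "s \<otimes> (u \<otimes> w) = s' \<otimes> (u' \<otimes> w)"
    using cs by (simp add: 1(8) flip: m_assoc)
  show ?thesis
    by (rule frac_relI[OF _ 1(2) _ 1(4) nonzero_mult[OF 1(5) 3(1)] nonzero_mult[OF 1(6) 3(1)] 7 8])
      (use cs in auto)
qed

lemma frac_rel_smult:
  assumes "((a, s), (a', s')) \<in> frac_rel A"
  shows "((c \<odot> a, s), (c \<odot> a', s')) \<in> frac_rel A"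
proof -
  obtain u v where 1: "a \<in> carrier A" "s \<in> carrier A - {\<zero>}" "a' \<in> carrier A"
      "s' \<in> carrier A - {\<zero>}" "u \<in> carrier A - {\<zero>}" "v \<in> carrier A - {\<zero>}"
      "a \<otimes> u = a' \<otimes> v" "s \<otimes> u = s' \<otimes> v"
    using assms by (rule frac_relE)
  have 2: "(c \<odot> a) \<otimes> u = (c \<odot> a') \<otimes> v"
    using 1 by (simp add: smult_mult_left)
  show ?thesis
    by (rule frac_relI[OF _ 1(2) _ 1(4,5,6) 2 1(8)]) (use 1 in auto)
qed

text \<open>
  The product of two classes is a union over all choices of representatives. The compatibility
  lemmas above reduce it to a single class, so fractions can be multiplied, added and scaled on
  any representatives of the required shape.
\<close>
lemma skew_frac_mult:
  assumes "a \<in> carrier A" "s \<in> carrier A - {\<zero>}" "b \<in> carrier A" "t \<in> carrier A - {\<zero>}"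
  shows "frac_class A a s \<otimes>\<^bsub>skew_frac A\<^esub> frac_class A (s \<otimes> b) t = frac_class A (a \<otimes> b) t"
proof -
  let ?F = "{frac_class A (a' \<otimes> b') t' | a' s' b' t'.
    (a', s') \<in> frac_class A a s \<and> b' \<in> carrier A \<and> (s' \<otimes> b', t') \<in> frac_class A (s \<otimes> b) t}"
  have "X = frac_class A (a \<otimes> b) t" if "X \<in> ?F" for X
  proof -
    from that obtain a' s' b' t' where X: "X = frac_class A (a' \<otimes> b') t'"
      "(a', s') \<in> frac_class A a s" "b' \<in> carrier A" "(s' \<otimes> b', t') \<in> frac_class A (s \<otimes> b) t"
      by blast
    then have "((a \<otimes> b, t), (a' \<otimes> b', t')) \<in> frac_rel A"
      using frac_rel_mult assms unfolding mem_frac_class_iff by blast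
    then show ?thesis
      using X(1) by (simp add: frac_class_eqI)
  qed
  moreover have "frac_class A (a \<otimes> b) t \<in> ?F"
    using frac_rel_refl[of a s] frac_rel_refl[of "s \<otimes> b" t] assms
    unfolding mem_frac_class_iff by blast
  ultimately have "?F = {frac_class A (a \<otimes> b) t}"
    by blast
  then show ?thesis
    by (simp add: skew_frac_def)
qed

lemma skew_frac_add:
  assumes "a \<in> carrier A" "b \<in> carrier A" "s \<in> carrier A - {\<zero>}"
  shows "frac_class A a s \<oplus>\<^bsub>skew_frac A\<^esub> frac_class A b s = frac_class A (a \<oplus> b) s"
proof -
  let ?F = "{frac_class A (a' \<oplus> b') s' | a' b' s'.
    (a', s') \<in> frac_class A a s \<and> (b', s') \<in> frac_class A b s}"
  have "X = frac_class A (a \<oplus> b) s" if "X \<in> ?F" for X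
  proof -
    from that obtain a' b' s' where X: "X = frac_class A (a' \<oplus> b') s'"
      "(a', s') \<in> frac_class A a s" "(b', s') \<in> frac_class A b s"
      by blast
    then have "((a \<oplus> b, s), (a' \<oplus> b', s')) \<in> frac_rel A"
      using frac_rel_add unfolding mem_frac_class_iff by blast
    then show ?thesis
      using X(1) by (simp add: frac_class_eqI)
  qed
  moreover have "frac_class A (a \<oplus> b) s \<in> ?F"
    using frac_rel_refl[of a s] frac_rel_refl[of b s] assms
    unfolding mem_frac_class_iff by blast
  ultimately have "?F = {frac_class A (a \<oplus> b) s}"
    by blast
  then show ?thesis
    by (simp add: skew_frac_def)
qed

lemma skew_frac_smult:
  assumes "a \<in> carrier A" "s \<in> carrier A - {\<zero>}"
  shows "c \<odot>\<^bsub>skew_frac A\<^esub> frac_class A a s = frac_class A (c \<odot> a) s"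
proof -
  let ?F = "{frac_class A (c \<odot> a') s' | a' s'. (a', s') \<in> frac_class A a s}"
  have "X = frac_class A (c \<odot> a) s" if "X \<in> ?F" for X
  proof -
    from that obtain a' s' where X: "X = frac_class A (c \<odot> a') s'" "(a', s') \<in> frac_class A a s"
      by blast
    then have "((c \<odot> a, s), (c \<odot> a', s')) \<in> frac_rel A"
      using frac_rel_smult unfolding mem_frac_class_iff by blast
    then show ?thesis
      using X(1) by (simp add: frac_class_eqI)
  qed
  moreover have "frac_class A (c \<odot> a) s \<in> ?F"
    using frac_rel_refl[of a s] assms unfolding mem_frac_class_iff by blast
  ultimately have "?F = {frac_class A (c \<odot> a) s}"
    by blast
  then show ?thesis
    by (simp add: skew_frac_def)
qed

lemma skew_frac_one: "\<one>\<^bsub>skew_frac A\<^esub> = frac_class A \<one> \<one>"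
  by (simp add: skew_frac_def)

lemma common_denominator:
  assumes "P \<in> carrier (skew_frac A)" "Q \<in> carrier (skew_frac A)"
  obtains a b s where "a \<in> carrier A" "b \<in> carrier A" "s \<in> carrier A - {\<zero>}"
    "P = frac_class A a s" "Q = frac_class A b s"
proof -
  obtain a s b t where 1: "a \<in> carrier A" "s \<in> carrier A - {\<zero>}" "P = frac_class A a s"
    "b \<in> carrier A" "t \<in> carrier A - {\<zero>}" "Q = frac_class A b t"
    using assms by (auto elim!: skew_frac_carrierE)
  obtain u v where 2: "u \<in> carrier A - {\<zero>}" "v \<in> carrier A - {\<zero>}" "s \<otimes> u = t \<otimes> v"
    using ore_nonzero[OF 1(2,5)] .
  show thesis
    using that[of "a \<otimes> u" "b \<otimes> v" "s \<otimes> u"] 1 2 frac_class_expand[of a s u] frac_class_expand[of b t v]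
      nonzero_mult[of s u] by auto
qed

text \<open>
  A choice of \<open>b u = s v\<close> expands the second fraction \<open>b t\<^sup>-\<^sup>1\<close> to \<open>(s v) (t u)\<^sup>-\<^sup>1\<close>, whose
  numerator begins with the denominator of the first.
\<close>
lemma composable_fractions:
  assumes "P \<in> carrier (skew_frac A)" "Q \<in> carrier (skew_frac A)"
  obtains a s b t where "a \<in> carrier A" "s \<in> carrier A - {\<zero>}" "b \<in> carrier A" "t \<in> carrier A - {\<zero>}"
    "P = frac_class A a s" "Q = frac_class A (s \<otimes> b) t"
proof -
  obtain a s b t where 1: "a \<in> carrier A" "s \<in> carrier A - {\<zero>}" "P = frac_class A a s"
    "b \<in> carrier A" "t \<in> carrier A - {\<zero>}" "Q = frac_class A b t"
    using assms by (auto elim!: skew_frac_carrierE)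
  obtain u v where 2: "u \<in> carrier A - {\<zero>}" "v \<in> carrier A" "b \<otimes> u = s \<otimes> v"
    using ore[OF 1(4,2)] by blast
  show thesis
    using that[of a s v "t \<otimes> u"] 1 2 frac_class_expand[of b t u] nonzero_mult[of t u] by auto
qed

lemma operations_closed_skew_frac: "operations_closed (skew_frac A)"
  unfolding operations_closed_def
proof (intro conjI ballI allI)
  fix P Q assume PQ: "P \<in> carrier (skew_frac A)" "Q \<in> carrier (skew_frac A)"
  show "P \<otimes>\<^bsub>skew_frac A\<^esub> Q \<in> carrier (skew_frac A)"
    using PQ by (rule composable_fractions) (simp add: skew_frac_mult frac_class_closed)
  show "P \<oplus>\<^bsub>skew_frac A\<^esub> Q \<in> carrier (skew_frac A)"
    using PQ by (rule common_denominator) (simp add: skew_frac_add frac_class_closed)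
next
  show "\<one>\<^bsub>skew_frac A\<^esub> \<in> carrier (skew_frac A)"
    using one_not_zero by (auto simp: skew_frac_one intro!: frac_class_closed)
next
  fix c P assume "P \<in> carrier (skew_frac A)"
  then show "c \<odot>\<^bsub>skew_frac A\<^esub> P \<in> carrier (skew_frac A)"
    by (rule skew_frac_carrierE) (simp add: skew_frac_smult frac_class_closed)
qed

end

section \<open>Dense embeddings\<close>

text \<open>
  Density says that every element of \<open>T\<close> is a right fraction with numerator and denominator in
  the image of \<open>A\<close>. This is what makes \<open>A\<close> and \<open>T\<close> have the same fractions.
\<close>

locale dense_embedding = A: complex_algebra A + T: ore_domain T
  for A :: "(complex, 'a) module" and T :: "(complex, 't) module" and \<iota> +
  assumes hom: "\<iota> \<in> algebra_hom A T"
    and inj: "inj_on \<iota> (carrier A)"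
    and dense: "t \<in> carrier T \<Longrightarrow>
      \<exists>s \<in> carrier A - {\<zero>\<^bsub>A\<^esub>}. t \<otimes>\<^bsub>T\<^esub> \<iota> s \<in> \<iota> ` carrier A"
begin

lemmas emb = algebra_homD [OF hom]

lemma emb_zero: "\<iota> \<zero>\<^bsub>A\<^esub> = \<zero>\<^bsub>T\<^esub>"
  by (rule algebra_hom_zero[OF hom A.complex_algebra_axioms T.complex_algebra_axioms])

lemma emb_eq_iff: "x \<in> carrier A \<Longrightarrow> y \<in> carrier A \<Longrightarrow> \<iota> x = \<iota> y \<longleftrightarrow> x = y"
  using inj by (auto dest: inj_onD)

lemma emb_nonzero: "s \<in> carrier A - {\<zero>\<^bsub>A\<^esub>} \<Longrightarrow> \<iota> s \<in> carrier T - {\<zero>\<^bsub>T\<^esub>}"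
  using emb_eq_iff[of s "\<zero>\<^bsub>A\<^esub>"] emb_zero emb(1) by auto

lemma nonzero_if_emb: "s \<in> carrier A \<Longrightarrow> \<iota> s \<noteq> \<zero>\<^bsub>T\<^esub> \<Longrightarrow> s \<in> carrier A - {\<zero>\<^bsub>A\<^esub>}"
  using emb_zero by auto

lemma two_denominators:
  assumes "x \<in> carrier T" "y \<in> carrier T"
  obtains d a b where "d \<in> carrier A - {\<zero>\<^bsub>A\<^esub>}" "a \<in> carrier A" "b \<in> carrier A"
    "x \<otimes>\<^bsub>T\<^esub> \<iota> d = \<iota> a" "y \<otimes>\<^bsub>T\<^esub> \<iota> d = \<iota> b"
proof -
  obtain s a where 1: "s \<in> carrier A - {\<zero>\<^bsub>A\<^esub>}" "a \<in> carrier A" "x \<otimes>\<^bsub>T\<^esub> \<iota> s = \<iota> a"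
    using dense[OF assms(1)] by blast
  have ys: "y \<otimes>\<^bsub>T\<^esub> \<iota> s \<in> carrier T"
    using assms(2) 1(1) emb(1) by blast
  obtain r b where 2: "r \<in> carrier A - {\<zero>\<^bsub>A\<^esub>}" "b \<in> carrier A"
    "(y \<otimes>\<^bsub>T\<^esub> \<iota> s) \<otimes>\<^bsub>T\<^esub> \<iota> r = \<iota> b"
    using dense[OF ys] by blast
  have c: "s \<in> carrier A" "r \<in> carrier A" "\<iota> s \<in> carrier T" "\<iota> r \<in> carrier T"
    using 1 2 emb(1) by auto
  have "\<iota> (s \<otimes>\<^bsub>A\<^esub> r) \<noteq> \<zero>\<^bsub>T\<^esub>"
    using T.nonzero_mult[OF emb_nonzero[OF 1(1)] emb_nonzero[OF 2(1)]] c by (simp add: emb)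
  then have "s \<otimes>\<^bsub>A\<^esub> r \<in> carrier A - {\<zero>\<^bsub>A\<^esub>}"
    using c nonzero_if_emb by blast
  moreover have "x \<otimes>\<^bsub>T\<^esub> \<iota> (s \<otimes>\<^bsub>A\<^esub> r) = \<iota> (a \<otimes>\<^bsub>A\<^esub> r)" "y \<otimes>\<^bsub>T\<^esub> \<iota> (s \<otimes>\<^bsub>A\<^esub> r) = \<iota> b"
    using 1 2 c assms by (simp_all add: emb T.m_assoc[symmetric])
  ultimately show thesis
    using that[of "s \<otimes>\<^bsub>A\<^esub> r" "a \<otimes>\<^bsub>A\<^esub> r" b] 1(2) 2(2) c by simp
qed

text \<open>
  A common right multiple \<open>\<iota> a u = \<iota> s v\<close> exists in \<open>T\<close>. A common right denominator of \<open>u\<close> and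
  \<open>v\<close> moves it into the image of \<open>A\<close>.
\<close>
lemma ore_domain_source: "ore_domain A"
proof
  show "\<one>\<^bsub>A\<^esub> \<noteq> \<zero>\<^bsub>A\<^esub>"
    using T.one_not_zero emb(4) emb_zero by metis
next
  fix a b assume ab: "a \<otimes>\<^bsub>A\<^esub> b = \<zero>\<^bsub>A\<^esub>" "a \<in> carrier A" "b \<in> carrier A"
  then have "\<iota> a \<otimes>\<^bsub>T\<^esub> \<iota> b = \<zero>\<^bsub>T\<^esub>"
    using emb(2)[of a b] emb_zero by simp
  then show "a = \<zero>\<^bsub>A\<^esub> \<or> b = \<zero>\<^bsub>A\<^esub>"
    using T.integral[of "\<iota> a" "\<iota> b"] ab emb(1) emb_zero emb_eq_iff[of _ "\<zero>\<^bsub>A\<^esub>"] by auto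
next
  fix a s assume as: "a \<in> carrier A" "s \<in> carrier A - {\<zero>\<^bsub>A\<^esub>}"
  obtain u v where uv: "u \<in> carrier T - {\<zero>\<^bsub>T\<^esub>}" "v \<in> carrier T" "\<iota> a \<otimes>\<^bsub>T\<^esub> u = \<iota> s \<otimes>\<^bsub>T\<^esub> v"
    using T.ore[of "\<iota> a" "\<iota> s"] emb(1)[OF as(1)] emb_nonzero[OF as(2)] by blast
  obtain d u' v' where d: "d \<in> carrier A - {\<zero>\<^bsub>A\<^esub>}" "u' \<in> carrier A" "v' \<in> carrier A"
    "u \<otimes>\<^bsub>T\<^esub> \<iota> d = \<iota> u'" "v \<otimes>\<^bsub>T\<^esub> \<iota> d = \<iota> v'"
    using two_denominators[of u v] uv by blast
  have "\<iota> u' \<noteq> \<zero>\<^bsub>T\<^esub>"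
    using T.nonzero_mult[OF uv(1) emb_nonzero[OF d(1)]] d(4) by simp
  then have u': "u' \<in> carrier A - {\<zero>\<^bsub>A\<^esub>}"
    using d(2) nonzero_if_emb by blast
  have "u \<in> carrier T" "s \<in> carrier A" "d \<in> carrier A"
    using as uv d by auto
  then have "\<iota> a \<otimes>\<^bsub>T\<^esub> \<iota> u' = \<iota> s \<otimes>\<^bsub>T\<^esub> \<iota> v'"
    unfolding d(4,5)[symmetric] using as(1) uv(2) emb(1)
    by (simp add: uv(3) flip: T.m_assoc)
  then have "a \<otimes>\<^bsub>A\<^esub> u' = s \<otimes>\<^bsub>A\<^esub> v'"
    using as d emb_eq_iff[of "a \<otimes>\<^bsub>A\<^esub> u'" "s \<otimes>\<^bsub>A\<^esub> v'"] by (simp add: emb)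
  then show "\<exists>u\<in>carrier A - {\<zero>\<^bsub>A\<^esub>}. \<exists>v\<in>carrier A. a \<otimes>\<^bsub>A\<^esub> u = s \<otimes>\<^bsub>A\<^esub> v"
    using u' d(3) by blast
qed

sublocale A: ore_domain A
  by (rule ore_domain_source)

text \<open>
  The witnesses of equality of fractions in \<open>T\<close> need not come from \<open>A\<close>, but they do after
  multiplication by a common right denominator.
\<close>
lemma frac_rel_emb:
  assumes c: "a \<in> carrier A" "s \<in> carrier A - {\<zero>\<^bsub>A\<^esub>}" "b \<in> carrier A" "t \<in> carrier A - {\<zero>\<^bsub>A\<^esub>}"
  shows "((\<iota> a, \<iota> s), (\<iota> b, \<iota> t)) \<in> frac_rel T \<longleftrightarrow> ((a, s), (b, t)) \<in> frac_rel A"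
proof
  assume "((a, s), (b, t)) \<in> frac_rel A"
  then obtain u v where uv: "u \<in> carrier A - {\<zero>\<^bsub>A\<^esub>}" "v \<in> carrier A - {\<zero>\<^bsub>A\<^esub>}"
    "a \<otimes>\<^bsub>A\<^esub> u = b \<otimes>\<^bsub>A\<^esub> v" "s \<otimes>\<^bsub>A\<^esub> u = t \<otimes>\<^bsub>A\<^esub> v"
    unfolding A.frac_rel_iff by blast
  then have "\<iota> a \<otimes>\<^bsub>T\<^esub> \<iota> u = \<iota> b \<otimes>\<^bsub>T\<^esub> \<iota> v" "\<iota> s \<otimes>\<^bsub>T\<^esub> \<iota> u = \<iota> t \<otimes>\<^bsub>T\<^esub> \<iota> v"
    using c by (simp_all flip: emb(2))
  then show "((\<iota> a, \<iota> s), (\<iota> b, \<iota> t)) \<in> frac_rel T"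
    unfolding T.frac_rel_iff using c uv emb_nonzero emb(1) by blast
next
  assume "((\<iota> a, \<iota> s), (\<iota> b, \<iota> t)) \<in> frac_rel T"
  then obtain u v where uv: "u \<in> carrier T - {\<zero>\<^bsub>T\<^esub>}" "v \<in> carrier T - {\<zero>\<^bsub>T\<^esub>}"
    "\<iota> a \<otimes>\<^bsub>T\<^esub> u = \<iota> b \<otimes>\<^bsub>T\<^esub> v" "\<iota> s \<otimes>\<^bsub>T\<^esub> u = \<iota> t \<otimes>\<^bsub>T\<^esub> v"
    unfolding T.frac_rel_iff by blast
  obtain d u' v' where d: "d \<in> carrier A - {\<zero>\<^bsub>A\<^esub>}" "u' \<in> carrier A" "v' \<in> carrier A"
    "u \<otimes>\<^bsub>T\<^esub> \<iota> d = \<iota> u'" "v \<otimes>\<^bsub>T\<^esub> \<iota> d = \<iota> v'"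
    using two_denominators[of u v] uv by blast
  have n: "u' \<in> carrier A - {\<zero>\<^bsub>A\<^esub>}" "v' \<in> carrier A - {\<zero>\<^bsub>A\<^esub>}"
    using T.nonzero_mult[OF uv(1) emb_nonzero[OF d(1)]] T.nonzero_mult[OF uv(2) emb_nonzero[OF d(1)]]
      d nonzero_if_emb by auto
  have *: "x \<otimes>\<^bsub>A\<^esub> u' = y \<otimes>\<^bsub>A\<^esub> v'"
    if "\<iota> x \<otimes>\<^bsub>T\<^esub> u = \<iota> y \<otimes>\<^bsub>T\<^esub> v" "x \<in> carrier A" "y \<in> carrier A" for x y
  proof -
    have "u \<in> carrier T" "v \<in> carrier T" "d \<in> carrier A"
      using uv d by auto
    then have "\<iota> x \<otimes>\<^bsub>T\<^esub> \<iota> u' = \<iota> y \<otimes>\<^bsub>T\<^esub> \<iota> v'"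
      unfolding d(4,5)[symmetric] using that(2,3) emb(1)
      by (simp add: that(1) flip: T.m_assoc)
    then show ?thesis
      using that d emb_eq_iff[of "x \<otimes>\<^bsub>A\<^esub> u'" "y \<otimes>\<^bsub>A\<^esub> v'"] by (simp add: emb)
  qed
  show "((a, s), (b, t)) \<in> frac_rel A"
    unfolding A.frac_rel_iff using c n *[OF uv(3)] *[OF uv(4)] by blast
qed

text \<open>
  The map \<open>a s\<^sup>-\<^sup>1 \<mapsto> \<iota> a (\<iota> s)\<^sup>-\<^sup>1\<close>, read off as the value that all representatives share.
\<close>
definition frac_map :: "('a \<times> 'a) set \<Rightarrow> ('t \<times> 't) set" where
  "frac_map P = the_elem ((\<lambda>(a, s). frac_class T (\<iota> a) (\<iota> s)) ` P)"

lemma frac_map_class: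
  assumes "a \<in> carrier A" "s \<in> carrier A - {\<zero>\<^bsub>A\<^esub>}"
  shows "frac_map (frac_class A a s) = frac_class T (\<iota> a) (\<iota> s)"
proof -
  let ?f = "\<lambda>(a, s). frac_class T (\<iota> a) (\<iota> s)"
  have mem: "(a, s) \<in> frac_class A a s"
    using A.frac_rel_refl assms by (simp add: A.mem_frac_class_iff)
  have "?f p = ?f (a, s)" if "p \<in> frac_class A a s" for p
  proof -
    obtain b t where p: "p = (b, t)"
      by (cases p)
    have r: "((a, s), (b, t)) \<in> frac_rel A"
      using that unfolding p A.mem_frac_class_iff .
    then have "b \<in> carrier A" "t \<in> carrier A - {\<zero>\<^bsub>A\<^esub>}"
      unfolding A.frac_rel_iff by auto
    then have "((\<iota> a, \<iota> s), (\<iota> b, \<iota> t)) \<in> frac_rel T"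
      using r frac_rel_emb[OF assms] by blast
    then show ?thesis
      unfolding p prod.case by (rule T.frac_class_eqI[symmetric])
  qed
  then have "the_elem (?f ` frac_class A a s) = ?f (a, s)"
    using mem by (intro the_elem_image_unique) auto
  then show ?thesis
    by (simp add: frac_map_def)
qed

lemma frac_map_hom: "frac_map \<in> algebra_hom (skew_frac A) (skew_frac T)"
proof -
  have "frac_map \<in> ring_hom (skew_frac A) (skew_frac T)"
  proof (rule ring_hom_memI)
    fix P assume "P \<in> carrier (skew_frac A)"
    then show "frac_map P \<in> carrier (skew_frac T)"
      by (rule A.skew_frac_carrierE)
        (simp add: frac_map_class T.frac_class_closed emb_nonzero emb del: Diff_iff)
  next
    fix P Q assume PQ: "P \<in> carrier (skew_frac A)" "Q \<in> carrier (skew_frac A)"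
    obtain a s b t where 1: "a \<in> carrier A" "s \<in> carrier A - {\<zero>\<^bsub>A\<^esub>}" "b \<in> carrier A"
      "t \<in> carrier A - {\<zero>\<^bsub>A\<^esub>}" "P = frac_class A a s" "Q = frac_class A (s \<otimes>\<^bsub>A\<^esub> b) t"
      by (rule A.composable_fractions[OF PQ])
    have s: "s \<in> carrier A"
      using 1(2) by blast
    show "frac_map (P \<otimes>\<^bsub>skew_frac A\<^esub> Q) = frac_map P \<otimes>\<^bsub>skew_frac T\<^esub> frac_map Q"
      using 1 s by (simp add: A.skew_frac_mult frac_map_class emb T.skew_frac_mult emb_nonzero del: Diff_iff)
    obtain a b s where 1: "a \<in> carrier A" "b \<in> carrier A" "s \<in> carrier A - {\<zero>\<^bsub>A\<^esub>}"
      "P = frac_class A a s" "Q = frac_class A b s"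
      by (rule A.common_denominator[OF PQ])
    show "frac_map (P \<oplus>\<^bsub>skew_frac A\<^esub> Q) = frac_map P \<oplus>\<^bsub>skew_frac T\<^esub> frac_map Q"
      using 1 by (simp add: A.skew_frac_add frac_map_class emb T.skew_frac_add emb_nonzero del: Diff_iff)
  next
    have "\<one>\<^bsub>A\<^esub> \<in> carrier A - {\<zero>\<^bsub>A\<^esub>}"
      using A.one_not_zero by auto
    then show "frac_map \<one>\<^bsub>skew_frac A\<^esub> = \<one>\<^bsub>skew_frac T\<^esub>"
      by (simp add: A.skew_frac_one T.skew_frac_one frac_map_class emb del: Diff_iff)
  qed
  moreover have "frac_map (c \<odot>\<^bsub>skew_frac A\<^esub> P) = c \<odot>\<^bsub>skew_frac T\<^esub> frac_map P"
    if "P \<in> carrier (skew_frac A)" for c P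
    using that by (rule A.skew_frac_carrierE)
      (simp add: A.skew_frac_smult T.skew_frac_smult frac_map_class emb_nonzero emb del: Diff_iff)
  ultimately show ?thesis
    by (simp add: algebra_hom_def)
qed

text \<open>
  Surjectivity is density: a fraction \<open>x y\<^sup>-\<^sup>1\<close> in \<open>T\<close> does not change when \<open>x\<close> and \<open>y\<close> are
  multiplied by a common right denominator, which puts both into the image of \<open>A\<close>.
\<close>
lemma frac_map_bij: "bij_betw frac_map (carrier (skew_frac A)) (carrier (skew_frac T))"
proof (rule bij_betw_imageI)
  show "inj_on frac_map (carrier (skew_frac A))"
  proof (rule inj_onI)
    fix P Q assume PQ: "P \<in> carrier (skew_frac A)" "Q \<in> carrier (skew_frac A)"
      and eq: "frac_map P = frac_map Q"
    obtain a b s where 1: "a \<in> carrier A" "b \<in> carrier A" "s \<in> carrier A - {\<zero>\<^bsub>A\<^esub>}"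
      "P = frac_class A a s" "Q = frac_class A b s"
      by (rule A.common_denominator[OF PQ])
    then show "P = Q"
      using eq emb_nonzero[OF 1(3)] emb(1)
      by (simp add: frac_map_class T.frac_class_eq_iff A.frac_class_eq_iff frac_rel_emb del: Diff_iff)
  qed
  show "frac_map ` carrier (skew_frac A) = carrier (skew_frac T)"
  proof (intro equalityI subsetI)
    fix Q assume "Q \<in> frac_map ` carrier (skew_frac A)"
    then show "Q \<in> carrier (skew_frac T)"
      using algebra_homD(1)[OF frac_map_hom] by blast
  next
    fix Q assume "Q \<in> carrier (skew_frac T)"
    then obtain x y where xy: "x \<in> carrier T" "y \<in> carrier T - {\<zero>\<^bsub>T\<^esub>}" "Q = frac_class T x y"
      by (rule T.skew_frac_carrierE)
    obtain d a s where d: "d \<in> carrier A - {\<zero>\<^bsub>A\<^esub>}" "a \<in> carrier A" "s \<in> carrier A"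
      "x \<otimes>\<^bsub>T\<^esub> \<iota> d = \<iota> a" "y \<otimes>\<^bsub>T\<^esub> \<iota> d = \<iota> s"
      using two_denominators[of x y] xy by blast
    have s: "s \<in> carrier A - {\<zero>\<^bsub>A\<^esub>}"
      using T.nonzero_mult[OF xy(2) emb_nonzero[OF d(1)]] d nonzero_if_emb by simp
    have "frac_map (frac_class A a s) = Q"
      using xy d(2,4,5) s T.frac_class_expand[OF xy(1,2) emb_nonzero[OF d(1)]]
      by (simp add: frac_map_class del: Diff_iff)
    then show "Q \<in> frac_map ` carrier (skew_frac A)"
      using A.frac_class_closed[OF d(2) s] by blast
  qed
qed

end

theorem skew_frac_isomorphic_if_dense_embeddings:
  assumes "dense_embedding A T f" "dense_embedding B T g"
  shows "algebra_isomorphic (skew_frac A) (skew_frac B)"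
proof -
  interpret f: dense_embedding A T f by fact
  interpret g: dense_embedding B T g by fact
  show ?thesis
    by (rule algebra_isomorphic_if_common_target[OF f.frac_map_hom f.frac_map_bij
          g.frac_map_hom g.frac_map_bij f.A.operations_closed_skew_frac
          g.A.operations_closed_skew_frac])
qed

section \<open>Twisted monoid algebras\<close>

text \<open>
  A finitely supported function is a finite formal sum of monomials, and \<open>h k a\<close> is the intended
  value at the monomial with coefficient \<open>a\<close> at \<open>k\<close>. Products and homomorphisms below have this
  form.
\<close>
definition linear_extension ::
    "('k \<Rightarrow> 'b::zero \<Rightarrow> 'c::comm_monoid_add) \<Rightarrow> ('k \<Rightarrow>\<^sub>0 'b) \<Rightarrow> 'c" where
  "linear_extension h p = (\<Sum>k \<in> Poly_Mapping.keys p. h k (Poly_Mapping.lookup p k))"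

lemma keys_add_subset:
  "Poly_Mapping.keys f \<subseteq> K \<Longrightarrow> Poly_Mapping.keys g \<subseteq> K \<Longrightarrow> Poly_Mapping.keys (f + g) \<subseteq> K"
  using Poly_Mapping.keys_add[of f g] by blast

lemma keys_single_subset: "k \<in> K \<Longrightarrow> Poly_Mapping.keys (Poly_Mapping.single k a) \<subseteq> K"
  by simp

lemma keys_diff_subset:
  "Poly_Mapping.keys f \<subseteq> K \<Longrightarrow> Poly_Mapping.keys g \<subseteq> K \<Longrightarrow> Poly_Mapping.keys (f - g) \<subseteq> K"
  using Poly_Mapping.keys_diff[of f g] by blast

lemma linear_extension_superset:
  assumes "finite F" "Poly_Mapping.keys p \<subseteq> F" "\<And>k. h k 0 = 0"
  shows "linear_extension h p = (\<Sum>k \<in> F. h k (Poly_Mapping.lookup p k))"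
  unfolding linear_extension_def using assms
  by (intro sum.mono_neutral_left) (auto simp: in_keys_iff)

lemma linear_extension_zero [simp]: "linear_extension h 0 = 0"
  by (simp add: linear_extension_def)

lemma linear_extension_single:
  assumes "h k 0 = 0"
  shows "linear_extension h (Poly_Mapping.single k a) = h k a"
  using assms by (cases "a = 0") (simp_all add: linear_extension_def)

lemma linear_extension_add:
  fixes h :: "'k \<Rightarrow> 'b::comm_monoid_add \<Rightarrow> 'c::ab_group_add"
  assumes h: "\<And>k a b. h k (a + b) = h k a + h k b"
  shows "linear_extension h (p + q) = linear_extension h p + linear_extension h q"
proof -
  have h0: "h k 0 = 0" for k
    using h[of k 0 0] by simp
  let ?F = "Poly_Mapping.keys p \<union> Poly_Mapping.keys q"
  have F: "finite ?F" "Poly_Mapping.keys (p + q) \<subseteq> ?F"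
    using Poly_Mapping.keys_add[of p q] by auto
  show ?thesis
    using F by (simp add: linear_extension_superset[where F = ?F] h0 lookup_add h sum.distrib)
qed

lemma linear_extension_add_fun:
  "linear_extension (\<lambda>k a. h k a + h' k a) p = linear_extension h p + linear_extension h' p"
  by (simp add: linear_extension_def sum.distrib)

lemma sum_single: "(\<Sum>k \<in> Poly_Mapping.keys p. Poly_Mapping.single k (Poly_Mapping.lookup p k)) = p"
  by (rule poly_mapping_eqI) (simp add: lookup_sum lookup_single when_def in_keys_iff)

lemma poly_mapping_additive_induct [consumes 1, case_names zero single add]:
  fixes p :: "'k \<Rightarrow>\<^sub>0 'b::comm_monoid_add"
  assumes "Poly_Mapping.keys p \<subseteq> K"
    and zero: "P 0"
    and single: "\<And>k a. k \<in> K \<Longrightarrow> P (Poly_Mapping.single k a)"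
    and add: "\<And>f g. Poly_Mapping.keys f \<subseteq> K \<Longrightarrow> Poly_Mapping.keys g \<subseteq> K \<Longrightarrow>
      P f \<Longrightarrow> P g \<Longrightarrow> P (f + g)"
  shows "P p"
proof -
  let ?s = "\<lambda>J. \<Sum>k \<in> J. Poly_Mapping.single k (Poly_Mapping.lookup p k)"
  have "Poly_Mapping.keys (?s J) \<subseteq> K \<and> P (?s J)" if "finite J" "J \<subseteq> K" for J
    using that
  proof (induction J rule: finite_induct)
    case empty
    then show ?case by (simp add: zero)
  next
    case (insert k J)
    then have "Poly_Mapping.keys (Poly_Mapping.single k (Poly_Mapping.lookup p k)) \<subseteq> K"
      by simp
    with insert show ?case
      by (simp add: keys_add_subset add single del: keys_single)
  qed
  from this[of "Poly_Mapping.keys p"] show ?thesis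
    using assms(1) by (simp add: sum_single)
qed

text \<open>
  A 2-cocycle, normalized at the identity. The trivial cocycle gives the monoid algebra, and a
  power of the commutation parameter gives the quantum torus, so the algebra axioms for both come
  from one proof.
\<close>
locale twisted_monoid = monoid M for M :: "('m, 'x) monoid_scheme" (structure) +
  fixes \<chi> :: "'m \<Rightarrow> 'm \<Rightarrow> 'b::comm_ring_1"
  assumes cocycle: "x \<in> carrier M \<Longrightarrow> y \<in> carrier M \<Longrightarrow> z \<in> carrier M \<Longrightarrow>
      \<chi> x y * \<chi> (x \<otimes> y) z = \<chi> y z * \<chi> x (y \<otimes> z)"
    and cocycle_one_left: "x \<in> carrier M \<Longrightarrow> \<chi> \<one> x = 1"
    and cocycle_one_right: "x \<in> carrier M \<Longrightarrow> \<chi> x \<one> = 1"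

definition twisted_mult ::
    "('m, 'x) monoid_scheme \<Rightarrow> ('m \<Rightarrow> 'm \<Rightarrow> 'b::comm_ring_1) \<Rightarrow>
      ('m \<Rightarrow>\<^sub>0 'b) \<Rightarrow> ('m \<Rightarrow>\<^sub>0 'b) \<Rightarrow> ('m \<Rightarrow>\<^sub>0 'b)" where
  "twisted_mult M \<chi> f g =
     linear_extension (\<lambda>k a. linear_extension (\<lambda>l b.
       Poly_Mapping.single (k \<otimes>\<^bsub>M\<^esub> l) (\<chi> k l * (a * b))) g) f"

definition twisted_algebra ::
    "('m, 'x) monoid_scheme \<Rightarrow> ('m \<Rightarrow> 'm \<Rightarrow> 'b::comm_ring_1) \<Rightarrow> (complex \<Rightarrow> 'b) \<Rightarrow>
      (complex, 'm \<Rightarrow>\<^sub>0 'b) module" where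
  "twisted_algebra M \<chi> \<epsilon> =
     \<lparr>carrier = {f. Poly_Mapping.keys f \<subseteq> carrier M},
      mult = twisted_mult M \<chi>,
      one = Poly_Mapping.single \<one>\<^bsub>M\<^esub> 1,
      zero = 0,
      add = (+),
      smult = (\<lambda>c. Poly_Mapping.map ((*) (\<epsilon> c)))\<rparr>"

lemma twisted_algebra_simps [simp]:
  "carrier (twisted_algebra M \<chi> \<epsilon>) = {f. Poly_Mapping.keys f \<subseteq> carrier M}"
  "f \<otimes>\<^bsub>twisted_algebra M \<chi> \<epsilon>\<^esub> g = twisted_mult M \<chi> f g"
  "\<one>\<^bsub>twisted_algebra M \<chi> \<epsilon>\<^esub> = Poly_Mapping.single \<one>\<^bsub>M\<^esub> 1"
  "\<zero>\<^bsub>twisted_algebra M \<chi> \<epsilon>\<^esub> = 0"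
  "f \<oplus>\<^bsub>twisted_algebra M \<chi> \<epsilon>\<^esub> g = f + g"
  "c \<odot>\<^bsub>twisted_algebra M \<chi> \<epsilon>\<^esub> f = Poly_Mapping.map ((*) (\<epsilon> c)) f"
  by (simp_all add: twisted_algebra_def)

lemma monoid_algebra_eq_twisted_algebra:
  "monoid_algebra M = twisted_algebra M (\<lambda>_ _. 1) (\<lambda>c. c)"
  by (simp add: monoid_algebra_def twisted_algebra_def twisted_mult_def linear_extension_def fun_eq_iff)

lemma twisted_mult_add_left:
  "twisted_mult M \<chi> (f + f') g = twisted_mult M \<chi> f g + twisted_mult M \<chi> f' g"
  unfolding twisted_mult_def
  by (rule linear_extension_add)
    (simp add: distrib_left distrib_right single_add linear_extension_add_fun)

lemma twisted_mult_add_right: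
  "twisted_mult M \<chi> f (g + g') = twisted_mult M \<chi> f g + twisted_mult M \<chi> f g'"
  unfolding twisted_mult_def
  by (subst linear_extension_add)
    (simp_all add: distrib_left single_add linear_extension_add_fun)

lemma twisted_mult_zero [simp]:
  "twisted_mult M \<chi> 0 g = 0" "twisted_mult M \<chi> f 0 = 0"
  by (simp_all add: twisted_mult_def linear_extension_def)

lemma twisted_mult_single:
  "twisted_mult M \<chi> (Poly_Mapping.single k a) (Poly_Mapping.single l b) =
     Poly_Mapping.single (k \<otimes>\<^bsub>M\<^esub> l) (\<chi> k l * (a * b))"
  by (simp add: twisted_mult_def linear_extension_single linear_extension_def)

lemma keys_sum_subset: "(\<And>k. k \<in> K \<Longrightarrow> Poly_Mapping.keys (f k) \<subseteq> X) \<Longrightarrow> Poly_Mapping.keys (sum f K) \<subseteq> X"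
  by (induction K rule: infinite_finite_induct) (simp_all add: keys_add_subset)

lemma lookup_map_mult [simp]:
  fixes c :: "'b::mult_zero"
  shows "Poly_Mapping.lookup (Poly_Mapping.map ((*) c) p) k = c * Poly_Mapping.lookup p k"
  by (simp add: map.rep_eq when_def)

lemma keys_map_mult_subset:
  fixes c :: "'b::mult_zero"
  shows "Poly_Mapping.keys (Poly_Mapping.map ((*) c) p) \<subseteq> Poly_Mapping.keys p"
  by (auto simp: in_keys_iff)

lemma map_mult_add:
  fixes c :: "'b::comm_ring_1"
  shows "Poly_Mapping.map ((*) c) (p + q) = Poly_Mapping.map ((*) c) p + Poly_Mapping.map ((*) c) q"
  by (rule poly_mapping_eqI) (simp add: lookup_add distrib_left)

lemma map_mult_map_mult:
  fixes c :: "'b::comm_ring_1"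
  shows "Poly_Mapping.map ((*) c) (Poly_Mapping.map ((*) d) p) = Poly_Mapping.map ((*) (c * d)) p"
  by (rule poly_mapping_eqI) (simp add: mult.assoc)

lemma map_mult_add_left:
  fixes c :: "'b::comm_ring_1"
  shows "Poly_Mapping.map ((*) (c + d)) p = Poly_Mapping.map ((*) c) p + Poly_Mapping.map ((*) d) p"
  by (rule poly_mapping_eqI) (simp add: lookup_add distrib_right)

lemma map_mult_single [simp]:
  fixes c :: "'b::comm_ring_1"
  shows "Poly_Mapping.map ((*) c) (Poly_Mapping.single k a) = Poly_Mapping.single k (c * a)"
  by (rule poly_mapping_eqI) (simp add: lookup_single when_def)

lemma map_mult_zero [simp]:
  fixes c :: "'b::comm_ring_1"
  shows "Poly_Mapping.map ((*) c) (0 :: 'k \<Rightarrow>\<^sub>0 'b) = 0"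
  by (rule poly_mapping_eqI) simp

lemma (in monoid) keys_twisted_mult_subset:
  assumes "Poly_Mapping.keys f \<subseteq> carrier G" "Poly_Mapping.keys g \<subseteq> carrier G"
  shows "Poly_Mapping.keys (twisted_mult G \<chi> f g) \<subseteq> carrier G"
  unfolding twisted_mult_def linear_extension_def using assms
  by (intro keys_sum_subset) (auto split: if_splits)

context twisted_monoid
begin

text \<open>
  Both sides are additive in each factor, which leaves three monomials, and there associativity is
  the cocycle identity.
\<close>
lemma twisted_mult_assoc:
  assumes "Poly_Mapping.keys f \<subseteq> carrier M" "Poly_Mapping.keys g \<subseteq> carrier M"
    "Poly_Mapping.keys h \<subseteq> carrier M"
  shows "twisted_mult M \<chi> (twisted_mult M \<chi> f g) h = twisted_mult M \<chi> f (twisted_mult M \<chi> g h)"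
  using assms(1)
proof (induction f rule: poly_mapping_additive_induct)
  case (single k a)
  from assms(2) show ?case
  proof (induction g rule: poly_mapping_additive_induct)
    case (single l b)
    from assms(3) show ?case
    proof (induction h rule: poly_mapping_additive_induct)
      case (single m c)
      have "\<chi> k l * \<chi> (k \<otimes> l) m * (a * b * c) = \<chi> l m * \<chi> k (l \<otimes> m) * (a * b * c)"
        using cocycle[of k l m] single \<open>k \<in> carrier M\<close> \<open>l \<in> carrier M\<close> by simp
      then show ?case
        using single \<open>k \<in> carrier M\<close> \<open>l \<in> carrier M\<close>
        by (simp add: twisted_mult_single m_assoc mult_ac)
    qed (simp_all add: twisted_mult_add_right)
  qed (simp_all add: twisted_mult_add_left twisted_mult_add_right)
qed (simp_all add: twisted_mult_add_left)

lemma twisted_mult_one: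
  assumes "Poly_Mapping.keys f \<subseteq> carrier M"
  shows "twisted_mult M \<chi> (Poly_Mapping.single \<one> 1) f = f"
    and "twisted_mult M \<chi> f (Poly_Mapping.single \<one> 1) = f"
  using assms
  by (induction f rule: poly_mapping_additive_induct)
    (simp_all add: twisted_mult_add_left twisted_mult_add_right twisted_mult_single
      cocycle_one_left cocycle_one_right)

lemma twisted_mult_scale:
  assumes "Poly_Mapping.keys f \<subseteq> carrier M" "Poly_Mapping.keys g \<subseteq> carrier M"
  shows "twisted_mult M \<chi> (Poly_Mapping.map ((*) c) f) g = Poly_Mapping.map ((*) c) (twisted_mult M \<chi> f g)"
    and "twisted_mult M \<chi> f (Poly_Mapping.map ((*) c) g) = Poly_Mapping.map ((*) c) (twisted_mult M \<chi> f g)"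
proof -
  have "twisted_mult M \<chi> (Poly_Mapping.map ((*) c) f) g = Poly_Mapping.map ((*) c) (twisted_mult M \<chi> f g) \<and>
     twisted_mult M \<chi> f (Poly_Mapping.map ((*) c) g) = Poly_Mapping.map ((*) c) (twisted_mult M \<chi> f g)"
    using assms(1)
  proof (induction f rule: poly_mapping_additive_induct)
    case (single k a)
    from assms(2) show ?case
      by (induction g rule: poly_mapping_additive_induct)
        (simp_all add: twisted_mult_add_right map_mult_add twisted_mult_single mult.assoc
          mult.left_commute)
  qed (simp_all add: twisted_mult_add_left map_mult_add)
  then show "twisted_mult M \<chi> (Poly_Mapping.map ((*) c) f) g = Poly_Mapping.map ((*) c) (twisted_mult M \<chi> f g)"
    and "twisted_mult M \<chi> f (Poly_Mapping.map ((*) c) g) = Poly_Mapping.map ((*) c) (twisted_mult M \<chi> f g)"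
    by auto
qed

lemma complex_algebra_twisted_algebra:
  assumes "\<And>c d. \<epsilon> (c + d) = \<epsilon> c + \<epsilon> d" "\<And>c d. \<epsilon> (c * d) = \<epsilon> c * \<epsilon> d" "\<epsilon> 1 = 1"
  shows "complex_algebra (twisted_algebra M \<chi> \<epsilon>)"
proof -
  have "ring (twisted_algebra M \<chi> \<epsilon>)"
  proof (intro ringI abelian_groupI monoidI)
    show "\<exists>y \<in> carrier (twisted_algebra M \<chi> \<epsilon>).
        y \<oplus>\<^bsub>twisted_algebra M \<chi> \<epsilon>\<^esub> x = \<zero>\<^bsub>twisted_algebra M \<chi> \<epsilon>\<^esub>"
      if "x \<in> carrier (twisted_algebra M \<chi> \<epsilon>)" for x
      using that by (intro bexI[of _ "- x"]) (auto simp: in_keys_iff)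
  qed (simp_all add: add_ac twisted_mult_assoc twisted_mult_one twisted_mult_add_left
      twisted_mult_add_right keys_add_subset keys_twisted_mult_subset)
  then interpret ring "twisted_algebra M \<chi> \<epsilon>" .
  show ?thesis
    by unfold_locales
      (auto simp: map_mult_add twisted_mult_scale assms lookup_add algebra_simps
        intro!: poly_mapping_eqI dest: subsetD[OF keys_map_mult_subset])
qed

end

lemma complex_algebra_monoid_algebra:
  assumes "monoid M"
  shows "complex_algebra (monoid_algebra M)"
proof -
  interpret monoid M by fact
  interpret twisted_monoid M "\<lambda>_ _. 1 :: complex"
    by unfold_locales simp_all
  show ?thesis
    unfolding monoid_algebra_eq_twisted_algebra by (rule complex_algebra_twisted_algebra) simp_all
qed

definition monoid_algebra_lift ::
    "(complex, 'b::comm_monoid_add) module \<Rightarrow> ('m \<Rightarrow> 'b) \<Rightarrow> ('m \<Rightarrow>\<^sub>0 complex) \<Rightarrow> 'b" where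
  "monoid_algebra_lift B \<phi> = linear_extension (\<lambda>w c. c \<odot>\<^bsub>B\<^esub> \<phi> w)"

text \<open>
  Homomorphisms out of a monoid algebra are constructed below with the quantum torus as target. It
  occupies a whole type of class \<^class>\<open>ab_group_add\<close>, where the value at a formal sum is an
  ordinary sum.
\<close>
locale type_based_algebra = complex_algebra B for B :: "(complex, 'b::ab_group_add) module" +
  assumes carrier_eq [simp]: "carrier B = UNIV"
    and add_eq [simp]: "add B = (+)"
    and zero_eq [simp]: "zero B = 0"
begin

lemma mult_distribs:
  "(x + y) \<otimes>\<^bsub>B\<^esub> z = x \<otimes>\<^bsub>B\<^esub> z + y \<otimes>\<^bsub>B\<^esub> z" "z \<otimes>\<^bsub>B\<^esub> (x + y) = z \<otimes>\<^bsub>B\<^esub> x + z \<otimes>\<^bsub>B\<^esub> y"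
  using l_distr[of x y z] r_distr[of x y z] by simp_all

lemma smult_distribs:
  "(c + d) \<odot>\<^bsub>B\<^esub> x = c \<odot>\<^bsub>B\<^esub> x + d \<odot>\<^bsub>B\<^esub> x" "c \<odot>\<^bsub>B\<^esub> (x + y) = c \<odot>\<^bsub>B\<^esub> x + c \<odot>\<^bsub>B\<^esub> y"
  using smult_l_distr[of x c d] smult_r_distr[of x y c] by simp_all

lemma smult_zero [simp]: "0 \<odot>\<^bsub>B\<^esub> x = 0" "c \<odot>\<^bsub>B\<^esub> 0 = 0"
  using smult_zero_left[of x] smult_distribs(2)[of c 0 0] by simp_all

lemma monoid_algebra_lift_single [simp]:
  "monoid_algebra_lift B \<phi> (Poly_Mapping.single w c) = c \<odot>\<^bsub>B\<^esub> \<phi> w"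
  by (simp add: monoid_algebra_lift_def linear_extension_single)

lemma monoid_algebra_lift_zero [simp]: "monoid_algebra_lift B \<phi> 0 = 0"
  by (simp add: monoid_algebra_lift_def)

lemma monoid_algebra_lift_add:
  "monoid_algebra_lift B \<phi> (p + q) = monoid_algebra_lift B \<phi> p + monoid_algebra_lift B \<phi> q"
  unfolding monoid_algebra_lift_def by (rule linear_extension_add) (simp add: smult_distribs)

lemma monoid_algebra_lift_diff:
  "monoid_algebra_lift B \<phi> (p - q) = monoid_algebra_lift B \<phi> p - monoid_algebra_lift B \<phi> q"
  using monoid_algebra_lift_add[of \<phi> "p - q" q] by (simp add: algebra_simps)

text \<open>
  The universal property of the monoid algebra: multiplicativity on monomials extends to sums by
  additivity in each factor.
\<close>
lemma monoid_algebra_lift_hom: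
  assumes M: "monoid M"
    and mult: "\<And>v w. v \<in> carrier M \<Longrightarrow> w \<in> carrier M \<Longrightarrow> \<phi> (v \<otimes>\<^bsub>M\<^esub> w) = \<phi> v \<otimes>\<^bsub>B\<^esub> \<phi> w"
    and one: "\<phi> \<one>\<^bsub>M\<^esub> = \<one>\<^bsub>B\<^esub>"
  shows "monoid_algebra_lift B \<phi> \<in> algebra_hom (monoid_algebra M) B"
proof -
  let ?L = "monoid_algebra_lift B \<phi>"
  have "?L (twisted_mult M (\<lambda>_ _. 1) f g) = ?L f \<otimes>\<^bsub>B\<^esub> ?L g"
    if "Poly_Mapping.keys f \<subseteq> carrier M" "Poly_Mapping.keys g \<subseteq> carrier M" for f g
    using that(1)
  proof (induction f rule: poly_mapping_additive_induct)
    case zero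
    then show ?case
      using l_null[of "?L g"] by simp
  next
    case (single k a)
    from that(2) show ?case
    proof (induction g rule: poly_mapping_additive_induct)
      case zero
      then show ?case
        using r_null[of "a \<odot>\<^bsub>B\<^esub> \<phi> k"] by simp
    next
      case (single l b)
      then show ?case
        using \<open>k \<in> carrier M\<close>
        by (simp add: twisted_mult_single mult smult_mult_left smult_mult_right smult_smult mult.commute)
    qed (simp_all add: twisted_mult_add_right monoid_algebra_lift_add mult_distribs)
  qed (simp_all add: twisted_mult_add_left monoid_algebra_lift_add mult_distribs)
  moreover have "?L (Poly_Mapping.map ((*) c) f) = c \<odot>\<^bsub>B\<^esub> ?L f"
    if "Poly_Mapping.keys f \<subseteq> carrier M" for f c
    using that
    by (induction f rule: poly_mapping_additive_induct)
      (simp_all add: map_mult_add monoid_algebra_lift_add smult_distribs smult_smult)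
  moreover have "?L (Poly_Mapping.single \<one>\<^bsub>M\<^esub> 1) = \<one>\<^bsub>B\<^esub>"
    by (simp add: one smult_one)
  ultimately show ?thesis
    unfolding monoid_algebra_eq_twisted_algebra algebra_hom_def
    by (auto intro!: ring_hom_memI simp: monoid_algebra_lift_add)
qed

end

section \<open>Quotients by a set of relations\<close>

definition residue :: "(complex, 'a) module \<Rightarrow> 'a set \<Rightarrow> 'a \<Rightarrow> 'a set" where
  "residue A S x = (Idl\<^bsub>A\<^esub> S) +>\<^bsub>A\<^esub> x"

lemma algebra_quotient_simps:
  "carrier (algebra_quotient A S) = residue A S ` carrier A"
  "mult (algebra_quotient A S) = rcoset_mult A (Idl\<^bsub>A\<^esub> S)"
  "one (algebra_quotient A S) = residue A S \<one>\<^bsub>A\<^esub>"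
  "zero (algebra_quotient A S) = Idl\<^bsub>A\<^esub> S"
  "add (algebra_quotient A S) = set_add A"
  "smult (algebra_quotient A S) = (\<lambda>c K. \<Union>x\<in>K. residue A S (c \<odot>\<^bsub>A\<^esub> x))"
  by (auto simp: algebra_quotient_def ring.defs module.defs FactRing_def residue_def A_RCOSETS_def'
      image_def)

locale algebra_with_relations = complex_algebra A for A :: "(complex, 'a) module" (structure) +
  fixes S :: "'a set"
  assumes relations: "S \<subseteq> carrier A"
begin

sublocale I: ideal "Idl S" A
  using genideal_ideal[OF relations] .

lemma residue_eq_iff:
  "x \<in> carrier A \<Longrightarrow> y \<in> carrier A \<Longrightarrow> residue A S x = residue A S y \<longleftrightarrow> x \<ominus> y \<in> Idl S"
  unfolding residue_def using quotient_eq_iff_same_a_r_cos[OF I.ideal_axioms] by simp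

lemma quotient_zero: "\<zero>\<^bsub>algebra_quotient A S\<^esub> = residue A S \<zero>"
proof -
  have "(\<lambda>h. h \<oplus> \<zero>) ` (Idl S) = Idl S"
    using I.Icarr by (auto simp: image_def)
  then show ?thesis
    by (auto simp: algebra_quotient_simps residue_def a_r_coset_def')
qed

lemma residue_relation:
  assumes "x \<ominus> y \<in> S" "x \<in> carrier A" "y \<in> carrier A"
  shows "residue A S x = residue A S y"
  using assms genideal_self[OF relations] by (auto simp: residue_eq_iff)

lemma residue_mult:
  "x \<in> carrier A \<Longrightarrow> y \<in> carrier A \<Longrightarrow>
    residue A S x \<otimes>\<^bsub>algebra_quotient A S\<^esub> residue A S y = residue A S (x \<otimes> y)"
  by (simp add: algebra_quotient_simps residue_def I.rcoset_mult_add)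

lemma residue_add:
  "x \<in> carrier A \<Longrightarrow> y \<in> carrier A \<Longrightarrow>
    residue A S x \<oplus>\<^bsub>algebra_quotient A S\<^esub> residue A S y = residue A S (x \<oplus> y)"
  by (simp add: algebra_quotient_simps residue_def I.a_rcos_sum)

lemma smult_ideal: "i \<in> Idl S \<Longrightarrow> c \<odot> i \<in> Idl S"
  using I.I_l_closed[of i "c \<odot> \<one>"] I.Icarr[of i] by (simp add: smult_mult_left)

lemma mem_residue_iff: "y \<in> residue A S x \<longleftrightarrow> (\<exists>i \<in> Idl S. y = i \<oplus> x)"
  by (auto simp: residue_def a_r_coset_def')

lemma residue_add_ideal:
  assumes "i \<in> Idl S" "x \<in> carrier A"
  shows "residue A S (i \<oplus> x) = residue A S x"
proof -
  have "i \<in> carrier A"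
    using assms(1) by (rule I.Icarr)
  then show ?thesis
    using assms by (simp add: residue_eq_iff minus_eq a_assoc r_neg)
qed

text \<open>
  The scalar multiple of a coset is a union of cosets. They all coincide, because a two-sided ideal
  is closed under scalars: \<open>c i = (c 1) i\<close>.
\<close>
lemma residue_smult:
  assumes "x \<in> carrier A"
  shows "c \<odot>\<^bsub>algebra_quotient A S\<^esub> residue A S x = residue A S (c \<odot> x)"
proof -
  have eq: "residue A S (c \<odot> y) = residue A S (c \<odot> x)" if y: "y \<in> residue A S x" for y
  proof -
    obtain i where i: "i \<in> Idl S" "y = i \<oplus> x"
      using y unfolding mem_residue_iff by blast
    have "i \<in> carrier A"
      using i(1) by (rule I.Icarr)
    then have "c \<odot> y = c \<odot> i \<oplus> c \<odot> x"
      using assms by (simp add: i(2) smult_r_distr)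
    then show ?thesis
      using assms smult_ideal[OF i(1)] by (simp add: residue_add_ideal)
  qed
  have "x \<in> residue A S x"
    using assms unfolding residue_def by (rule I.a_rcos_self)
  then have "residue A S x \<noteq> {}"
    by blast
  then show ?thesis
    unfolding algebra_quotient_simps by (rule SUP_eq_const[OF _ eq])
qed

lemma complex_algebra_quotient: "complex_algebra (algebra_quotient A S)"
proof -
  let ?Q = "algebra_quotient A S"
  interpret Q: ring "A Quot (Idl S)"
    by (rule I.quotient_is_ring)
  have eq: "carrier (A Quot (Idl S)) = carrier ?Q" "mult (A Quot (Idl S)) = mult ?Q"
    "one (A Quot (Idl S)) = one ?Q" "zero (A Quot (Idl S)) = zero ?Q" "add (A Quot (Idl S)) = add ?Q"
    by (auto simp: algebra_quotient_def ring.defs)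
  have "ring ?Q"
  proof (intro ringI abelian_groupI monoidI)
    show "\<exists>y \<in> carrier ?Q. y \<oplus>\<^bsub>?Q\<^esub> x = \<zero>\<^bsub>?Q\<^esub>" if "x \<in> carrier ?Q" for x
      using that Q.l_neg Q.a_inv_closed unfolding eq by blast
  qed (use Q.ring_simprules Q.m_assoc Q.r_one Q.r_distr in \<open>simp_all add: eq\<close>)
  then interpret R: ring ?Q .
  show ?thesis
  proof
  qed (auto simp: algebra_quotient_simps(1) residue_smult residue_mult residue_add smult_l_distr
      smult_r_distr smult_smult smult_one smult_mult_left smult_mult_right)
qed

end

definition quotient_lift :: "('a \<Rightarrow> 'b) \<Rightarrow> 'a set \<Rightarrow> 'b" where
  "quotient_lift h K = the_elem (h ` K)"

context algebra_with_relations
begin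

text \<open>
  The kernel of \<open>h\<close> is an ideal that contains the relations, hence contains the ideal they
  generate; so \<open>h\<close> is constant on each coset.
\<close>
lemma quotient_lift_residue:
  assumes h: "h \<in> algebra_hom A B" and B: "complex_algebra B"
    and S: "\<And>s. s \<in> S \<Longrightarrow> h s = \<zero>\<^bsub>B\<^esub>" and x: "x \<in> carrier A"
  shows "quotient_lift h (residue A S x) = h x"
proof -
  interpret B: complex_algebra B by fact
  interpret h: ring_hom_ring A B h
    using h by (intro ring_hom_ringI2) (auto simp: algebra_hom_def ring_axioms B.ring_axioms)
  have "S \<subseteq> a_kernel A B h"
    unfolding a_kernel_def' using subsetD[OF relations] S by (intro subsetI CollectI conjI)
  then have kernel: "Idl S \<subseteq> a_kernel A B h"
    by (intro genideal_minimal h.kernel_is_ideal)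
  have eq: "h y = h x" if "y \<in> residue A S x" for y
  proof -
    have "y \<in> a_kernel A B h +> x"
      using that kernel unfolding residue_def a_r_coset_def' by blast
    then show ?thesis
      by (rule h.rcos_imp_homeq[OF x])
  qed
  have "x \<in> residue A S x"
    using x unfolding residue_def by (rule I.a_rcos_self)
  then have "residue A S x \<noteq> {}"
    by blast
  then show ?thesis
    unfolding quotient_lift_def by (rule the_elem_image_unique[OF _ eq])
qed

lemma quotient_lift_hom:
  assumes h: "h \<in> algebra_hom A B" and B: "complex_algebra B"
    and S: "\<And>s. s \<in> S \<Longrightarrow> h s = \<zero>\<^bsub>B\<^esub>"
  shows "quotient_lift h \<in> algebra_hom (algebra_quotient A S) B"
  unfolding algebra_hom_def
  using algebra_homD[OF h]
  by (auto intro!: ring_hom_memI simp: algebra_quotient_simps(1,3) residue_mult residue_add residue_smult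
      quotient_lift_residue[OF assms])

end

section \<open>The quantum torus is an Ore domain\<close>

text \<open>The pair \<open>(i, j)\<close> is the exponent of the monomial \<open>x\<^sup>i y\<^sup>j\<close>.\<close>

definition exponent_group :: "(int \<times> int) monoid" where
  "exponent_group =
     \<lparr>carrier = UNIV, mult = (\<lambda>k l. (fst k + fst l, snd k + snd l)), one = (0, 0)\<rparr>"

lemma exponent_group_simps [simp]:
  "carrier exponent_group = UNIV"
  "k \<otimes>\<^bsub>exponent_group\<^esub> l = (fst k + fst l, snd k + snd l)"
  "\<one>\<^bsub>exponent_group\<^esub> = (0, 0)"
  by (simp_all add: exponent_group_def)

text \<open>
  Moving \<open>y\<close> past \<open>x\<close> by \<open>y x = \<omega> x y\<close> gives
  \<open>(x\<^sup>i y\<^sup>j) (x\<^sup>k y\<^sup>l) = \<omega>\<^sup>j\<^sup>k x\<^sup>i\<^sup>+\<^sup>k y\<^sup>j\<^sup>+\<^sup>l\<close>.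
\<close>
definition commutation_factor :: "'k::field \<Rightarrow> int \<times> int \<Rightarrow> int \<times> int \<Rightarrow> 'k" where
  "commutation_factor \<omega> k l = \<omega> powi (snd k * fst l)"

definition quantum_torus ::
    "'k::field \<Rightarrow> (complex \<Rightarrow> 'k) \<Rightarrow> (complex, int \<times> int \<Rightarrow>\<^sub>0 'k) module" where
  "quantum_torus \<omega> \<epsilon> = twisted_algebra exponent_group (commutation_factor \<omega>) \<epsilon>"

text \<open>
  Gaussian elimination: a pivot \<open>a j p\<close> removes the equation \<open>j\<close> and the unknown \<open>p\<close>, and a
  solution of the smaller system determines the value at \<open>p\<close>.
\<close>
lemma underdetermined_system:
  fixes a :: "'j \<Rightarrow> 'i \<Rightarrow> 'k::field"
  assumes "finite J" "finite I" "card J < card I"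
  shows "\<exists>x. (\<exists>i \<in> I. x i \<noteq> 0) \<and> (\<forall>j \<in> J. (\<Sum>i \<in> I. a j i * x i) = 0)"
  using assms
proof (induction J arbitrary: I a rule: finite_induct)
  case empty
  then have "I \<noteq> {}"
    by auto
  then show ?case
    by (intro exI[of _ "\<lambda>_. 1"]) auto
next
  case (insert j J)
  show ?case
  proof (cases "\<forall>i \<in> I. a j i = 0")
    case True
    then show ?thesis
      using insert.IH[of I a] insert.prems insert.hyps by auto
  next
    case False
    then obtain p where p: "p \<in> I" "a j p \<noteq> 0"
      by blast
    let ?I = "I - {p}"
    define b where "b j' i = a j' i - a j' p * a j i / a j p" for j' i
    have "card J < card ?I"
      using insert.prems insert.hyps p(1) by simp
    then obtain y where y: "\<exists>i \<in> ?I. y i \<noteq> 0" "\<And>j'. j' \<in> J \<Longrightarrow> (\<Sum>i \<in> ?I. b j' i * y i) = 0"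
      using insert.IH[of ?I b] insert.prems by auto
    define x where "x = y(p := - (\<Sum>i \<in> ?I. a j i * y i) / a j p)"
    have split: "(\<Sum>i \<in> I. a j' i * x i) = a j' p * x p + (\<Sum>i \<in> ?I. a j' i * y i)" for j'
    proof -
      have "(\<Sum>i \<in> I. a j' i * x i) = a j' p * x p + (\<Sum>i \<in> ?I. a j' i * x i)"
        using p(1) insert.prems by (simp add: sum.remove)
      also have "(\<Sum>i \<in> ?I. a j' i * x i) = (\<Sum>i \<in> ?I. a j' i * y i)"
        by (rule sum.cong) (auto simp: x_def)
      finally show ?thesis .
    qed
    have "(\<Sum>i \<in> I. a j' i * x i) = 0" if "j' \<in> J" for j'
    proof -
      have "0 = (\<Sum>i \<in> ?I. a j' i * y i - a j' p / a j p * (a j i * y i))"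
        using y(2)[OF that] by (simp add: b_def field_simps)
      also have "\<dots> = (\<Sum>i \<in> ?I. a j' i * y i) + a j' p * x p"
        by (simp add: sum_subtractf x_def sum_distrib_left sum_divide_distrib)
      finally show ?thesis
        by (simp add: split add.commute)
    qed
    moreover have "(\<Sum>i \<in> I. a j i * x i) = 0"
      unfolding split using p(2) by (simp add: x_def)
    moreover have "\<exists>i \<in> I. x i \<noteq> 0"
      using y(1) by (auto simp: x_def)
    ultimately show ?thesis
      by (intro exI[of _ x]) auto
  qed
qed

lemma lexicographic_maximum:
  fixes J :: "(int \<times> int) set"
  assumes "finite J" "J \<noteq> {}"
  obtains m where "m \<in> J"
    "\<And>k. k \<in> J \<Longrightarrow> snd k \<le> snd m" "\<And>k. k \<in> J \<Longrightarrow> snd k = snd m \<Longrightarrow> fst k \<le> fst m"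
proof -
  define b where "b = Max (snd ` J)"
  let ?J = "{k \<in> J. snd k = b}"
  define a where "a = Max (fst ` ?J)"
  have "b \<in> snd ` J"
    unfolding b_def using assms by (intro Max_in) auto
  then have "?J \<noteq> {}"
    by auto
  then have "a \<in> fst ` ?J"
    unfolding a_def using assms by (intro Max_in) auto
  then obtain m where m: "m \<in> J" "snd m = b" "fst m = a"
    by auto
  show thesis
  proof (rule that[OF m(1)])
    show "snd k \<le> snd m" if "k \<in> J" for k
      using that assms by (simp add: m b_def)
    show "fst k \<le> fst m" if "k \<in> J" "snd k = snd m" for k
      using that assms by (simp add: m a_def)
  qed
qed

lemma keys_in_box:
  fixes f g :: "int \<times> int \<Rightarrow>\<^sub>0 'k::zero"
  obtains d :: nat where
    "\<And>k. k \<in> Poly_Mapping.keys f \<union> Poly_Mapping.keys g \<Longrightarrow> \<bar>fst k\<bar> \<le> int d \<and> \<bar>snd k\<bar> \<le> int d"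
proof -
  let ?J = "Poly_Mapping.keys f \<union> Poly_Mapping.keys g"
  let ?n = "\<lambda>k. nat (\<bar>fst k\<bar> + \<bar>snd k\<bar>)"
  have "\<bar>fst k\<bar> \<le> int (sum ?n ?J) \<and> \<bar>snd k\<bar> \<le> int (sum ?n ?J)" if "k \<in> ?J" for k
  proof -
    have "?n k \<le> sum ?n ?J"
      using that by (intro member_le_sum) auto
    then show ?thesis
      by linarith
  qed
  then show thesis
    by (rule that)
qed

locale nonzero_parameter =
  fixes \<omega> :: "'k::field"
  assumes nonzero: "\<omega> \<noteq> 0"
begin

sublocale twisted_monoid exponent_group "commutation_factor \<omega>"
proof
  show "commutation_factor \<omega> x y * commutation_factor \<omega> (x \<otimes>\<^bsub>exponent_group\<^esub> y) z =
      commutation_factor \<omega> y z * commutation_factor \<omega> x (y \<otimes>\<^bsub>exponent_group\<^esub> z)" for x y z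
    using nonzero
    by (simp add: commutation_factor_def ring_distribs mult_ac add_ac flip: power_int_add)
qed (auto simp: commutation_factor_def)

abbreviation tmult :: "(int \<times> int \<Rightarrow>\<^sub>0 'k) \<Rightarrow> (int \<times> int \<Rightarrow>\<^sub>0 'k) \<Rightarrow> (int \<times> int \<Rightarrow>\<^sub>0 'k)"
    (infixl "\<star>" 70) where
  "f \<star> g \<equiv> twisted_mult exponent_group (commutation_factor \<omega>) f g"

lemma commutation_factor_nonzero: "commutation_factor \<omega> k l \<noteq> 0"
  using nonzero by (simp add: commutation_factor_def)

lemma lookup_tmult:
  "Poly_Mapping.lookup (f \<star> g) n =
     (\<Sum>k \<in> Poly_Mapping.keys f. \<Sum>l \<in> Poly_Mapping.keys g.
       if (fst k + fst l, snd k + snd l) = n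
       then commutation_factor \<omega> k l * (Poly_Mapping.lookup f k * Poly_Mapping.lookup g l) else 0)"
  by (simp add: twisted_mult_def linear_extension_def lookup_sum lookup_single when_def)

text \<open>
  Order the exponents by the exponent of \<open>y\<close> first. The sum of the two leading exponents arises
  from no other pair of exponents, so the leading coefficients cannot cancel.
\<close>
lemma tmult_nonzero:
  assumes "f \<noteq> 0" "g \<noteq> 0"
  shows "f \<star> g \<noteq> 0"
proof -
  obtain m where m: "m \<in> Poly_Mapping.keys f" "\<And>k. k \<in> Poly_Mapping.keys f \<Longrightarrow> snd k \<le> snd m"
    "\<And>k. k \<in> Poly_Mapping.keys f \<Longrightarrow> snd k = snd m \<Longrightarrow> fst k \<le> fst m"
    using lexicographic_maximum[of "Poly_Mapping.keys f"] assms(1) by auto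
  obtain n where n: "n \<in> Poly_Mapping.keys g" "\<And>k. k \<in> Poly_Mapping.keys g \<Longrightarrow> snd k \<le> snd n"
    "\<And>k. k \<in> Poly_Mapping.keys g \<Longrightarrow> snd k = snd n \<Longrightarrow> fst k \<le> fst n"
    using lexicographic_maximum[of "Poly_Mapping.keys g"] assms(2) by auto
  let ?p = "(fst m + fst n, snd m + snd n)"
  let ?c = "\<lambda>k l. commutation_factor \<omega> k l * (Poly_Mapping.lookup f k * Poly_Mapping.lookup g l)"
  have unique: "(fst k + fst l, snd k + snd l) = ?p \<longleftrightarrow> k = m \<and> l = n"
    if "k \<in> Poly_Mapping.keys f" "l \<in> Poly_Mapping.keys g" for k l
  proof
    assume eq: "(fst k + fst l, snd k + snd l) = ?p"
    then have s: "snd k = snd m" "snd l = snd n"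
      using m(2)[OF that(1)] n(2)[OF that(2)] by auto
    then have "fst k = fst m" "fst l = fst n"
      using m(3)[OF that(1)] n(3)[OF that(2)] eq by auto
    with s show "k = m \<and> l = n"
      by (simp add: prod_eq_iff)
  qed auto
  have "Poly_Mapping.lookup (f \<star> g) ?p =
      (\<Sum>k \<in> Poly_Mapping.keys f. \<Sum>l \<in> Poly_Mapping.keys g. if k = m \<and> l = n then ?c k l else 0)"
    unfolding lookup_tmult by (intro sum.cong refl) (simp only: unique)
  also have "\<dots> = (\<Sum>k \<in> Poly_Mapping.keys f. if k = m then ?c m n else 0)"
    using n(1) by (intro sum.cong refl) auto
  also have "\<dots> = ?c m n"
    using m(1) by simp
  also have "\<dots> \<noteq> 0"
    using m(1) n(1) commutation_factor_nonzero by (simp add: in_keys_iff)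
  finally show ?thesis
    by auto
qed

lemma tmult_sum_right: "f \<star> (\<Sum>m \<in> B. h m) = (\<Sum>m \<in> B. f \<star> h m)"
  by (induction B rule: infinite_finite_induct) (simp_all add: twisted_mult_add_right)

lemma lookup_tmult_combination:
  "Poly_Mapping.lookup (f \<star> (\<Sum>m \<in> B. Poly_Mapping.single m (x m))) n =
     (\<Sum>m \<in> B. Poly_Mapping.lookup (f \<star> Poly_Mapping.single m 1) n * x m)"
proof -
  have "f \<star> Poly_Mapping.single m (x m) = Poly_Mapping.map ((*) (x m)) (f \<star> Poly_Mapping.single m 1)" for m
    using twisted_mult_scale(2)[of f "Poly_Mapping.single m 1" "x m"] by simp
  then show ?thesis
    by (simp add: tmult_sum_right lookup_sum mult.commute)
qed

text \<open>
  Let the exponents of \<open>f\<close> and \<open>g\<close> lie in \<open>[-d, d]\<^sup>2\<close>. For \<open>u\<close> and \<open>w\<close> supported on a square of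
  side \<open>N\<close>, the equation \<open>f u + g w = 0\<close> is linear in their \<open>2 N\<^sup>2\<close> coefficients and amounts to
  at most \<open>(N + 2 d)\<^sup>2\<close> conditions. For large \<open>N\<close> there are fewer conditions than unknowns.
\<close>
lemma common_right_multiple:
  obtains u w where "f \<star> u + g \<star> w = 0" "u \<noteq> 0 \<or> w \<noteq> 0"
proof -
  obtain d :: nat where d:
    "\<And>k. k \<in> Poly_Mapping.keys f \<union> Poly_Mapping.keys g \<Longrightarrow> \<bar>fst k\<bar> \<le> int d \<and> \<bar>snd k\<bar> \<le> int d"
    using keys_in_box[of f g] by blast
  \<comment> \<open>With this side, \<open>(N + 2 d)\<^sup>2 = (8 d + 1)\<^sup>2 < 2 (6 d + 1)\<^sup>2 = 2 N\<^sup>2\<close>.\<close>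
  define N where "N = 6 * int d + 1"
  let ?B = "{0..<N} \<times> {0..<N}"
  let ?J = "{- int d..<N + int d} \<times> {- int d..<N + int d}"
  \<comment> \<open>A Boolean indexes the two factors, so that the pairs \<open>(b, m)\<close> index all unknowns.\<close>
  define h where "h b = (if b then f else g)" for b
  have "card ?J < card ((UNIV :: bool set) \<times> ?B)"
  proof -
    have "card ?J = (8 * d + 1) * (8 * d + 1)"
      by (simp add: card_cartesian_product N_def nat_add_distrib nat_mult_distrib)
    moreover have "card ((UNIV :: bool set) \<times> ?B) = 2 * ((6 * d + 1) * (6 * d + 1))"
      by (simp add: card_cartesian_product N_def nat_add_distrib nat_mult_distrib)
    ultimately show ?thesis
      by (simp add: algebra_simps)
  qed
  then obtain x where x: "\<exists>i \<in> UNIV \<times> ?B. x i \<noteq> 0"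
    "\<And>n. n \<in> ?J \<Longrightarrow> (\<Sum>i \<in> UNIV \<times> ?B. Poly_Mapping.lookup (h (fst i) \<star> Poly_Mapping.single (snd i) 1) n * x i) = 0"
    using underdetermined_system[of ?J "UNIV \<times> ?B"
        "\<lambda>n i. Poly_Mapping.lookup (h (fst i) \<star> Poly_Mapping.single (snd i) 1) n"]
    by auto
  define v where "v b = (\<Sum>m \<in> ?B. Poly_Mapping.single m (x (b, m)))" for b
  have "Poly_Mapping.lookup (h True \<star> v True + h False \<star> v False) n = 0" for n
  proof (cases "n \<in> ?J")
    case True
    have "Poly_Mapping.lookup (h True \<star> v True + h False \<star> v False) n =
        (\<Sum>b \<in> UNIV. \<Sum>m \<in> ?B. Poly_Mapping.lookup (h b \<star> Poly_Mapping.single m 1) n * x (b, m))"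
      by (simp add: UNIV_bool lookup_add v_def lookup_tmult_combination)
    also have "\<dots> = 0"
      using x(2)[OF True] by (simp add: sum.cartesian_product split_beta)
    finally show ?thesis .
  next
    case False
    have "Poly_Mapping.lookup (h b \<star> Poly_Mapping.single m 1) n = 0" if "m \<in> ?B" for b m
    proof -
      have "(fst k + fst m, snd k + snd m) \<noteq> n" if k: "k \<in> Poly_Mapping.keys (h b)" for k
      proof -
        have "k \<in> Poly_Mapping.keys f \<union> Poly_Mapping.keys g"
          using k by (auto simp: h_def split: if_splits)
        from d[OF this] have "(fst k + fst m, snd k + snd m) \<in> ?J"
          using \<open>m \<in> ?B\<close> by auto
        with False show ?thesis
          by metis
      qed
      then show ?thesis
        by (simp add: lookup_tmult)
    qed
    then show ?thesis
      unfolding v_def lookup_add lookup_tmult_combination by simp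
  qed
  then have "f \<star> v True + g \<star> v False = 0"
    by (intro poly_mapping_eqI) (simp add: h_def)
  moreover have "v True \<noteq> 0 \<or> v False \<noteq> 0"
  proof -
    obtain b m where bm: "m \<in> ?B" "x (b, m) \<noteq> 0"
      using x(1) by auto
    have "Poly_Mapping.lookup (v b) m = x (b, m)"
      using bm(1) by (simp add: v_def lookup_sum lookup_single when_def del: mem_Sigma_iff)
    then have "v b \<noteq> 0"
      using bm(2) by auto
    then show ?thesis
      by (cases b) auto
  qed
  ultimately show thesis
    by (rule that)
qed

lemma tmult_minus: "f \<star> (- g) = - (f \<star> g)"
proof -
  have "f \<star> (- g) + f \<star> g = 0"
    unfolding twisted_mult_add_right[symmetric] by simp
  then show ?thesis
    by (simp add: add_eq_0_iff2)
qed

end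

locale torus_scalars = nonzero_parameter \<omega> for \<omega> :: "'k::field" +
  fixes \<epsilon> :: "complex \<Rightarrow> 'k"
  assumes scalar_add: "\<epsilon> (c + d) = \<epsilon> c + \<epsilon> d"
    and scalar_mult: "\<epsilon> (c * d) = \<epsilon> c * \<epsilon> d"
    and scalar_one: "\<epsilon> 1 = 1"
begin

lemma torus_simps [simp]:
  "carrier (quantum_torus \<omega> \<epsilon>) = UNIV"
  "f \<otimes>\<^bsub>quantum_torus \<omega> \<epsilon>\<^esub> g = f \<star> g"
  "\<one>\<^bsub>quantum_torus \<omega> \<epsilon>\<^esub> = Poly_Mapping.single (0, 0) 1"
  "\<zero>\<^bsub>quantum_torus \<omega> \<epsilon>\<^esub> = 0"
  "add (quantum_torus \<omega> \<epsilon>) = (+)"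
  "c \<odot>\<^bsub>quantum_torus \<omega> \<epsilon>\<^esub> f = Poly_Mapping.map ((*) (\<epsilon> c)) f"
  by (simp_all add: quantum_torus_def fun_eq_iff)

sublocale torus: type_based_algebra "quantum_torus \<omega> \<epsilon>"
proof -
  interpret complex_algebra "quantum_torus \<omega> \<epsilon>"
    unfolding quantum_torus_def
    by (rule complex_algebra_twisted_algebra) (simp_all add: scalar_add scalar_mult scalar_one)
  show "type_based_algebra (quantum_torus \<omega> \<epsilon>)"
    by unfold_locales simp_all
qed

sublocale torus: ore_domain "quantum_torus \<omega> \<epsilon>"
proof
  show "\<one>\<^bsub>quantum_torus \<omega> \<epsilon>\<^esub> \<noteq> \<zero>\<^bsub>quantum_torus \<omega> \<epsilon>\<^esub>"
    using inj_single[of "(0, 0) :: int \<times> int"] by (metis torus_simps(3,4) single_zero injD zero_neq_one)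
  show "a = \<zero>\<^bsub>quantum_torus \<omega> \<epsilon>\<^esub> \<or> b = \<zero>\<^bsub>quantum_torus \<omega> \<epsilon>\<^esub>"
    if "a \<otimes>\<^bsub>quantum_torus \<omega> \<epsilon>\<^esub> b = \<zero>\<^bsub>quantum_torus \<omega> \<epsilon>\<^esub>" for a b
    using that tmult_nonzero by auto
  fix a s :: "int \<times> int \<Rightarrow>\<^sub>0 'k"
  assume "s \<in> carrier (quantum_torus \<omega> \<epsilon>) - {\<zero>\<^bsub>quantum_torus \<omega> \<epsilon>\<^esub>}"
  then have s: "s \<noteq> 0"
    by simp
  have "\<exists>u. u \<noteq> 0 \<and> (\<exists>v. a \<star> u = s \<star> v)"
  proof (cases "a = 0")
    case True
    then show ?thesis
      using s by (intro exI[of _ s]) (auto intro: exI[of _ 0])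
  next
    case False
    obtain u w where uw: "a \<star> u + s \<star> w = 0" "u \<noteq> 0 \<or> w \<noteq> 0"
      by (rule common_right_multiple)
    have "u \<noteq> 0"
      using uw tmult_nonzero[OF s, of w] by auto
    moreover have "a \<star> u = s \<star> (- w)"
      using uw(1) by (simp add: tmult_minus add_eq_0_iff2)
    ultimately show ?thesis
      by blast
  qed
  then show "\<exists>u \<in> carrier (quantum_torus \<omega> \<epsilon>) - {\<zero>\<^bsub>quantum_torus \<omega> \<epsilon>\<^esub>}.
      \<exists>v \<in> carrier (quantum_torus \<omega> \<epsilon>). a \<otimes>\<^bsub>quantum_torus \<omega> \<epsilon>\<^esub> u = s \<otimes>\<^bsub>quantum_torus \<omega> \<epsilon>\<^esub> v"
    by auto
qed

end

section \<open>Presented algebras and normal forms\<close>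

inductive_set additive_span :: "(complex, 'a) module \<Rightarrow> 'a set \<Rightarrow> 'a set"
  for A :: "(complex, 'a) module" and S :: "'a set" where
  zero: "\<zero>\<^bsub>A\<^esub> \<in> additive_span A S"
| base: "s \<in> S \<Longrightarrow> s \<in> additive_span A S"
| add: "x \<in> additive_span A S \<Longrightarrow> y \<in> additive_span A S \<Longrightarrow> x \<oplus>\<^bsub>A\<^esub> y \<in> additive_span A S"

lemma (in complex_algebra) additive_span_closed:
  assumes "S \<subseteq> carrier A" "x \<in> additive_span A S"
  shows "x \<in> carrier A"
  using assms(2) by induction (use assms(1) in auto)

text \<open>
  A spanning family turns each element into a finite sum of members \<open>e m d\<close>, one for each index
  \<open>m\<close>. If \<open>h\<close> kills the sum, independence of the images kills every \<open>d\<close>, so the element is zero.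
\<close>
lemma (in complex_algebra) inj_on_if_independent_family:
  fixes e :: "'m \<Rightarrow> 'd::comm_monoid_add \<Rightarrow> 'a" and h :: "'a \<Rightarrow> 't::ab_group_add"
  assumes e_closed: "\<And>m d. e m d \<in> carrier A"
    and e_add: "\<And>m d d'. e m (d + d') = e m d \<oplus> e m d'"
    and span: "carrier A \<subseteq> additive_span A {e m d | m d. True}"
    and h_add: "\<And>x y. x \<in> carrier A \<Longrightarrow> y \<in> carrier A \<Longrightarrow> h (x \<oplus> y) = h x + h y"
    and independent: "\<And>J d. finite J \<Longrightarrow> (\<Sum>m \<in> J. h (e m (d m))) = 0 \<Longrightarrow> \<forall>m \<in> J. d m = 0"
  shows "inj_on h (carrier A)"
proof -
  have e_zero: "e m 0 = \<zero>" for m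
  proof -
    have "e m 0 \<oplus> e m 0 = e m 0"
      using e_add[of m 0 0] by simp
    then show ?thesis
      using e_closed[of m 0] by simp
  qed
  have h_zero: "h \<zero> = 0"
    using h_add[of \<zero> \<zero>] by simp
  have h_minus: "h (x \<ominus> y) = h x - h y" if "x \<in> carrier A" "y \<in> carrier A" for x y
  proof -
    have "h (x \<ominus> y) + h y = h x"
      using that by (simp flip: h_add add: minus_eq a_assoc l_neg)
    then show ?thesis
      by (simp add: eq_diff_eq)
  qed
  define S where "S p = (\<Oplus>m \<in> Poly_Mapping.keys p. e m (Poly_Mapping.lookup p m))" for p
  have S_superset: "S p = (\<Oplus>m \<in> F. e m (Poly_Mapping.lookup p m))"
    if "finite F" "Poly_Mapping.keys p \<subseteq> F" for p F
    unfolding S_def using that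
    by (intro add.finprod_mono_neutral_cong_left) (auto simp: e_closed e_zero in_keys_iff)
  have S_add: "S (p + p') = S p \<oplus> S p'" for p p'
  proof -
    let ?F = "Poly_Mapping.keys p \<union> Poly_Mapping.keys p'"
    have F: "finite ?F" "Poly_Mapping.keys (p + p') \<subseteq> ?F"
      using Poly_Mapping.keys_add[of p p'] by auto
    show ?thesis
      using F by (simp add: S_superset[of ?F] lookup_add e_add finsum_addf e_closed Pi_def)
  qed
  have S_single: "S (Poly_Mapping.single m d) = e m d" for m d
    by (simp add: S_superset[of "{m}"] e_closed)
  have S_zero: "S 0 = \<zero>"
    by (simp add: S_def)
  have h_finsum: "finite J \<Longrightarrow> h (\<Oplus>m \<in> J. e m (d m)) = (\<Sum>m \<in> J. h (e m (d m)))" for J d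
    by (induction J rule: finite_induct) (simp_all add: h_zero h_add e_closed Pi_def)
  have representation: "\<exists>p. x = S p" if "x \<in> carrier A" for x
  proof -
    have "x \<in> additive_span A {e m d | m d. True}"
      using span that by blast
    then show ?thesis
    proof induction
      case zero
      then show ?case by (metis S_zero)
    next
      case (base s)
      then show ?case by (auto simp flip: S_single)
    next
      case (add x y)
      then show ?case by (metis S_add)
    qed
  qed
  have kernel: "x = \<zero>" if x: "x \<in> carrier A" "h x = 0" for x
  proof -
    obtain p where p: "x = S p"
      using representation x(1) by blast
    have "(\<Sum>m \<in> Poly_Mapping.keys p. h (e m (Poly_Mapping.lookup p m))) = 0"
      using x(2) by (simp add: p S_def flip: h_finsum)
    then have "\<forall>m \<in> Poly_Mapping.keys p. Poly_Mapping.lookup p m = 0"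
      using independent[of "Poly_Mapping.keys p" "Poly_Mapping.lookup p"] by simp
    then have "p = 0"
      by (intro poly_mapping_eqI) (metis in_keys_iff lookup_zero)
    then show ?thesis
      by (simp add: p S_zero)
  qed
  show ?thesis
  proof (rule inj_onI)
    fix x y assume xy: "x \<in> carrier A" "y \<in> carrier A" "h x = h y"
    then have "x \<ominus> y = \<zero>"
      by (intro kernel) (simp_all add: h_minus)
    then show "x = y"
      using xy minus_equality[of x "\<ominus> y"] by (simp add: minus_eq)
  qed
qed

locale monoid_algebra_quotient = monoid M for M :: "('m, 'x) monoid_scheme" +
  fixes S :: "('m \<Rightarrow>\<^sub>0 complex) set"
  assumes S_subset: "S \<subseteq> {f. Poly_Mapping.keys f \<subseteq> carrier M}"
begin

abbreviation Q :: "(complex, ('m \<Rightarrow>\<^sub>0 complex) set) module" where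
  "Q \<equiv> algebra_quotient (monoid_algebra M) S"

abbreviation cls :: "('m \<Rightarrow>\<^sub>0 complex) \<Rightarrow> ('m \<Rightarrow>\<^sub>0 complex) set" where
  "cls \<equiv> residue (monoid_algebra M) S"

lemma monoid_algebra_simps:
  "carrier (monoid_algebra M) = {f. Poly_Mapping.keys f \<subseteq> carrier M}"
  "f \<otimes>\<^bsub>monoid_algebra M\<^esub> g = twisted_mult M (\<lambda>_ _. 1) f g"
  "\<one>\<^bsub>monoid_algebra M\<^esub> = Poly_Mapping.single \<one>\<^bsub>M\<^esub> 1"
  "\<zero>\<^bsub>monoid_algebra M\<^esub> = 0"
  "f \<oplus>\<^bsub>monoid_algebra M\<^esub> g = f + g"
  "c \<odot>\<^bsub>monoid_algebra M\<^esub> f = Poly_Mapping.map ((*) c) f"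
  by (simp_all add: monoid_algebra_eq_twisted_algebra)

sublocale P: complex_algebra "monoid_algebra M"
  by (rule complex_algebra_monoid_algebra) (rule monoid_axioms)

sublocale P: algebra_with_relations "monoid_algebra M" S
  by unfold_locales (use S_subset in \<open>simp add: monoid_algebra_simps\<close>)

sublocale Q: complex_algebra Q
  by (rule P.complex_algebra_quotient)

lemma carrier_Q: "carrier Q = cls ` {f. Poly_Mapping.keys f \<subseteq> carrier M}"
  by (simp add: algebra_quotient_simps monoid_algebra_simps)

lemma cls_closed: "Poly_Mapping.keys f \<subseteq> carrier M \<Longrightarrow> cls f \<in> carrier Q"
  by (simp add: carrier_Q)

lemma cls_add:
  "Poly_Mapping.keys f \<subseteq> carrier M \<Longrightarrow> Poly_Mapping.keys g \<subseteq> carrier M \<Longrightarrow>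
     cls (f + g) = cls f \<oplus>\<^bsub>Q\<^esub> cls g"
  using P.residue_add[of f g] by (simp add: monoid_algebra_simps)

lemma cls_single_closed [simp]: "k \<in> carrier M \<Longrightarrow> cls (Poly_Mapping.single k a) \<in> carrier Q"
  by (simp add: cls_closed)

lemma cls_single_mult:
  "k \<in> carrier M \<Longrightarrow> l \<in> carrier M \<Longrightarrow>
     cls (Poly_Mapping.single k a) \<otimes>\<^bsub>Q\<^esub> cls (Poly_Mapping.single l b) =
       cls (Poly_Mapping.single (k \<otimes>\<^bsub>M\<^esub> l) (a * b))"
  using P.residue_mult[of "Poly_Mapping.single k a" "Poly_Mapping.single l b"]
  by (simp add: monoid_algebra_simps twisted_mult_single)

lemma cls_single_smult:
  "k \<in> carrier M \<Longrightarrow> c \<odot>\<^bsub>Q\<^esub> cls (Poly_Mapping.single k a) = cls (Poly_Mapping.single k (c * a))"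
  using P.residue_smult[of "Poly_Mapping.single k a" c] by (simp add: monoid_algebra_simps)

lemma Q_zero: "\<zero>\<^bsub>Q\<^esub> = cls 0"
  by (simp add: P.quotient_zero monoid_algebra_simps)

lemma P_minus:
  assumes "Poly_Mapping.keys f \<subseteq> carrier M" "Poly_Mapping.keys g \<subseteq> carrier M"
  shows "f \<ominus>\<^bsub>monoid_algebra M\<^esub> g = f - g"
proof -
  have "\<ominus>\<^bsub>monoid_algebra M\<^esub> g = - g"
    using assms by (intro P.minus_equality) (auto simp: monoid_algebra_simps in_keys_iff)
  then show ?thesis
    by (simp add: P.minus_eq monoid_algebra_simps)
qed

lemma cls_eq_if_relation:
  assumes "f - g \<in> S" "Poly_Mapping.keys f \<subseteq> carrier M" "Poly_Mapping.keys g \<subseteq> carrier M"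
  shows "cls f = cls g"
  using assms by (intro P.residue_relation) (simp_all add: P_minus monoid_algebra_simps)

lemma Q_induct [consumes 1, case_names zero single add]:
  assumes "x \<in> carrier Q"
    and "P \<zero>\<^bsub>Q\<^esub>"
    and "\<And>k c. k \<in> carrier M \<Longrightarrow> P (cls (Poly_Mapping.single k c))"
    and "\<And>x y. x \<in> carrier Q \<Longrightarrow> y \<in> carrier Q \<Longrightarrow> P x \<Longrightarrow> P y \<Longrightarrow> P (x \<oplus>\<^bsub>Q\<^esub> y)"
  shows "P x"
proof -
  obtain f where f: "Poly_Mapping.keys f \<subseteq> carrier M" "x = cls f"
    using assms(1) by (auto simp: carrier_Q)
  from f(1) have "P (cls f)"
    by (induction f rule: poly_mapping_additive_induct)
      (simp_all add: assms cls_add cls_closed flip: Q_zero)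
  then show ?thesis
    by (simp add: f(2))
qed

lemma quotient_hom_to_type_based:
  fixes B :: "(complex, 'b::ab_group_add) module" and \<phi> :: "'m \<Rightarrow> 'b"
  defines "h \<equiv> quotient_lift (monoid_algebra_lift B \<phi>)"
  assumes B: "type_based_algebra B"
    and mult: "\<And>v w. v \<in> carrier M \<Longrightarrow> w \<in> carrier M \<Longrightarrow> \<phi> (v \<otimes>\<^bsub>M\<^esub> w) = \<phi> v \<otimes>\<^bsub>B\<^esub> \<phi> w"
    and one: "\<phi> \<one>\<^bsub>M\<^esub> = \<one>\<^bsub>B\<^esub>"
    and S: "\<And>s. s \<in> S \<Longrightarrow> monoid_algebra_lift B \<phi> s = 0"
  shows "h \<in> algebra_hom Q B"
    and "k \<in> carrier M \<Longrightarrow> h (cls (Poly_Mapping.single k c)) = c \<odot>\<^bsub>B\<^esub> \<phi> k"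
proof -
  interpret B: type_based_algebra B by fact
  note hom = B.monoid_algebra_lift_hom[OF monoid_axioms mult one]
  show "h \<in> algebra_hom Q B"
    unfolding h_def
    by (rule P.quotient_lift_hom[OF hom B.complex_algebra_axioms]) (simp_all add: S)
  show "h (cls (Poly_Mapping.single k c)) = c \<odot>\<^bsub>B\<^esub> \<phi> k" if "k \<in> carrier M"
  proof -
    have "h (cls (Poly_Mapping.single k c)) = monoid_algebra_lift B \<phi> (Poly_Mapping.single k c)"
      unfolding h_def using that
      by (intro P.quotient_lift_residue[OF hom B.complex_algebra_axioms])
        (simp_all add: S monoid_algebra_simps)
    then show ?thesis
      by simp
  qed
qed

end

lemma free_monoid_simps [simp]:
  "carrier (free_monoid G) = lists G"
  "v \<otimes>\<^bsub>free_monoid G\<^esub> w = v @ w"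
  "\<one>\<^bsub>free_monoid G\<^esub> = []"
  by (simp_all add: free_monoid_def)

lemma monoid_free_monoid: "monoid (free_monoid G)"
  by (rule monoidI) auto

locale presentation =
  fixes G :: "'g set" and R :: "(('g list \<Rightarrow>\<^sub>0 complex) \<times> ('g list \<Rightarrow>\<^sub>0 complex)) set"
  assumes R_subset: "(l, r) \<in> R \<Longrightarrow> Poly_Mapping.keys l \<subseteq> lists G \<and> Poly_Mapping.keys r \<subseteq> lists G"
begin

sublocale monoid_algebra_quotient "free_monoid G" "{l - r | l r. (l, r) \<in> R}"
proof -
  interpret monoid "free_monoid G" by (rule monoid_free_monoid)
  show "monoid_algebra_quotient (free_monoid G) {l - r | l r. (l, r) \<in> R}"
  proof
    have "Poly_Mapping.keys (l - r) \<subseteq> lists G" if "(l, r) \<in> R" for l r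
      using R_subset[OF that] Poly_Mapping.keys_diff[of l r] by blast
    then show "{l - r | l r. (l, r) \<in> R} \<subseteq> {f. Poly_Mapping.keys f \<subseteq> carrier (free_monoid G)}"
      by auto
  qed
qed

lemma presented_algebra_eq: "presented_algebra G R = Q"
  by (simp add: presented_algebra_def)

lemma cls_relation: "(l, r) \<in> R \<Longrightarrow> cls l = cls r"
  using R_subset by (intro cls_eq_if_relation) auto

lemma cls_word_append:
  "v \<in> lists G \<Longrightarrow> w \<in> lists G \<Longrightarrow> cls (word (v @ w)) = cls (word v) \<otimes>\<^bsub>Q\<^esub> cls (word w)"
  by (simp add: word_def cls_single_mult)

lemma cls_word_closed [simp]: "w \<in> lists G \<Longrightarrow> cls (word w) \<in> carrier Q"
  by (simp add: word_def)

text \<open>Relations between words may be applied to factors of longer words.\<close>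
lemma cls_word_context:
  assumes "cls (word v) = cls (word w)" "v \<in> lists G" "w \<in> lists G" "u \<in> lists G" "u' \<in> lists G"
  shows "cls (word (u @ v @ u')) = cls (word (u @ w @ u'))"
  using assms by (simp add: cls_word_append)

text \<open>
  Every word arises from the empty one by left multiplication with generators. So a set spans as
  soon as its span contains the scalars and absorbs generators from the left.
\<close>
lemma carrier_subset_additive_span:
  assumes T: "T \<subseteq> carrier Q"
    and scalars: "\<And>c. cls (Poly_Mapping.single [] c) \<in> additive_span Q T"
    and left: "\<And>g t. g \<in> G \<Longrightarrow> t \<in> T \<Longrightarrow> cls (word [g]) \<otimes>\<^bsub>Q\<^esub> t \<in> additive_span Q T"
  shows "carrier Q \<subseteq> additive_span Q T"
proof
  have left_span: "cls (word [g]) \<otimes>\<^bsub>Q\<^esub> x \<in> additive_span Q T"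
    if "g \<in> G" "x \<in> additive_span Q T" for g x
    using that(2)
  proof induction
    case zero
    then show ?case
      using that(1) additive_span.zero[of Q T] by simp
  next
    case (base s)
    then show ?case
      using left that(1) by blast
  next
    case (add x y)
    then show ?case
      using that(1) Q.additive_span_closed[OF T]
      by (simp add: Q.r_distr additive_span.add)
  qed
  have monomials: "cls (Poly_Mapping.single w c) \<in> additive_span Q T" if "w \<in> lists G" for w c
    using that
  proof (induction w)
    case Nil
    then show ?case by (rule scalars)
  next
    case (Cons g w)
    then show ?case
      using left_span[of g "cls (Poly_Mapping.single w c)"]
        cls_single_mult[of "[g]" w 1 c] by (simp add: word_def)
  qed
  show "x \<in> additive_span Q T" if "x \<in> carrier Q" for x
    using that
    by (induction rule: Q_induct) (simp_all add: monomials additive_span.zero additive_span.add)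
qed

end

definition word_product :: "(complex, 'b) module \<Rightarrow> ('g \<Rightarrow> 'b) \<Rightarrow> 'g list \<Rightarrow> 'b" where
  "word_product B \<phi> w = foldr (\<lambda>g. (\<otimes>\<^bsub>B\<^esub>) (\<phi> g)) w \<one>\<^bsub>B\<^esub>"

lemma word_product_simps [simp]:
  "word_product B \<phi> [] = \<one>\<^bsub>B\<^esub>"
  "word_product B \<phi> (g # w) = \<phi> g \<otimes>\<^bsub>B\<^esub> word_product B \<phi> w"
  by (simp_all add: word_product_def)

lemma (in type_based_algebra) word_product_append:
  "word_product B \<phi> (v @ w) = word_product B \<phi> v \<otimes>\<^bsub>B\<^esub> word_product B \<phi> w"
  by (induction v) (simp_all add: m_assoc)

text \<open>
  The universal property of a presented algebra: values on generators that satisfy the relations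
  extend to a homomorphism.
\<close>
lemma (in presentation) hom_from_generators:
  fixes B :: "(complex, 'b::ab_group_add) module" and \<phi> :: "'g \<Rightarrow> 'b"
  defines "h \<equiv> quotient_lift (monoid_algebra_lift B (word_product B \<phi>))"
  assumes B: "type_based_algebra B"
    and R: "\<And>l r. (l, r) \<in> R \<Longrightarrow>
      monoid_algebra_lift B (word_product B \<phi>) l = monoid_algebra_lift B (word_product B \<phi>) r"
  shows "h \<in> algebra_hom Q B"
    and "w \<in> lists G \<Longrightarrow> h (cls (word w)) = word_product B \<phi> w"
proof -
  interpret B: type_based_algebra B by fact
  note hom = quotient_hom_to_type_based[OF B, where \<phi> = "word_product B \<phi>"]
  have S: "monoid_algebra_lift B (word_product B \<phi>) s = 0" if "s \<in> {l - r | l r. (l, r) \<in> R}" for s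
    using that R by (auto simp: B.monoid_algebra_lift_diff)
  show "h \<in> algebra_hom Q B"
    unfolding h_def by (rule hom(1)) (use S in \<open>simp_all add: B.word_product_append\<close>)
  show "h (cls (word w)) = word_product B \<phi> w" if "w \<in> lists G"
  proof -
    have "h (cls (Poly_Mapping.single w 1)) = 1 \<odot>\<^bsub>B\<^esub> word_product B \<phi> w"
      unfolding h_def by (rule hom(2)) (use S that in \<open>simp_all add: B.word_product_append\<close>)
    then show ?thesis
      by (simp add: word_def B.smult_one)
  qed
qed

section \<open>The quantum torus over the rational functions in \<open>C\<close>\<close>

definition scalar :: "complex \<Rightarrow> complex poly fract" where
  "scalar c = to_fract [:c:]"

lemma scalar_hom:
  "scalar (c + d) = scalar c + scalar d" "scalar (c * d) = scalar c * scalar d" "scalar 1 = 1"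
  by (simp_all add: scalar_def flip: to_fract_add to_fract_mult one_pCons)

lemma scalar_eq_zero_iff [simp]: "scalar c = 0 \<longleftrightarrow> c = 0"
  by (simp add: scalar_def)

lemma to_fract_smult: "to_fract (Polynomial.smult c p) = scalar c * to_fract p"
  by (simp add: scalar_def flip: to_fract_mult)

lemma scalar_power: "scalar c ^ n = scalar (c ^ n)"
  by (induction n) (simp_all add: scalar_hom)

lemma scalar_inverse: "scalar (inverse c) = inverse (scalar c)"
proof (cases "c = 0")
  case True
  then show ?thesis by (simp add: scalar_def)
next
  case False
  then have "scalar c * scalar (inverse c) = 1"
    by (simp flip: scalar_hom)
  then show ?thesis
    by (simp add: inverse_unique)
qed

lemma scalar_powi: "scalar c powi m = scalar (c powi m)"
  by (simp add: power_int_def scalar_power scalar_inverse[symmetric])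

lemma scalar_eq_Fract: "scalar = (\<lambda>c. Fraction_Field.Fract [:c:] 1)"
  by (simp add: scalar_def to_fract_def fun_eq_iff)

lemma poly_additive_induct [case_names zero monom add]:
  assumes "P 0" "\<And>c i. P (monom c i)" "\<And>p r. P p \<Longrightarrow> P r \<Longrightarrow> P (p + r)"
  shows "P p"
proof -
  have "P (\<Sum>i \<in> I. monom (coeff p i) i)" if "finite I" for I
    using that by induction (simp_all add: assms)
  from this[of "{..degree p}"] show ?thesis
    by (simp add: poly_as_sum_of_monoms)
qed

lemma common_denominator_fract:
  fixes f :: "'k \<Rightarrow> 'a::idom fract"
  assumes "finite J"
  shows "\<exists>p. p \<noteq> 0 \<and> (\<forall>k \<in> J. to_fract p * f k \<in> range to_fract)"
  using assms
proof induction
  case empty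
  show ?case
    by (intro exI[of _ 1]) simp
next
  case (insert j J)
  then obtain p where p: "p \<noteq> 0" "\<And>k. k \<in> J \<Longrightarrow> to_fract p * f k \<in> range to_fract"
    by blast
  obtain a b where ab: "f j = Fraction_Field.Fract a b" "b \<noteq> 0"
    by (rule Fract_cases)
  have "to_fract (p * b) * f k \<in> range to_fract" if k: "k \<in> insert j J" for k
  proof (cases "k = j")
    case True
    have "to_fract (p * b) * f j = to_fract (p * a)"
      using ab by (simp add: to_fract_def eq_fract mult_ac)
    with True show ?thesis
      by blast
  next
    case False
    then obtain r where "to_fract p * f k = to_fract r"
      using p(2) k by blast
    then have "to_fract (p * b) * f k = to_fract (b * r)"
      by (simp add: mult.assoc mult.left_commute[of "to_fract p"])
    then show ?thesis
      by blast
  qed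
  then show ?case
    using p(1) ab(2) by (intro exI[of _ "p * b"]) simp
qed

lemma rational_functions_simps [simp]:
  "carrier rational_functions = UNIV"
  "x \<otimes>\<^bsub>rational_functions\<^esub> y = x * y"
  "\<one>\<^bsub>rational_functions\<^esub> = 1"
  "x \<oplus>\<^bsub>rational_functions\<^esub> y = x + y"
  "c \<odot>\<^bsub>rational_functions\<^esub> x = scalar c * x"
  by (simp_all add: rational_functions_def type_algebra_def scalar_eq_Fract)

lemma monoid_rational_functions: "monoid rational_functions"
  by (rule monoidI) (simp_all add: mult.assoc)

locale quantum_parameter =
  fixes q :: complex
  assumes q_nonzero: "q \<noteq> 0"
begin

sublocale torus_scalars "scalar (q\<^sup>2)" scalar
  by unfold_locales (simp_all add: q_nonzero scalar_hom)

abbreviation T :: "(complex, int \<times> int \<Rightarrow>\<^sub>0 complex poly fract) module" where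
  "T \<equiv> quantum_torus (scalar (q\<^sup>2)) scalar"

abbreviation torus_mult (infixl "\<star>" 70) where
  "f \<star> g \<equiv> twisted_mult exponent_group (commutation_factor (scalar (q\<^sup>2))) f g"

lemma tmult_assoc: "(f \<star> g) \<star> h = f \<star> (g \<star> h)"
  by (rule twisted_mult_assoc) simp_all

lemma tmult_one [simp]:
  "Poly_Mapping.single (0, 0) 1 \<star> f = f" "f \<star> Poly_Mapping.single (0, 0) 1 = f"
  using twisted_mult_one[of f] by simp_all

lemma tmult_single:
  "Poly_Mapping.single (i, j) a \<star> Poly_Mapping.single (k, l) b =
     Poly_Mapping.single (i + k, j + l) (scalar ((q\<^sup>2) powi (j * k)) * (a * b))"
  by (simp add: twisted_mult_single commutation_factor_def scalar_powi)

lemma lookup_tmult_single: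
  "Poly_Mapping.lookup (f \<star> Poly_Mapping.single (a, b) c) n =
     scalar ((q\<^sup>2) powi ((snd n - b) * a)) * (Poly_Mapping.lookup f (fst n - a, snd n - b) * c)"
proof -
  have "Poly_Mapping.keys f \<subseteq> UNIV" by simp
  then show ?thesis
  proof (induction f rule: poly_mapping_additive_induct)
    case (single k v)
    then show ?case
      by (cases k; cases n) (auto simp: tmult_single lookup_single when_def)
  qed (simp_all add: twisted_mult_add_left lookup_add algebra_simps)
qed

text \<open>
  For \<open>t\<close> in the torus take \<open>p\<close> a common denominator of its coefficients and \<open>N\<close> a bound for its
  exponents. The product \<open>t p x\<^sup>N y\<^sup>N\<close> then has only nonnegative exponents, and its coefficients
  are polynomials: the powers of \<open>q\<^sup>2\<close> that come from commuting \<open>x\<close> and \<open>y\<close> are constants.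
\<close>
lemma dense_embedding_if_monomials:
  assumes A: "complex_algebra A" and hom: "h \<in> algebra_hom A T" and inj: "inj_on h (carrier A)"
    and monomials: "\<And>i j p. Poly_Mapping.single (int i, int j) (to_fract p) \<in> h ` carrier A"
  shows "dense_embedding A T h"
proof -
  interpret A: complex_algebra A by fact
  let ?I = "h ` carrier A"
  have add: "f + g \<in> ?I" if fg: "f \<in> ?I" "g \<in> ?I" for f g
  proof -
    obtain x y where xy: "x \<in> carrier A" "y \<in> carrier A" "f = h x" "g = h y"
      using fg by blast
    then have "f + g = h (x \<oplus>\<^bsub>A\<^esub> y)"
      by (simp add: algebra_homD(3)[OF hom])
    then show ?thesis
      using xy(1,2) by blast
  qed
  have monomial: "Poly_Mapping.single n (to_fract p) \<in> ?I" if "fst n \<ge> 0" "snd n \<ge> 0" for n p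
    using monomials[of "nat (fst n)" "nat (snd n)" p] that by simp
  have image: "f \<in> ?I"
    if f: "\<And>n. n \<in> Poly_Mapping.keys f \<Longrightarrow>
      fst n \<ge> 0 \<and> snd n \<ge> 0 \<and> Poly_Mapping.lookup f n \<in> range to_fract" for f
  proof -
    have "(\<Sum>n \<in> J. Poly_Mapping.single n (Poly_Mapping.lookup f n)) \<in> ?I"
      if "finite J" "J \<subseteq> Poly_Mapping.keys f" for J
      using that
    proof (induction J rule: finite_induct)
      case empty
      then show ?case
        using monomial[of "(0, 0)" 0] by simp
    next
      case (insert n J)
      then have "Poly_Mapping.single n (Poly_Mapping.lookup f n) \<in> ?I"
        using f[of n] monomial[of n] by auto
      with insert show ?case
        by (simp add: add)
    qed
    from this[of "Poly_Mapping.keys f"] show ?thesis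
      by (simp add: sum_single)
  qed
  show ?thesis
  proof
    show "h \<in> algebra_hom A T" "inj_on h (carrier A)"
      by fact+
    fix t :: "int \<times> int \<Rightarrow>\<^sub>0 complex poly fract"
    obtain p where p: "p \<noteq> 0"
      "\<And>k. k \<in> Poly_Mapping.keys t \<Longrightarrow> to_fract p * Poly_Mapping.lookup t k \<in> range to_fract"
      using common_denominator_fract[of "Poly_Mapping.keys t" "Poly_Mapping.lookup t"] by auto
    obtain N where N: "\<And>k. k \<in> Poly_Mapping.keys t \<Longrightarrow> \<bar>fst k\<bar> \<le> int N \<and> \<bar>snd k\<bar> \<le> int N"
      using keys_in_box[of t t] by auto
    let ?m = "Poly_Mapping.single (int N, int N) (to_fract p)"
    obtain s where s: "s \<in> carrier A" "h s = ?m"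
      using monomials[of N N p] by auto
    have "?m \<noteq> 0"
      using p(1) lookup_single_eq[of "(int N, int N)" "to_fract p"] by (metis lookup_zero to_fract_eq_0_iff)
    then have "s \<in> carrier A - {\<zero>\<^bsub>A\<^esub>}"
      using s algebra_hom_zero[OF hom A torus.complex_algebra_axioms] by auto
    moreover have "t \<star> ?m \<in> ?I"
    proof (rule image)
      fix n assume "n \<in> Poly_Mapping.keys (t \<star> ?m)"
      then have nz: "Poly_Mapping.lookup (t \<star> ?m) n \<noteq> 0"
        by (simp add: in_keys_iff)
      let ?k = "(fst n - int N, snd n - int N)"
      have k: "?k \<in> Poly_Mapping.keys t"
        using nz by (simp add: lookup_tmult_single in_keys_iff)
      obtain r where r: "to_fract p * Poly_Mapping.lookup t ?k = to_fract r"
        using p(2)[OF k] by blast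
      have "Poly_Mapping.lookup (t \<star> ?m) n =
          to_fract ([:(q\<^sup>2) powi ((snd n - int N) * int N):] * r)"
        by (simp add: lookup_tmult_single to_fract_smult mult_ac flip: r)
      then show "fst n \<ge> 0 \<and> snd n \<ge> 0 \<and> Poly_Mapping.lookup (t \<star> ?m) n \<in> range to_fract"
        using N[OF k] by auto
    qed
    ultimately show "\<exists>s \<in> carrier A - {\<zero>\<^bsub>A\<^esub>}. t \<otimes>\<^bsub>T\<^esub> h s \<in> ?I"
      using s(2) by (intro bexI[of _ s]) simp_all
  qed
qed

section \<open>The generalized Weyl algebra in the quantum torus\<close>

text \<open>The inclusion of \<open>\<complex>[C][H]\<close> that sends \<open>H\<close> to \<open>x\<close>.\<close>

definition poly_H :: "complex poly poly \<Rightarrow> (int \<times> int \<Rightarrow>\<^sub>0 complex poly fract)" where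
  "poly_H d = (\<Sum>i \<le> degree d. Poly_Mapping.single (int i, 0) (to_fract (coeff d i)))"

lemma lookup_poly_H:
  "Poly_Mapping.lookup (poly_H d) n =
     (if fst n \<ge> 0 \<and> snd n = 0 then to_fract (coeff d (nat (fst n))) else 0)"
proof (cases n)
  case (Pair a b)
  have "Poly_Mapping.lookup (poly_H d) n =
      (\<Sum>i \<le> degree d. if i = nat a \<and> a \<ge> 0 \<and> b = 0 then to_fract (coeff d i) else 0)"
    unfolding poly_H_def lookup_sum Pair
    by (intro sum.cong refl) (auto simp: lookup_single when_def)
  also have "\<dots> = (if a \<ge> 0 \<and> b = 0 then to_fract (coeff d (nat a)) else 0)"
    by (auto simp: coeff_eq_0)
  finally show ?thesis
    by (simp add: Pair)
qed

lemma poly_H_add: "poly_H (d + e) = poly_H d + poly_H e"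
  by (rule poly_mapping_eqI) (simp add: lookup_poly_H lookup_add)

lemma poly_H_monom: "poly_H (monom c i) = Poly_Mapping.single (int i, 0) (to_fract c)"
  by (rule poly_mapping_eqI) (auto simp: lookup_poly_H lookup_single when_def prod_eq_iff)

lemma poly_H_zero [simp]: "poly_H 0 = 0"
  by (rule poly_mapping_eqI) (simp add: lookup_poly_H)

lemma poly_H_mult: "poly_H (d * e) = poly_H d \<star> poly_H e"
proof (induction d rule: poly_additive_induct)
  case (monom c i)
  show ?case
    by (induction e rule: poly_additive_induct)
      (simp_all add: mult_monom poly_H_monom tmult_single scalar_hom distrib_left poly_H_add
        twisted_mult_add_right)
qed (simp_all add: distrib_right poly_H_add twisted_mult_add_left)

lemma poly_H_one: "poly_H 1 = Poly_Mapping.single (0, 0) 1"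
  using poly_H_monom[of 1 0] by simp

lemma poly_H_smult: "poly_H ([:[:c:]:] * d) = Poly_Mapping.map ((*) (scalar c)) (poly_H d)"
  by (rule poly_mapping_eqI) (simp add: lookup_poly_H scalar_def flip: to_fract_mult)

abbreviation \<sigma> :: "complex poly poly \<Rightarrow> complex poly poly" where
  "\<sigma> \<equiv> so3_aut q"

lemma coeff_so3_aut: "coeff (so3_aut r d) i = [:r\<^sup>2:] ^ i * coeff d i"
proof -
  have "[:[:r\<^sup>2:]:] * var_H = [:0, [:r\<^sup>2:]:]"
    by (simp add: var_H_def)
  then show ?thesis
    by (simp add: so3_aut_def coeff_pcompose_linear)
qed

lemma const_poly_power: "[:c:] ^ n = [:c ^ n :: complex:]"
  by (induction n) (simp_all add: one_pCons)

lemma so3_aut_inverse: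
  "so3_aut q (so3_aut (inverse q) d) = d" "so3_aut (inverse q) (so3_aut q d) = d"
  by (rule poly_eqI,
      simp add: coeff_so3_aut const_poly_power q_nonzero power_inverse field_simps)+

lemma inv_so3_aut: "inv_into UNIV \<sigma> = so3_aut (inverse q)"
proof -
  have "surj \<sigma>" "inj \<sigma>"
    by (metis so3_aut_inverse(1) surjI) (metis so3_aut_inverse(2) injI)
  then show ?thesis
    by (metis inv_f_f so3_aut_inverse(1) ext)
qed

lemma so3_aut_zero: "so3_aut r 0 = 0"
  by (simp add: so3_aut_def)

lemma so3_aut_add: "so3_aut r (d + e) = so3_aut r d + so3_aut r e"
  by (simp add: so3_aut_def pcompose_add)

lemma y_poly_H:
  "Poly_Mapping.single (0, 1) 1 \<star> poly_H d = poly_H (\<sigma> d) \<star> Poly_Mapping.single (0, 1) 1"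
proof (induction d rule: poly_additive_induct)
  case (monom c i)
  have "\<sigma> (monom c i) = monom ([:(q\<^sup>2) ^ i:] * c) i"
    by (rule poly_eqI) (auto simp: coeff_so3_aut const_poly_power)
  then show ?case
    by (simp add: poly_H_monom tmult_single scalar_hom to_fract_smult)
qed (simp_all add: so3_aut_zero so3_aut_add poly_H_add twisted_mult_add_left twisted_mult_add_right)

lemma y_inverse:
  "Poly_Mapping.single (0, 1) 1 \<star> Poly_Mapping.single (0, - 1) 1 = Poly_Mapping.single (0, 0) 1"
  "Poly_Mapping.single (0, - 1) 1 \<star> Poly_Mapping.single (0, 1) 1 = Poly_Mapping.single (0, 0) 1"
  by (simp_all add: tmult_single scalar_hom)

lemma y_inverse_poly_H:
  "Poly_Mapping.single (0, - 1) 1 \<star> poly_H d =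
     poly_H (so3_aut (inverse q) d) \<star> Poly_Mapping.single (0, - 1) 1"
proof -
  let ?y = "Poly_Mapping.single (0, 1) 1" and ?z = "Poly_Mapping.single (0, - 1) 1"
  let ?e = "so3_aut (inverse q) d"
  have "?z \<star> poly_H d = ?z \<star> ((poly_H (\<sigma> ?e) \<star> ?y) \<star> ?z)"
    by (simp add: tmult_assoc y_inverse so3_aut_inverse)
  also have "\<dots> = (?z \<star> ?y) \<star> (poly_H ?e \<star> ?z)"
    by (simp add: tmult_assoc flip: y_poly_H)
  finally show ?thesis
    by (simp add: y_inverse)
qed

definition weyl_element :: "complex poly poly" where
  "weyl_element = var_C + [:[:1 / (q * (1 + q\<^sup>2)):]:] * var_H\<^sup>2"

lemma weyl_element_nonzero: "weyl_element \<noteq> 0"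
proof
  assume "weyl_element = 0"
  then have "coeff weyl_element 0 = 0"
    by simp
  then show False
    by (simp add: weyl_element_def var_C_def var_H_def power2_eq_square)
qed

text \<open>
  The defining relations with the operations of the coefficient ring evaluated, and with the inverse
  automorphism written as the automorphism for \<open>q\<^sup>-\<^sup>1\<close>.
\<close>
definition gwa_relations ::
    "((complex poly poly gwa_gen list \<Rightarrow>\<^sub>0 complex) \<times> (complex poly poly gwa_gen list \<Rightarrow>\<^sub>0 complex)) set"
  where
  "gwa_relations =
      {(word [Coef (d + e)], word [Coef d] + word [Coef e]) | d e. True}
      \<union> {(word [Coef (d * e)], word [Coef d, Coef e]) | d e. True}
      \<union> {(word [Coef ([:[:c:]:] * d)], Poly_Mapping.single [Coef d] c) | c d. True}
      \<union> {(word [Coef 1], word [])}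
      \<union> {(word [Gen_X, Coef d], word [Coef (\<sigma> d), Gen_X]) | d. True}
      \<union> {(word [Gen_Y, Coef d], word [Coef (so3_aut (inverse q) d), Gen_Y]) | d. True}
      \<union> {(word [Gen_Y, Gen_X], word [Coef weyl_element]), (word [Gen_X, Gen_Y], word [Coef (\<sigma> weyl_element)])}"

lemma O_so3_eq: "O_so3 q = presented_algebra UNIV gwa_relations"
proof -
  have "Coef ` UNIV \<union> {Gen_X, Gen_Y} = (UNIV :: complex poly poly gwa_gen set)"
    by (auto intro: gwa_gen.exhaust)
  then show ?thesis
    by (simp add: O_so3_def gwa_def poly_HC_def type_algebra_def gwa_relations_def inv_so3_aut weyl_element_def)
qed

sublocale gwa: presentation UNIV gwa_relations
  by unfold_locales simp

text \<open>
  The relation \<open>Y X = a\<close> leaves no choice for \<open>Y\<close> once \<open>X\<close> is the invertible element \<open>y\<close>.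
\<close>
definition gwa_image :: "complex poly poly gwa_gen \<Rightarrow> (int \<times> int \<Rightarrow>\<^sub>0 complex poly fract)" where
  "gwa_image g = (case g of
     Coef d \<Rightarrow> poly_H d
   | Gen_X \<Rightarrow> Poly_Mapping.single (0, 1) 1
   | Gen_Y \<Rightarrow> poly_H weyl_element \<star> Poly_Mapping.single (0, - 1) 1)"

lemma gwa_image_simps [simp]:
  "gwa_image (Coef d) = poly_H d"
  "gwa_image Gen_X = Poly_Mapping.single (0, 1) 1"
  "gwa_image Gen_Y = poly_H weyl_element \<star> Poly_Mapping.single (0, - 1) 1"
  by (simp_all add: gwa_image_def)

definition gwa_embedding ::
    "(complex poly poly gwa_gen list \<Rightarrow>\<^sub>0 complex) set \<Rightarrow> (int \<times> int \<Rightarrow>\<^sub>0 complex poly fract)" where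
  "gwa_embedding = quotient_lift (monoid_algebra_lift T (word_product T gwa_image))"

lemma map_scalar_one: "Poly_Mapping.map ((*) (scalar 1)) f = f"
  by (rule poly_mapping_eqI) (simp add: scalar_hom)

lemma lift_word [simp]: "monoid_algebra_lift T \<phi> (word w) = \<phi> w"
  by (simp add: word_def map_scalar_one)

lemma gwa_relations_hold:
  assumes "(l, r) \<in> gwa_relations"
  shows "monoid_algebra_lift T (word_product T gwa_image) l =
    monoid_algebra_lift T (word_product T gwa_image) r"
proof -
  let ?z = "Poly_Mapping.single (0, - 1) 1" and ?y = "Poly_Mapping.single (0, 1) 1"
  have Yd': "(poly_H weyl_element \<star> ?z) \<star> poly_H d = poly_H (so3_aut (inverse q) d) \<star> (poly_H weyl_element \<star> ?z)" for d
  proof -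
    have "(poly_H weyl_element \<star> ?z) \<star> poly_H d = poly_H (weyl_element * so3_aut (inverse q) d) \<star> ?z"
      by (simp add: tmult_assoc y_inverse_poly_H poly_H_mult)
    also have "weyl_element * so3_aut (inverse q) d = so3_aut (inverse q) d * weyl_element"
      by (rule mult.commute)
    finally show ?thesis
      by (simp only: poly_H_mult tmult_assoc)
  qed
  have YX': "(poly_H weyl_element \<star> ?z) \<star> ?y = poly_H weyl_element"
    by (simp only: tmult_assoc y_inverse tmult_one)
  have XY': "?y \<star> (poly_H weyl_element \<star> ?z) = poly_H (\<sigma> weyl_element)"
    by (simp only: y_poly_H y_inverse tmult_one tmult_assoc flip: tmult_assoc[of ?y])
  consider
      (add) d e where "l = word [Coef (d + e)]" "r = word [Coef d] + word [Coef e]"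
    | (mult) d e where "l = word [Coef (d * e)]" "r = word [Coef d, Coef e]"
    | (scale) c d where "l = word [Coef ([:[:c:]:] * d)]" "r = Poly_Mapping.single [Coef d] c"
    | (one) "l = word [Coef 1]" "r = word []"
    | (Xd) d where "l = word [Gen_X, Coef d]" "r = word [Coef (\<sigma> d), Gen_X]"
    | (Yd) d where "l = word [Gen_Y, Coef d]" "r = word [Coef (so3_aut (inverse q) d), Gen_Y]"
    | (YX) "l = word [Gen_Y, Gen_X]" "r = word [Coef weyl_element]"
    | (XY) "l = word [Gen_X, Gen_Y]" "r = word [Coef (\<sigma> weyl_element)]"
    using assms unfolding gwa_relations_def by blast
  then show ?thesis
  proof cases
    case add
    then show ?thesis
      by (simp add: torus.monoid_algebra_lift_add poly_H_add)
  next
    case mult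
    then show ?thesis
      by (simp add: poly_H_mult)
  next
    case scale
    have "monoid_algebra_lift T (word_product T gwa_image) l = poly_H ([:[:c:]:] * d)"
      unfolding scale by (simp only: lift_word word_product_simps gwa_image_simps torus_simps tmult_one)
    also have "\<dots> = monoid_algebra_lift T (word_product T gwa_image) r"
      unfolding scale poly_H_smult by simp
    finally show ?thesis .
  next
    case one
    then show ?thesis
      by (simp add: poly_H_one)
  next
    case Xd
    then show ?thesis
      by (simp add: y_poly_H)
  next
    case Yd
    then show ?thesis
      by (simp add: Yd')
  next
    case YX
    then show ?thesis
      by (simp add: YX')
  next
    case XY
    then show ?thesis
      by (simp add: XY')
  qed
qed

lemma gwa_embedding_hom: "gwa_embedding \<in> algebra_hom gwa.Q T"
  and gwa_embedding_word: "gwa_embedding (gwa.cls (word w)) = word_product T gwa_image w"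
  unfolding gwa_embedding_def
  using gwa.hom_from_generators[OF torus.type_based_algebra_axioms gwa_relations_hold] by auto

text \<open>The power \<open>X\<^sup>j\<close> for \<open>j \<ge> 0\<close> and \<open>Y\<^sup>-\<^sup>j\<close> for \<open>j < 0\<close>.\<close>
definition weyl_monomial :: "int \<Rightarrow> complex poly poly gwa_gen list" where
  "weyl_monomial j = replicate (nat j) Gen_X @ replicate (nat (- j)) Gen_Y"

lemma weyl_monomial_X: "j \<ge> 0 \<Longrightarrow> Gen_X # weyl_monomial j = weyl_monomial (j + 1)"
  by (simp add: weyl_monomial_def nat_add_distrib)

lemma weyl_monomial_Y:
  assumes "j \<le> 0"
  shows "Gen_Y # weyl_monomial j = weyl_monomial (j - 1)"
proof -
  have "nat (1 - j) = Suc (nat (- j))"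
    using assms by linarith
  then show ?thesis
    using assms by (simp add: weyl_monomial_def)
qed

lemma weyl_monomial_pos: "j > 0 \<Longrightarrow> weyl_monomial j = Gen_X # weyl_monomial (j - 1)"
  using weyl_monomial_X[of "j - 1"] by simp

lemma weyl_monomial_neg: "j < 0 \<Longrightarrow> weyl_monomial j = Gen_Y # weyl_monomial (j + 1)"
  using weyl_monomial_Y[of "j + 1"] by simp

text \<open>
  For \<open>Y\<^sup>n\<close> the coefficient is \<open>a \<sigma>\<^sup>-\<^sup>1(a) \<dots> \<sigma>\<^sup>1\<^sup>-\<^sup>n(a)\<close>, which does not vanish because
  \<open>\<complex>[C][H]\<close> is a domain and \<open>\<sigma>\<close> is bijective.
\<close>
lemma word_product_weyl_monomial:
  "\<exists>e. e \<noteq> 0 \<and>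
     word_product T gwa_image (weyl_monomial j) = poly_H e \<star> Poly_Mapping.single (0, j) 1"
proof (cases "j \<ge> 0")
  case True
  have "word_product T gwa_image (replicate n Gen_X) = Poly_Mapping.single (0, int n) 1" for n
    by (induction n) (simp_all add: tmult_single scalar_hom)
  with True show ?thesis
    by (intro exI[of _ 1]) (simp add: weyl_monomial_def poly_H_one)
next
  case False
  have "\<exists>e. e \<noteq> 0 \<and>
      word_product T gwa_image (replicate n Gen_Y) = poly_H e \<star> Poly_Mapping.single (0, - int n) 1" for n
  proof (induction n)
    case 0
    then show ?case
      by (intro exI[of _ 1]) (simp add: poly_H_one)
  next
    case (Suc n)
    then obtain e where e: "e \<noteq> 0"
      "word_product T gwa_image (replicate n Gen_Y) = poly_H e \<star> Poly_Mapping.single (0, - int n) 1"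
      by blast
    let ?e = "weyl_element * so3_aut (inverse q) e"
    have "so3_aut (inverse q) e \<noteq> 0"
      using e(1) so3_aut_inverse(1)[of e] so3_aut_zero by metis
    then have "?e \<noteq> 0"
      using weyl_element_nonzero by simp
    moreover have "word_product T gwa_image (replicate (Suc n) Gen_Y) =
        (poly_H weyl_element \<star> (Poly_Mapping.single (0, - 1) 1 \<star> poly_H e)) \<star>
          Poly_Mapping.single (0, - int n) 1"
      by (simp add: e(2) tmult_assoc)
    then have "word_product T gwa_image (replicate (Suc n) Gen_Y) =
        poly_H ?e \<star> (Poly_Mapping.single (0, - 1) 1 \<star> Poly_Mapping.single (0, - int n) 1)"
      by (simp add: y_inverse_poly_H poly_H_mult tmult_assoc)
    then have "word_product T gwa_image (replicate (Suc n) Gen_Y) =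
        poly_H ?e \<star> Poly_Mapping.single (0, - int (Suc n)) 1"
      by (simp add: tmult_single scalar_hom)
    ultimately show ?case
      by blast
  qed
  from this[of "nat (- j)"] False show ?thesis
    by (simp add: weyl_monomial_def)
qed

definition normal_word :: "int \<Rightarrow> complex poly poly \<Rightarrow>
    (complex poly poly gwa_gen list \<Rightarrow>\<^sub>0 complex) set" where
  "normal_word j d = gwa.cls (word (Coef d # weyl_monomial j))"

lemma gwa_rewrite:
  assumes "(word v, word w) \<in> gwa_relations"
  shows "gwa.cls (word (u @ v @ u')) = gwa.cls (word (u @ w @ u'))"
  using gwa.cls_relation[OF assms] by (rule gwa.cls_word_context) simp_all

text \<open>
  Read from left to right, these rules carry every word to a normal form: coefficients move to the
  left and merge, and \<open>X\<close> and \<open>Y\<close> do not stay next to each other.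
\<close>
lemma gwa_rewrite_rules:
  "gwa.cls (word (u @ [Coef d, Coef e] @ v)) = gwa.cls (word (u @ [Coef (d * e)] @ v))"
  "gwa.cls (word (u @ [Gen_X, Coef d] @ v)) = gwa.cls (word (u @ [Coef (\<sigma> d), Gen_X] @ v))"
  "gwa.cls (word (u @ [Gen_Y, Coef d] @ v)) =
     gwa.cls (word (u @ [Coef (so3_aut (inverse q) d), Gen_Y] @ v))"
  "gwa.cls (word (u @ [Gen_Y, Gen_X] @ v)) = gwa.cls (word (u @ [Coef weyl_element] @ v))"
  "gwa.cls (word (u @ [Gen_X, Gen_Y] @ v)) = gwa.cls (word (u @ [Coef (\<sigma> weyl_element)] @ v))"
proof -
  have r: "(word [Coef (d * e)], word [Coef d, Coef e]) \<in> gwa_relations"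
    "(word [Gen_X, Coef d], word [Coef (\<sigma> d), Gen_X]) \<in> gwa_relations"
    "(word [Gen_Y, Coef d], word [Coef (so3_aut (inverse q) d), Gen_Y]) \<in> gwa_relations"
    "(word [Gen_Y, Gen_X], word [Coef weyl_element]) \<in> gwa_relations"
    "(word [Gen_X, Gen_Y], word [Coef (\<sigma> weyl_element)]) \<in> gwa_relations"
    unfolding gwa_relations_def by blast+
  show "gwa.cls (word (u @ [Coef d, Coef e] @ v)) = gwa.cls (word (u @ [Coef (d * e)] @ v))"
    by (rule gwa_rewrite[OF r(1), symmetric])
  show "gwa.cls (word (u @ [Gen_X, Coef d] @ v)) = gwa.cls (word (u @ [Coef (\<sigma> d), Gen_X] @ v))"
    by (rule gwa_rewrite[OF r(2)])
  show "gwa.cls (word (u @ [Gen_Y, Coef d] @ v)) =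
      gwa.cls (word (u @ [Coef (so3_aut (inverse q) d), Gen_Y] @ v))"
    by (rule gwa_rewrite[OF r(3)])
  show "gwa.cls (word (u @ [Gen_Y, Gen_X] @ v)) = gwa.cls (word (u @ [Coef weyl_element] @ v))"
    by (rule gwa_rewrite[OF r(4)])
  show "gwa.cls (word (u @ [Gen_X, Gen_Y] @ v)) = gwa.cls (word (u @ [Coef (\<sigma> weyl_element)] @ v))"
    by (rule gwa_rewrite[OF r(5)])
qed

lemma normal_word_Coef: "gwa.cls (word [Coef e]) \<otimes>\<^bsub>gwa.Q\<^esub> normal_word j d = normal_word j (e * d)"
  using gwa_rewrite_rules(1)[of "[]" e d "weyl_monomial j"]
  by (simp add: normal_word_def flip: gwa.cls_word_append)

lemma normal_word_X:
  "\<exists>j' d'. gwa.cls (word [Gen_X]) \<otimes>\<^bsub>gwa.Q\<^esub> normal_word j d = normal_word j' d'"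
proof -
  have eq: "gwa.cls (word [Gen_X]) \<otimes>\<^bsub>gwa.Q\<^esub> normal_word j d =
      gwa.cls (word (Coef (\<sigma> d) # Gen_X # weyl_monomial j))"
    using gwa_rewrite_rules(2)[of "[]" d "weyl_monomial j"]
    by (simp add: normal_word_def flip: gwa.cls_word_append)
  show ?thesis
  proof (cases "j \<ge> 0")
    case True
    then have "gwa.cls (word [Gen_X]) \<otimes>\<^bsub>gwa.Q\<^esub> normal_word j d = normal_word (j + 1) (\<sigma> d)"
      unfolding eq by (simp add: normal_word_def weyl_monomial_X)
    then show ?thesis
      by blast
  next
    case False
    then have "gwa.cls (word [Gen_X]) \<otimes>\<^bsub>gwa.Q\<^esub> normal_word j d =
        normal_word (j + 1) (\<sigma> d * \<sigma> weyl_element)"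
      unfolding eq
      using gwa_rewrite_rules(5)[of "[Coef (\<sigma> d)]" "weyl_monomial (j + 1)"]
        gwa_rewrite_rules(1)[of "[]" "\<sigma> d" "\<sigma> weyl_element" "weyl_monomial (j + 1)"]
      by (simp add: normal_word_def weyl_monomial_neg)
    then show ?thesis
      by blast
  qed
qed

lemma normal_word_Y:
  "\<exists>j' d'. gwa.cls (word [Gen_Y]) \<otimes>\<^bsub>gwa.Q\<^esub> normal_word j d = normal_word j' d'"
proof -
  let ?d = "so3_aut (inverse q) d"
  have eq: "gwa.cls (word [Gen_Y]) \<otimes>\<^bsub>gwa.Q\<^esub> normal_word j d =
      gwa.cls (word (Coef ?d # Gen_Y # weyl_monomial j))"
    using gwa_rewrite_rules(3)[of "[]" d "weyl_monomial j"]
    by (simp add: normal_word_def flip: gwa.cls_word_append)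
  show ?thesis
  proof (cases "j \<le> 0")
    case True
    then have "gwa.cls (word [Gen_Y]) \<otimes>\<^bsub>gwa.Q\<^esub> normal_word j d = normal_word (j - 1) ?d"
      unfolding eq by (simp add: normal_word_def weyl_monomial_Y)
    then show ?thesis
      by blast
  next
    case False
    then have "gwa.cls (word [Gen_Y]) \<otimes>\<^bsub>gwa.Q\<^esub> normal_word j d =
        normal_word (j - 1) (?d * weyl_element)"
      unfolding eq
      using gwa_rewrite_rules(4)[of "[Coef ?d]" "weyl_monomial (j - 1)"]
        gwa_rewrite_rules(1)[of "[]" ?d weyl_element "weyl_monomial (j - 1)"]
      by (simp add: normal_word_def weyl_monomial_pos)
    then show ?thesis
      by blast
  qed
qed

text \<open>
  Left multiplication by a generator carries a normal form \<open>d X\<^sup>j\<close> or \<open>d Y\<^sup>j\<close> to another one: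
  the generator moves past \<open>d\<close>, and \<open>X Y\<close> or \<open>Y X\<close> collapses into a coefficient where it occurs.
\<close>
lemma normal_words_span:
  "carrier gwa.Q \<subseteq> additive_span gwa.Q {normal_word j d | j d. True}"
proof (rule gwa.carrier_subset_additive_span)
  show "{normal_word j d | j d. True} \<subseteq> carrier gwa.Q"
    by (auto simp: normal_word_def)
next
  fix c
  have "gwa.cls (word [Coef ([:[:c:]:] * 1)]) = gwa.cls (Poly_Mapping.single [Coef 1] c)"
    by (rule gwa.cls_relation) (unfold gwa_relations_def, blast)
  also have "\<dots> = c \<odot>\<^bsub>gwa.Q\<^esub> gwa.cls (word [Coef 1])"
    by (simp add: word_def gwa.cls_single_smult)
  also have "gwa.cls (word [Coef 1]) = gwa.cls (word [])"
    by (rule gwa.cls_relation) (unfold gwa_relations_def, blast)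
  also have "c \<odot>\<^bsub>gwa.Q\<^esub> gwa.cls (word []) = gwa.cls (Poly_Mapping.single [] c)"
    by (simp add: word_def gwa.cls_single_smult)
  finally have "gwa.cls (Poly_Mapping.single [] c) = normal_word 0 ([:[:c:]:] * 1)"
    by (simp add: normal_word_def weyl_monomial_def)
  then show "gwa.cls (Poly_Mapping.single [] c) \<in> additive_span gwa.Q {normal_word j d | j d. True}"
    by (intro additive_span.base) blast
next
  fix g t assume "t \<in> {normal_word j d | j d. True}"
  then obtain j d where t: "t = normal_word j d"
    by blast
  have "\<exists>j' d'. gwa.cls (word [g]) \<otimes>\<^bsub>gwa.Q\<^esub> t = normal_word j' d'"
    unfolding t by (cases g) (use normal_word_Coef normal_word_X normal_word_Y in blast)+
  then show "gwa.cls (word [g]) \<otimes>\<^bsub>gwa.Q\<^esub> t \<in> additive_span gwa.Q {normal_word j d | j d. True}"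
    by (intro additive_span.base) blast
qed

lemma normal_word_add: "normal_word j (d + e) = normal_word j d \<oplus>\<^bsub>gwa.Q\<^esub> normal_word j e"
proof -
  have split: "normal_word j d = gwa.cls (word [Coef d]) \<otimes>\<^bsub>gwa.Q\<^esub> gwa.cls (word (weyl_monomial j))" for d
    by (simp add: normal_word_def flip: gwa.cls_word_append)
  have "gwa.cls (word [Coef (d + e)]) = gwa.cls (word [Coef d] + word [Coef e])"
    by (rule gwa.cls_relation) (unfold gwa_relations_def, blast)
  also have "\<dots> = gwa.cls (word [Coef d]) \<oplus>\<^bsub>gwa.Q\<^esub> gwa.cls (word [Coef e])"
    by (rule gwa.cls_add) simp_all
  finally show ?thesis
    by (simp add: split gwa.Q.l_distr)
qed

text \<open>
  The images of the normal forms have different exponents of \<open>y\<close>, so they cannot cancel; and the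
  coefficient \<open>d\<close> only gets multiplied by a nonzero polynomial.
\<close>
lemma gwa_embedding_inj: "inj_on gwa_embedding (carrier gwa.Q)"
proof (rule gwa.Q.inj_on_if_independent_family[where e = normal_word])
  show "\<forall>j \<in> J. d j = 0" if J: "finite J" "(\<Sum>j \<in> J. gwa_embedding (normal_word j (d j))) = 0" for J d
  proof
    fix j assume j: "j \<in> J"
    have "\<exists>b. \<forall>j. b j \<noteq> 0 \<and>
        word_product T gwa_image (weyl_monomial j) = poly_H (b j) \<star> Poly_Mapping.single (0, j) 1"
      using word_product_weyl_monomial by (intro choice allI)
    then obtain b where b: "\<And>j. b j \<noteq> 0"
      "\<And>j. word_product T gwa_image (weyl_monomial j) = poly_H (b j) \<star> Poly_Mapping.single (0, j) 1"
      by blast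
    have emb: "gwa_embedding (normal_word i (d i)) = poly_H (d i * b i) \<star> Poly_Mapping.single (0, i) 1" for i
      by (simp add: normal_word_def gwa_embedding_word b(2) poly_H_mult tmult_assoc)
    have "coeff (d j * b j) n = 0" for n
    proof -
      have "0 = (\<Sum>i \<in> J. Poly_Mapping.lookup (poly_H (d i * b i) \<star> Poly_Mapping.single (0, i) 1) (int n, j))"
        using J(2) by (simp add: emb flip: lookup_sum)
      also have "\<dots> = (\<Sum>i \<in> J. if i = j then to_fract (coeff (d j * b j) n) else 0)"
        by (intro sum.cong refl) (auto simp: lookup_tmult_single lookup_poly_H scalar_hom)
      also have "\<dots> = to_fract (coeff (d j * b j) n)"
        using J(1) j by simp
      finally show ?thesis
        by simp
    qed
    then have "d j * b j = 0"
      by (intro poly_eqI) simp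
    then show "d j = 0"
      using b(1) by simp
  qed
qed (use normal_words_span normal_word_add algebra_homD(3)[OF gwa_embedding_hom] in
    \<open>auto simp: normal_word_def\<close>)

text \<open>The element \<open>p(C) H\<^sup>i X\<^sup>j\<close> is mapped to \<open>p(C) x\<^sup>i y\<^sup>j\<close>.\<close>
lemma dense_embedding_gwa: "dense_embedding gwa.Q T gwa_embedding"
proof (rule dense_embedding_if_monomials[OF gwa.Q.complex_algebra_axioms
      gwa_embedding_hom gwa_embedding_inj])
  fix i j p
  have "word_product T gwa_image (replicate j Gen_X) = Poly_Mapping.single (0, int j) 1"
    by (induction j) (simp_all add: tmult_single scalar_hom)
  then have "Poly_Mapping.single (int i, int j) (to_fract p) =
      gwa_embedding (gwa.cls (word (Coef (monom p i) # replicate j Gen_X)))"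
    by (simp add: gwa_embedding_word poly_H_monom tmult_single scalar_hom)
  then show "Poly_Mapping.single (int i, int j) (to_fract p) \<in> gwa_embedding ` carrier gwa.Q"
    by (rule image_eqI) simp
qed

section \<open>The tensor product in the quantum torus\<close>

definition plane_relations :: "((plane_gen list \<Rightarrow>\<^sub>0 complex) \<times> (plane_gen list \<Rightarrow>\<^sub>0 complex)) set" where
  "plane_relations = {(word [Plane_y, Plane_x], Poly_Mapping.single [Plane_x, Plane_y] (q\<^sup>2))}"

sublocale plane: presentation UNIV plane_relations
  by unfold_locales simp

lemma quantum_plane_eq: "quantum_plane (q\<^sup>2) = plane.Q"
proof -
  have "{Plane_x, Plane_y} = UNIV"
    by (auto intro: plane_gen.exhaust)
  then show ?thesis
    unfolding quantum_plane_def plane_relations_def[symmetric] by (simp add: plane.presented_algebra_eq)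
qed

definition plane_monomial :: "nat \<Rightarrow> nat \<Rightarrow> (plane_gen list \<Rightarrow>\<^sub>0 complex) set" where
  "plane_monomial i j = plane.cls (word (replicate i Plane_x @ replicate j Plane_y))"

lemma plane_monomial_closed [simp]: "plane_monomial i j \<in> carrier plane.Q"
  by (simp add: plane_monomial_def)

text \<open>Moving \<open>y\<close> past \<open>x\<^sup>i\<close> collects one factor \<open>q\<^sup>2\<close> for each \<open>x\<close>.\<close>
lemma y_times_plane_word:
  "plane.cls (word (Plane_y # replicate i Plane_x @ v)) =
     (q\<^sup>2) ^ i \<odot>\<^bsub>plane.Q\<^esub> plane.cls (word (replicate i Plane_x @ Plane_y # v))"
proof (induction i)
  case 0
  then show ?case by (simp add: plane.Q.smult_one)
next
  case (Suc i)
  let ?w = "replicate i Plane_x @ v" and ?u = "replicate i Plane_x @ Plane_y # v"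
  have "plane.cls (word [Plane_y, Plane_x]) = plane.cls (Poly_Mapping.single [Plane_x, Plane_y] (q\<^sup>2))"
    by (rule plane.cls_relation) (simp add: plane_relations_def)
  also have "\<dots> = q\<^sup>2 \<odot>\<^bsub>plane.Q\<^esub> plane.cls (word [Plane_x, Plane_y])"
    by (simp add: word_def plane.cls_single_smult)
  finally have "plane.cls (word [Plane_y, Plane_x]) =
      q\<^sup>2 \<odot>\<^bsub>plane.Q\<^esub> plane.cls (word [Plane_x, Plane_y])" .
  then have "plane.cls (word ([Plane_y, Plane_x] @ ?w)) =
      (q\<^sup>2 \<odot>\<^bsub>plane.Q\<^esub> plane.cls (word [Plane_x, Plane_y])) \<otimes>\<^bsub>plane.Q\<^esub> plane.cls (word ?w)"
    by (subst plane.cls_word_append) simp_all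
  also have "\<dots> = q\<^sup>2 \<odot>\<^bsub>plane.Q\<^esub> plane.cls (word ([Plane_x, Plane_y] @ ?w))"
    by (subst plane.cls_word_append) (simp_all add: plane.Q.smult_mult_left)
  also have "plane.cls (word ([Plane_x, Plane_y] @ ?w)) =
      plane.cls (word [Plane_x]) \<otimes>\<^bsub>plane.Q\<^esub> plane.cls (word (Plane_y # ?w))"
    by (simp flip: plane.cls_word_append)
  also have "\<dots> = (q\<^sup>2) ^ i \<odot>\<^bsub>plane.Q\<^esub> (plane.cls (word [Plane_x]) \<otimes>\<^bsub>plane.Q\<^esub> plane.cls (word ?u))"
    by (simp add: Suc.IH plane.Q.smult_mult_right)
  also have "plane.cls (word [Plane_x]) \<otimes>\<^bsub>plane.Q\<^esub> plane.cls (word ?u) = plane.cls (word (Plane_x # ?u))"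
    by (simp flip: plane.cls_word_append)
  finally show ?case
    by (simp add: plane.Q.smult_smult)
qed

lemma plane_monomials_span:
  "carrier plane.Q \<subseteq> additive_span plane.Q {c \<odot>\<^bsub>plane.Q\<^esub> plane_monomial i j | c i j. True}"
  (is "_ \<subseteq> additive_span _ ?T")
proof (rule plane.carrier_subset_additive_span)
  show "?T \<subseteq> carrier plane.Q"
    by auto
  show "plane.cls (Poly_Mapping.single [] c) \<in> additive_span plane.Q ?T" for c
  proof -
    have "plane.cls (Poly_Mapping.single [] c) = c \<odot>\<^bsub>plane.Q\<^esub> plane_monomial 0 0"
      by (simp add: plane_monomial_def word_def plane.cls_single_smult)
    then show ?thesis
      by (intro additive_span.base) blast
  qed
  fix g t assume "t \<in> ?T"
  then obtain c i j where t: "t = c \<odot>\<^bsub>plane.Q\<^esub> plane_monomial i j"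
    by blast
  have "\<exists>c' i' j'. plane.cls (word [g]) \<otimes>\<^bsub>plane.Q\<^esub> plane_monomial i j =
      c' \<odot>\<^bsub>plane.Q\<^esub> plane_monomial i' j'"
  proof (cases g)
    case Plane_x
    have "plane.cls (word [g]) \<otimes>\<^bsub>plane.Q\<^esub> plane_monomial i j = 1 \<odot>\<^bsub>plane.Q\<^esub> plane_monomial (Suc i) j"
      by (simp add: Plane_x plane_monomial_def plane.Q.smult_one flip: plane.cls_word_append)
    then show ?thesis
      by blast
  next
    case Plane_y
    have "plane.cls (word [g]) \<otimes>\<^bsub>plane.Q\<^esub> plane_monomial i j =
        (q\<^sup>2) ^ i \<odot>\<^bsub>plane.Q\<^esub> plane_monomial i (Suc j)"
      by (simp add: Plane_y plane_monomial_def y_times_plane_word flip: plane.cls_word_append)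
    then show ?thesis
      by blast
  qed
  then obtain c' i' j' where "plane.cls (word [g]) \<otimes>\<^bsub>plane.Q\<^esub> plane_monomial i j =
      c' \<odot>\<^bsub>plane.Q\<^esub> plane_monomial i' j'"
    by blast
  then have "plane.cls (word [g]) \<otimes>\<^bsub>plane.Q\<^esub> t = (c * c') \<odot>\<^bsub>plane.Q\<^esub> plane_monomial i' j'"
    by (simp add: t plane.Q.smult_mult_right plane.Q.smult_smult)
  then show "plane.cls (word [g]) \<otimes>\<^bsub>plane.Q\<^esub> t \<in> additive_span plane.Q ?T"
    by (intro additive_span.base) blast
qed

definition plane_image :: "plane_gen \<Rightarrow> (int \<times> int \<Rightarrow>\<^sub>0 complex poly fract)" where
  "plane_image g = (case g of
     Plane_x \<Rightarrow> Poly_Mapping.single (1, 0) 1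
   | Plane_y \<Rightarrow> Poly_Mapping.single (0, 1) 1)"

lemma plane_image_simps [simp]:
  "plane_image Plane_x = Poly_Mapping.single (1, 0) 1"
  "plane_image Plane_y = Poly_Mapping.single (0, 1) 1"
  by (simp_all add: plane_image_def)

definition plane_hom :: "(plane_gen list \<Rightarrow>\<^sub>0 complex) set \<Rightarrow> (int \<times> int \<Rightarrow>\<^sub>0 complex poly fract)" where
  "plane_hom = quotient_lift (monoid_algebra_lift T (word_product T plane_image))"

lemma plane_relations_hold:
  assumes "(l, r) \<in> plane_relations"
  shows "monoid_algebra_lift T (word_product T plane_image) l =
    monoid_algebra_lift T (word_product T plane_image) r"
  using assms by (simp add: plane_relations_def tmult_single scalar_hom)

lemma plane_hom: "plane_hom \<in> algebra_hom plane.Q T"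
  and plane_hom_word: "plane_hom (plane.cls (word w)) = word_product T plane_image w"
  unfolding plane_hom_def
  using plane.hom_from_generators[OF torus.type_based_algebra_axioms plane_relations_hold] by auto

lemma plane_hom_monomial: "plane_hom (plane_monomial i j) = Poly_Mapping.single (int i, int j) 1"
proof -
  have y: "word_product T plane_image (replicate j Plane_y) = Poly_Mapping.single (0, int j) 1"
    by (induction j) (simp_all add: tmult_single scalar_hom)
  have "word_product T plane_image (replicate i Plane_x @ replicate j Plane_y) =
      Poly_Mapping.single (int i, int j) 1"
    by (induction i) (simp_all add: y tmult_single scalar_hom)
  then show ?thesis
    by (simp add: plane_monomial_def plane_hom_word)
qed

abbreviation pure_tensors :: "(complex poly fract \<times> (plane_gen list \<Rightarrow>\<^sub>0 complex) set) monoid" where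
  "pure_tensors \<equiv> rational_functions \<times>\<times> plane.Q"

definition bilinearity_relations ::
    "(complex poly fract \<times> (plane_gen list \<Rightarrow>\<^sub>0 complex) set \<Rightarrow>\<^sub>0 complex) set" where
  "bilinearity_relations =
     {Poly_Mapping.single (k \<oplus>\<^bsub>rational_functions\<^esub> k', b) 1
         - (Poly_Mapping.single (k, b) 1 + Poly_Mapping.single (k', b) 1) | k k' b.
         k \<in> carrier rational_functions \<and> k' \<in> carrier rational_functions \<and> b \<in> carrier plane.Q}
      \<union> {Poly_Mapping.single (k, b \<oplus>\<^bsub>plane.Q\<^esub> b') 1
           - (Poly_Mapping.single (k, b) 1 + Poly_Mapping.single (k, b') 1) | k b b'.
           k \<in> carrier rational_functions \<and> b \<in> carrier plane.Q \<and> b' \<in> carrier plane.Q}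
      \<union> {Poly_Mapping.single (c \<odot>\<^bsub>rational_functions\<^esub> k, b) 1 - Poly_Mapping.single (k, b) c | c k b.
           k \<in> carrier rational_functions \<and> b \<in> carrier plane.Q}
      \<union> {Poly_Mapping.single (k, c \<odot>\<^bsub>plane.Q\<^esub> b) 1 - Poly_Mapping.single (k, b) c | c k b.
           k \<in> carrier rational_functions \<and> b \<in> carrier plane.Q}"

lemma bilinearity_relation_cases:
  assumes "s \<in> bilinearity_relations"
  obtains (add_left) k k' b where "b \<in> carrier plane.Q"
      "s = Poly_Mapping.single (k + k', b) 1 - (Poly_Mapping.single (k, b) 1 + Poly_Mapping.single (k', b) 1)"
    | (add_right) k b b' where "b \<in> carrier plane.Q" "b' \<in> carrier plane.Q"
      "s = Poly_Mapping.single (k, b \<oplus>\<^bsub>plane.Q\<^esub> b') 1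
         - (Poly_Mapping.single (k, b) 1 + Poly_Mapping.single (k, b') 1)"
    | (scale_left) c k b where "b \<in> carrier plane.Q"
      "s = Poly_Mapping.single (scalar c * k, b) 1 - Poly_Mapping.single (k, b) c"
    | (scale_right) c k b where "b \<in> carrier plane.Q"
      "s = Poly_Mapping.single (k, c \<odot>\<^bsub>plane.Q\<^esub> b) 1 - Poly_Mapping.single (k, b) c"
  using assms
  unfolding bilinearity_relations_def Un_iff mem_Collect_eq rational_functions_simps
  by (elim disjE exE conjE) (rule add_left add_right scale_left scale_right; assumption)+

lemma bilinearity_relationsI:
  assumes "b \<in> carrier plane.Q" "b' \<in> carrier plane.Q"
  shows "Poly_Mapping.single (k, b \<oplus>\<^bsub>plane.Q\<^esub> b') 1
         - (Poly_Mapping.single (k, b) 1 + Poly_Mapping.single (k, b') 1) \<in> bilinearity_relations"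
    and "Poly_Mapping.single (k + k', b) 1
         - (Poly_Mapping.single (k, b) 1 + Poly_Mapping.single (k', b) 1) \<in> bilinearity_relations"
    and "Poly_Mapping.single (scalar c * k, b) 1 - Poly_Mapping.single (k, b) c \<in> bilinearity_relations"
    and "Poly_Mapping.single (k, c \<odot>\<^bsub>plane.Q\<^esub> b) 1 - Poly_Mapping.single (k, b) c \<in> bilinearity_relations"
  using assms unfolding bilinearity_relations_def rational_functions_simps by blast+

sublocale tensor: monoid_algebra_quotient pure_tensors bilinearity_relations
proof -
  interpret monoid pure_tensors
    by (rule DirProd_monoid[OF monoid_rational_functions plane.Q.monoid_axioms])
  have "Poly_Mapping.keys s \<subseteq> carrier pure_tensors" if "s \<in> bilinearity_relations" for s
    using that
    by (cases rule: bilinearity_relation_cases)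
      (simp_all add: keys_diff_subset keys_add_subset keys_single_subset del: keys_single)
  then show "monoid_algebra_quotient pure_tensors bilinearity_relations"
    by unfold_locales blast
qed

lemma tensor_product_eq:
  "tensor_algebra_product rational_functions (quantum_plane (q\<^sup>2)) = tensor.Q"
  unfolding tensor_algebra_product_def quantum_plane_eq bilinearity_relations_def ..

definition tensor_image ::
    "complex poly fract \<times> (plane_gen list \<Rightarrow>\<^sub>0 complex) set \<Rightarrow> (int \<times> int \<Rightarrow>\<^sub>0 complex poly fract)" where
  "tensor_image = (\<lambda>(k, b). Poly_Mapping.map ((*) k) (plane_hom b))"

definition tensor_embedding ::
    "(complex poly fract \<times> (plane_gen list \<Rightarrow>\<^sub>0 complex) set \<Rightarrow>\<^sub>0 complex) set \<Rightarrow>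
       (int \<times> int \<Rightarrow>\<^sub>0 complex poly fract)" where
  "tensor_embedding = quotient_lift (monoid_algebra_lift T tensor_image)"

lemma tensor_image_mult:
  assumes "v \<in> carrier pure_tensors" "w \<in> carrier pure_tensors"
  shows "tensor_image (v \<otimes>\<^bsub>pure_tensors\<^esub> w) = tensor_image v \<otimes>\<^bsub>T\<^esub> tensor_image w"
proof -
  obtain k b k' b' where vw: "v = (k, b)" "w = (k', b')"
    by (cases v; cases w)
  then have "plane_hom (b \<otimes>\<^bsub>plane.Q\<^esub> b') = plane_hom b \<star> plane_hom b'"
    using assms algebra_homD(2)[OF plane_hom] by simp
  then show ?thesis
    by (simp add: vw tensor_image_def twisted_mult_scale map_mult_map_mult mult.commute)
qed

lemma tensor_image_one: "tensor_image \<one>\<^bsub>pure_tensors\<^esub> = \<one>\<^bsub>T\<^esub>"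
  using algebra_homD(4)[OF plane_hom] by (simp add: tensor_image_def)

lemma bilinearity_relations_hold:
  assumes "s \<in> bilinearity_relations"
  shows "monoid_algebra_lift T tensor_image s = 0"
  using assms
proof (cases rule: bilinearity_relation_cases)
  case add_left
  then show ?thesis
    by (simp add: torus.monoid_algebra_lift_diff torus.monoid_algebra_lift_add map_scalar_one
        tensor_image_def map_mult_add_left)
next
  case add_right
  then show ?thesis
    using algebra_homD(3)[OF plane_hom]
    by (simp add: torus.monoid_algebra_lift_diff torus.monoid_algebra_lift_add map_scalar_one
        tensor_image_def map_mult_add)
next
  case scale_left
  then show ?thesis
    by (simp add: torus.monoid_algebra_lift_diff map_scalar_one tensor_image_def map_mult_map_mult
        scalar_hom(3))
next
  case scale_right
  then show ?thesis
    using algebra_homD(5)[OF plane_hom]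
    by (simp add: torus.monoid_algebra_lift_diff map_scalar_one tensor_image_def map_mult_map_mult
        scalar_hom(3) mult.commute)
qed

lemma tensor_embedding_hom: "tensor_embedding \<in> algebra_hom tensor.Q T"
  unfolding tensor_embedding_def
  by (rule tensor.quotient_hom_to_type_based(1)[OF torus.type_based_algebra_axioms
        tensor_image_mult tensor_image_one bilinearity_relations_hold])

definition pure_tensor ::
    "complex poly fract \<Rightarrow> (plane_gen list \<Rightarrow>\<^sub>0 complex) set \<Rightarrow>
      (complex poly fract \<times> (plane_gen list \<Rightarrow>\<^sub>0 complex) set \<Rightarrow>\<^sub>0 complex) set" where
  "pure_tensor k b = tensor.cls (Poly_Mapping.single (k, b) 1)"

lemma pure_tensor_closed [simp]: "b \<in> carrier plane.Q \<Longrightarrow> pure_tensor k b \<in> carrier tensor.Q"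
  by (simp add: pure_tensor_def)

lemma tensor_embedding_pure:
  assumes "b \<in> carrier plane.Q"
  shows "tensor_embedding (pure_tensor k b) = Poly_Mapping.map ((*) k) (plane_hom b)"
proof -
  have kb: "(k, b) \<in> carrier pure_tensors"
    using assms by simp
  have "tensor_embedding (tensor.cls (Poly_Mapping.single (k, b) 1)) = 1 \<odot>\<^bsub>T\<^esub> tensor_image (k, b)"
    unfolding tensor_embedding_def
    by (rule tensor.quotient_hom_to_type_based(2)[OF torus.type_based_algebra_axioms
          tensor_image_mult tensor_image_one bilinearity_relations_hold kb])
  then show ?thesis
    by (simp add: pure_tensor_def tensor_image_def map_scalar_one)
qed

lemma pure_tensor_add_left:
  assumes "b \<in> carrier plane.Q"
  shows "pure_tensor (k + k') b = pure_tensor k b \<oplus>\<^bsub>tensor.Q\<^esub> pure_tensor k' b"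
proof -
  have "pure_tensor (k + k') b =
      tensor.cls (Poly_Mapping.single (k, b) 1 + Poly_Mapping.single (k', b) 1)"
    unfolding pure_tensor_def using bilinearity_relationsI(2)[OF assms assms] assms
    by (intro tensor.cls_eq_if_relation) (simp_all add: keys_add_subset keys_single_subset del: keys_single)
  then show ?thesis
    using assms by (simp add: pure_tensor_def tensor.cls_add keys_single_subset del: keys_single)
qed

lemma pure_tensor_add_right:
  assumes "b \<in> carrier plane.Q" "b' \<in> carrier plane.Q"
  shows "pure_tensor k (b \<oplus>\<^bsub>plane.Q\<^esub> b') = pure_tensor k b \<oplus>\<^bsub>tensor.Q\<^esub> pure_tensor k b'"
proof -
  have "pure_tensor k (b \<oplus>\<^bsub>plane.Q\<^esub> b') =
      tensor.cls (Poly_Mapping.single (k, b) 1 + Poly_Mapping.single (k, b') 1)"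
    unfolding pure_tensor_def using bilinearity_relationsI(1)[OF assms] assms
    by (intro tensor.cls_eq_if_relation) (simp_all add: keys_add_subset keys_single_subset del: keys_single)
  then show ?thesis
    using assms by (simp add: pure_tensor_def tensor.cls_add keys_single_subset del: keys_single)
qed

lemma pure_tensor_scale_left:
  assumes "b \<in> carrier plane.Q"
  shows "pure_tensor (scalar c * k) b = tensor.cls (Poly_Mapping.single (k, b) c)"
  unfolding pure_tensor_def using bilinearity_relationsI(3)[OF assms assms] assms
  by (intro tensor.cls_eq_if_relation) (simp_all add: keys_single_subset del: keys_single)

lemma pure_tensor_scale_right:
  assumes "b \<in> carrier plane.Q"
  shows "pure_tensor k (c \<odot>\<^bsub>plane.Q\<^esub> b) = tensor.cls (Poly_Mapping.single (k, b) c)"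
  unfolding pure_tensor_def using bilinearity_relationsI(4)[OF assms assms] assms
  by (intro tensor.cls_eq_if_relation) (simp_all add: keys_single_subset del: keys_single)

definition normal_tensor :: "nat \<times> nat \<Rightarrow> complex poly fract \<Rightarrow>
      (complex poly fract \<times> (plane_gen list \<Rightarrow>\<^sub>0 complex) set \<Rightarrow>\<^sub>0 complex) set" where
  "normal_tensor m k = pure_tensor k (plane_monomial (fst m) (snd m))"

text \<open>
  A pure tensor is additive in its second factor, and scalars move to its first factor. So the
  spanning monomials of the quantum plane suffice there.
\<close>
lemma normal_tensors_span:
  "carrier tensor.Q \<subseteq> additive_span tensor.Q {normal_tensor m k | m k. True}"
  (is "_ \<subseteq> additive_span _ ?T")
proof
  have pure: "pure_tensor k b \<in> additive_span tensor.Q ?T" if b: "b \<in> carrier plane.Q" for k b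
  proof -
    let ?U = "{c \<odot>\<^bsub>plane.Q\<^esub> plane_monomial i j | c i j. True}"
    have U: "?U \<subseteq> carrier plane.Q"
      by auto
    have "b \<in> additive_span plane.Q ?U"
      using plane_monomials_span b by blast
    then show ?thesis
    proof induction
      case zero
      have "pure_tensor k \<zero>\<^bsub>plane.Q\<^esub> \<oplus>\<^bsub>tensor.Q\<^esub> pure_tensor k \<zero>\<^bsub>plane.Q\<^esub> = pure_tensor k \<zero>\<^bsub>plane.Q\<^esub>"
        by (simp flip: pure_tensor_add_right)
      then have "pure_tensor k \<zero>\<^bsub>plane.Q\<^esub> = \<zero>\<^bsub>tensor.Q\<^esub>"
        by simp
      then show ?case
        by (simp add: additive_span.zero)
    next
      case (base s)
      then obtain c i j where s: "s = c \<odot>\<^bsub>plane.Q\<^esub> plane_monomial i j"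
        by blast
      have "pure_tensor k s = normal_tensor (i, j) (scalar c * k)"
        by (simp add: s normal_tensor_def pure_tensor_scale_left pure_tensor_scale_right)
      then show ?case
        by (intro additive_span.base) blast
    next
      case (add x y)
      then show ?case
        using plane.Q.additive_span_closed[OF U]
        by (simp add: pure_tensor_add_right additive_span.add)
    qed
  qed
  show "x \<in> additive_span tensor.Q ?T" if "x \<in> carrier tensor.Q" for x
    using that
  proof (induction rule: tensor.Q_induct)
    case (single kb c)
    obtain k b where kb: "kb = (k, b)"
      by (cases kb)
    with single have "b \<in> carrier plane.Q"
      by simp
    then show ?case
      using pure[of b "scalar c * k"] by (simp add: kb pure_tensor_scale_left)
  qed (simp_all add: additive_span.zero additive_span.add)
qed

lemma tensor_embedding_normal:
  "tensor_embedding (normal_tensor m k) = Poly_Mapping.single (int (fst m), int (snd m)) k"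
  by (simp add: normal_tensor_def tensor_embedding_pure plane_hom_monomial)

text \<open>Distinct pairs \<open>(i, j)\<close> give distinct monomials of the torus.\<close>
lemma tensor_embedding_inj: "inj_on tensor_embedding (carrier tensor.Q)"
proof (rule tensor.Q.inj_on_if_independent_family[where e = normal_tensor])
  show "\<forall>m \<in> J. d m = 0" if J: "finite J" "(\<Sum>m \<in> J. tensor_embedding (normal_tensor m (d m))) = 0" for J d
  proof
    fix m assume m: "m \<in> J"
    have "0 = (\<Sum>n \<in> J. Poly_Mapping.lookup (tensor_embedding (normal_tensor n (d n)))
        (int (fst m), int (snd m)))"
      using J(2) by (simp flip: lookup_sum)
    also have "\<dots> = (\<Sum>n \<in> J. if n = m then d m else 0)"
      by (intro sum.cong refl)
        (auto simp: tensor_embedding_normal lookup_single when_def prod_eq_iff)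
    also have "\<dots> = d m"
      using J(1) m by simp
    finally show "d m = 0"
      by simp
  qed
qed (use normal_tensors_span algebra_homD(3)[OF tensor_embedding_hom] in
    \<open>auto simp: normal_tensor_def pure_tensor_add_left\<close>)

lemma dense_embedding_tensor: "dense_embedding tensor.Q T tensor_embedding"
proof (rule dense_embedding_if_monomials[OF tensor.Q.complex_algebra_axioms
      tensor_embedding_hom tensor_embedding_inj])
  show "Poly_Mapping.single (int i, int j) (to_fract p) \<in> tensor_embedding ` carrier tensor.Q" for i j p
    using tensor_embedding_normal[of "(i, j)" "to_fract p"]
    by (auto simp: normal_tensor_def intro!: image_eqI[OF sym])
qed

end

theorem corollary2:
  fixes q :: complex
  assumes "q \<noteq> 0"
    and "\<And>n::nat. n > 0 \<Longrightarrow> q ^ n \<noteq> 1"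
  shows "algebra_isomorphic
    (skew_frac (O_so3 q))
    (skew_frac (tensor_algebra_product rational_functions (quantum_plane (q\<^sup>2))))"
proof -
  interpret quantum_parameter q
    by unfold_locales fact
  show ?thesis
    unfolding O_so3_eq gwa.presented_algebra_eq tensor_product_eq
    by (rule skew_frac_isomorphic_if_dense_embeddings[OF dense_embedding_gwa
          dense_embedding_tensor])
qed

end
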